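(* Assume the setting and assumptions (R1), (R2) of the context, and suppose moreover that for every $k\ge1$ the kernel $\Gamma_k$ of (R1) has uniformly finite support, i.e. $\sup_{f\in\mathcal{B}(S^{(k)})}\mathrm{Card}(\mathrm{Supp}(\Gamma_k(f,\cdot)))<\infty$. Let $m\ge1$. Then there exists a finite constant $\overline{\sigma}_m\in(0,\infty)$ such that for any $f\in\mathcal{B}_1(E_m)$ and any $t>0$, $$\limsup_{n\to\infty}\frac1n\log\mathbb{P}\left(\left|\left[\overline{\eta}^{[m]}_n-\overline{\pi}^{[m]}\right](f)\right|>t\right)<-\frac{t^2}{2\overline{\sigma}_m^2}.$$
   Context: Notation. For a measurable space $S$: $\mathcal{P}(S)$ is the set of probability measures on $S$; $\mathcal{B}(S)$ the bounded measurable real functions with the sup norm $\|\cdot\|$; $\mathcal{B}_1(S)$ its unit ball; $\mathrm{osc}(f)=\sup_{x,y}|f(x)-f(y)|$; $\mathrm{Osc}_1(S)$ the measurable functions with $\mathrm{osc}(f)\le 1$. $\mu(f)=\int f\,d\mu$, and for a finite signed measure $\|\mu\|=\sup_{f\in\mathcal{B}_1(S)}|\mu(f)|$. For a bounded integral operator $M$, $M(f)(x)=\int M(x,dy)f(y)$, $(\mu M)(f)=\mu(M(f))$, $\|M\|=\sup_{f\in\mathcal{B}_1}\|M(f)\|$, and if $M$ is Markov, $\beta(M)=\sup\{\mathrm{osc}(M(f)):f\in\mathrm{Osc}_1\}$. Setting (interacting MCMC). $(S^{(l)})_{l\ge0}$ are measurable spaces, $\pi^{(0)}\in\mathcal{P}(S^{(0)})$,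 $\Phi_l:\mathcal{P}(S^{(l-1)})\to\mathcal{P}(S^{(l)})$ for $l\ge1$, and $\pi^{(l)}=\Phi_l(\pi^{(l-1)})$. $M^{(0)}$ is a Markov transition on $S^{(0)}$ with $\pi^{(0)}M^{(0)}=\pi^{(0)}$; for $l\ge1$ and $\mu\in\mathcal{P}(S^{(l-1)})$, $M^{(l)}_\mu$ is a Markov transition on $S^{(l)}$ with $\Phi_l(\mu)M^{(l)}_\mu=\Phi_l(\mu)$. Convention: $M^{(0)}_\mu=M^{(0)}$. Let $\nu_k\in\mathcal{P}(S^{(k)})$, $k\ge0$, be given. $X^{(0)}=(X^{(0)}_n)_{n\ge0}$ is a Markov chain with initial law $\nu_0$ and transition $M^{(0)}$. For $k\ge1$, given $X^{(k-1)}$, $X^{(k)}=(X^{(k)}_n)_{n\geq 0}$ is a Markov chain with initial law $\nu_k$ and $$\mathbb{P}(X^{(k)}_{n+1}\in dx\mid X^{(k-1)},X^{(k)}_n)=M^{(k)}_{\eta^{(k-1)}_n}(X^{(k)}_n,dx),\qquad \eta^{(k)}_n=\frac1{n+1}\sum_{p=0}^n\delta_{X^{(k)}_p}.$$ For $m\ge 1$ let $E_m=S^{(0)}\times\cdots\times S^{(m)}$ and $\overline{X}^m_n=(X^{(0)}_n,\ldots,X^{(m)}_n)$. The process $\overline X^m$ is $E_m$-valued with, given its past up to time $n$, transition $\prod_{0\le l\le m}M^{(l)}_{\eta_n^{(l-1)}}(x^l,dy^l)$ from $x=(x^0,\dots,x^m)$. Put $\overline{\eta}^{[m]}_n=\frac1{n+1}\sum_{p=0}^n\delta_{\overline{X}^m_p}$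 and $\overline{\pi}^{[m]}=\pi^{(0)}\otimes\cdots\otimes\pi^{(m)}$. Standing regularity assumptions. (R1) For each $l\ge1$ there is a kernel $\Gamma_l$ from $\mathcal{B}(S^{(l)})$ into $\mathcal{B}(S^{(l-1)})$ and $\Lambda_l<\infty$ such that for all $f\in\mathcal{B}(S^{(l)})$, $\mu,\nu\in\mathcal{P}(S^{(l-1)})$: $|[\Phi_l(\mu)-\Phi_l(\nu)](f)|\le\int|[\mu-\nu](g)|\,\Gamma_l(f,dg)$ and $\int\Gamma_l(f,dg)\|g\|\le\Lambda_l\|f\|$. (R2) For each $l\ge0$ there are an integer $n_l\ge0$ and a finite constant $c_l$ with $\|M^{(l)}_\mu-M^{(l)}_\nu\|\le c_l\|\mu-\nu\|$ for all $\mu,\nu\in\mathcal{P}(S^{(l-1)})$, and $b_l(n_l):=\sup_{\mu}\beta((M^{(l)}_\mu)^{n_l})<1$ (for $l=0$, $M^{(0)}_\mu=M^{(0)}$). *)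

theory Defs
  imports "HOL-Probability.Probability"
begin

text \<open>
  A measurable space is an Isabelle measure whose measure part is ignored; the probability
  measures on \<open>S\<close> are the elements of \<^term>\<open>space (prob_algebra S)\<close>.
  All suprema below are real suprema of nonempty sets that are bounded above, as soon as
  \<open>S\<close> is nonempty and the arguments are bounded functions, probability measures and
  Markov transitions.
\<close>

subsection \<open>Bounded measurable functions\<close>

text \<open>
  Functions are normalised to be extensional, so that two elements of \<open>bmeas S\<close> are equal
  iff they agree on the points of \<open>S\<close>. This matters where elements are counted
  (cardinality of a support) and makes \<open>sup_norm\<close> a norm rather than a seminorm.
\<close>

definition bmeas :: "'a measure \<Rightarrow> ('a \<Rightarrow> real) set" where
  "bmeas S = {f \<in> borel_measurable S. bounded (f ` space S) \<and> f \<in> extensional (space S)}"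

definition sup_norm :: "'a measure \<Rightarrow> ('a \<Rightarrow> real) \<Rightarrow> real" where
  "sup_norm S f = (SUP x\<in>space S. \<bar>f x\<bar>)"

definition bmeas1 :: "'a measure \<Rightarrow> ('a \<Rightarrow> real) set" where
  "bmeas1 S = {f \<in> bmeas S. sup_norm S f \<le> 1}"

definition osc :: "'a measure \<Rightarrow> ('a \<Rightarrow> real) \<Rightarrow> real" where
  "osc S f = (SUP (x, y)\<in>space S \<times> space S. \<bar>f x - f y\<bar>)"

text \<open>
  Functions of finite oscillation are bounded; membership in \<open>bmeas S\<close> is required explicitly
  because the real supremum in \<open>osc\<close> is meaningless for unbounded functions.
\<close>

definition Osc1 :: "'a measure \<Rightarrow> ('a \<Rightarrow> real) set" where
  "Osc1 S = {f \<in> bmeas S. osc S f \<le> 1}"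

text \<open>The norm \<open>\<parallel>\<mu> - \<nu>\<parallel>\<close> of the signed measure \<open>\<mu> - \<nu>\<close>.\<close>

definition meas_dist :: "'a measure \<Rightarrow> 'a measure \<Rightarrow> 'a measure \<Rightarrow> real" where
  "meas_dist S \<mu> \<nu> = (SUP f\<in>bmeas1 S. \<bar>integral\<^sup>L \<mu> f - integral\<^sup>L \<nu> f\<bar>)"

subsection \<open>Markov transitions\<close>

definition kernel_op :: "'a measure \<Rightarrow> ('a \<Rightarrow> 'a measure) \<Rightarrow> ('a \<Rightarrow> real) \<Rightarrow> 'a \<Rightarrow> real" where
  "kernel_op S K f = (\<lambda>x\<in>space S. \<integral>y. f y \<partial>K x)"

text \<open>The operator norm \<open>\<parallel>K - L\<parallel>\<close>.\<close>

definition op_dist :: "'a measure \<Rightarrow> ('a \<Rightarrow> 'a measure) \<Rightarrow> ('a \<Rightarrow> 'a measure) \<Rightarrow> real" where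
  "op_dist S K L = (SUP f\<in>bmeas1 S. sup_norm S (\<lambda>x. kernel_op S K f x - kernel_op S L f x))"

definition dobrushin :: "'a measure \<Rightarrow> ('a \<Rightarrow> 'a measure) \<Rightarrow> real" where
  "dobrushin S K = (SUP f\<in>Osc1 S. osc S (kernel_op S K f))"

primrec kernel_pow :: "'a measure \<Rightarrow> ('a \<Rightarrow> 'a measure) \<Rightarrow> nat \<Rightarrow> 'a \<Rightarrow> 'a measure" where
  "kernel_pow S K 0 = return S"
| "kernel_pow S K (Suc n) = (\<lambda>x. bind (K x) (kernel_pow S K n))"

subsection \<open>Kernels between function spaces\<close>

text \<open>
  The distance of the sup norm; it is set to 0 outside \<open>bmeas S\<close> only because
  \<^locale>\<open>Metric_space\<close> asks for nonnegativity on the whole type.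
\<close>

definition bmeas_dist :: "'a measure \<Rightarrow> ('a \<Rightarrow> real) \<Rightarrow> ('a \<Rightarrow> real) \<Rightarrow> real" where
  "bmeas_dist S f g =
     (if f \<in> bmeas S \<and> g \<in> bmeas S then sup_norm S (\<lambda>x. f x - g x) else 0)"

abbreviation bmeas_topology :: "'a measure \<Rightarrow> ('a \<Rightarrow> real) topology" where
  "bmeas_topology S \<equiv> Metric_space.mtopology (bmeas S) (bmeas_dist S)"

definition bmeas_borel :: "'a measure \<Rightarrow> ('a \<Rightarrow> real) measure" where
  "bmeas_borel S = sigma (bmeas S) {U. openin (bmeas_topology S) U}"

definition bmeas_kernel ::
    "'a measure \<Rightarrow> 'b measure \<Rightarrow> (('a \<Rightarrow> real) \<Rightarrow> ('b \<Rightarrow> real) measure) \<Rightarrow> bool" where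
  "bmeas_kernel S T \<Gamma> \<longleftrightarrow>
     (\<forall>f\<in>bmeas S. sets (\<Gamma> f) = sets (bmeas_borel T)) \<and>
     (\<forall>U\<in>sets (bmeas_borel T). (\<lambda>f. emeasure (\<Gamma> f) U) \<in> borel_measurable (bmeas_borel S))"

definition full_closed :: "'a measure \<Rightarrow> ('a \<Rightarrow> real) measure \<Rightarrow> ('a \<Rightarrow> real) set \<Rightarrow> bool" where
  "full_closed S \<gamma> C \<longleftrightarrow> closedin (bmeas_topology S) C \<and> emeasure \<gamma> (bmeas S - C) = 0"

text \<open>
  The support is the smallest closed set of full measure. As the space of bounded functions is
  not separable in general, the intersection of all closed sets of full measure need not have
  full measure itself; this is therefore part of the definition of a finite support.
\<close>

definition supp :: "'a measure \<Rightarrow> ('a \<Rightarrow> real) measure \<Rightarrow> ('a \<Rightarrow> real) set" where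
  "supp S \<gamma> = \<Inter>{C. full_closed S \<gamma> C}"

definition uniformly_finite_support ::
    "'a measure \<Rightarrow> 'b measure \<Rightarrow> (('a \<Rightarrow> real) \<Rightarrow> ('b \<Rightarrow> real) measure) \<Rightarrow> bool" where
  "uniformly_finite_support S T \<Gamma> \<longleftrightarrow>
     (\<exists>N::nat. \<forall>f\<in>bmeas S.
        full_closed T (\<Gamma> f) (supp T (\<Gamma> f)) \<and> finite (supp T (\<Gamma> f)) \<and> card (supp T (\<Gamma> f)) \<le> N)"

subsection \<open>Processes\<close>

text \<open>The empirical measure \<open>(\<delta>\<^bsub>u 0\<^esub> + \<dots> + \<delta>\<^bsub>u n\<^esub>) / (n + 1)\<close> on \<open>S\<close>.\<close>

definition empirical :: "'a measure \<Rightarrow> nat \<Rightarrow> (nat \<Rightarrow> 'a) \<Rightarrow> 'a measure" where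
  "empirical S n u = distr (uniform_count_measure {..n}) S u"

text \<open>The \<open>\<sigma>\<close>-algebra generated by the variables \<open>X k p\<close> with \<open>(k, p) \<in> I\<close>.\<close>

definition generated_by ::
    "'w measure \<Rightarrow> (nat \<Rightarrow> 'a measure) \<Rightarrow> (nat \<Rightarrow> nat \<Rightarrow> 'w \<Rightarrow> 'a) \<Rightarrow> (nat \<times> nat) set \<Rightarrow> 'w measure" where
  "generated_by P S X I =
     sigma (space P) (\<Union>(k, p)\<in>I. {X k p -` A \<inter> space P | A. A \<in> sets (S k)})"

text \<open>Given \<open>F\<close>, the conditional law of the \<open>T\<close>-valued random variable \<open>Y\<close> is \<open>\<kappa>\<close>.\<close>

definition cond_law ::
    "'w measure \<Rightarrow> 'w measure \<Rightarrow> 'b measure \<Rightarrow> ('w \<Rightarrow> 'b) \<Rightarrow> ('w \<Rightarrow> 'b measure) \<Rightarrow> bool" where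
  "cond_law P F T Y \<kappa> \<longleftrightarrow>
     (\<forall>A\<in>sets T. AE \<omega> in P.
        real_cond_exp P F (indicator (Y -` A \<inter> space P)) \<omega> = measure (\<kappa> \<omega>) A)"

definition level_empirical ::
    "(nat \<Rightarrow> 'a measure) \<Rightarrow> (nat \<Rightarrow> nat \<Rightarrow> 'w \<Rightarrow> 'a) \<Rightarrow> nat \<Rightarrow> nat \<Rightarrow> 'w \<Rightarrow> 'a measure" where
  "level_empirical S X k n \<omega> = empirical (S k) n (\<lambda>p. X k p \<omega>)"

definition joint :: "(nat \<Rightarrow> nat \<Rightarrow> 'w \<Rightarrow> 'a) \<Rightarrow> nat \<Rightarrow> nat \<Rightarrow> 'w \<Rightarrow> nat \<Rightarrow> 'a" where
  "joint X m n \<omega> = (\<lambda>l\<in>{..m}. X l n \<omega>)"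

text \<open>
  The process on a probability space \<open>P\<close>. The transition family \<open>M\<close> is such that \<open>M 0 \<mu>\<close> does
  not depend on \<open>\<mu>\<close>, so that the value of the index \<open>k - 1\<close> at \<open>k = 0\<close> is irrelevant there.
  The third clause says that the transition \<open>M k \<eta>\<close>, where \<open>\<eta>\<close> is the empirical measure of
  \<open>u 0, \<dots>, u n\<close>, is a transition probability from past and current state, i.e.\ is jointly
  measurable in \<open>(u, x)\<close>. Two clauses follow on the level-0 chain, then two on the chain of
  level \<open>k \<ge> 1\<close> given the whole path of level \<open>k - 1\<close>. The last clause says that, given their
  common past, the levels \<open>0, \<dots>, m\<close> move independently; it is what excludes any further
  dependence of level \<open>k\<close> on levels below \<open>k - 1\<close>.
\<close>

definition interacting_mcmc ::
    "'w measure \<Rightarrow> (nat \<Rightarrow> 'a measure) \<Rightarrow> (nat \<Rightarrow> 'a measure \<Rightarrow> 'a \<Rightarrow> 'a measure)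
      \<Rightarrow> (nat \<Rightarrow> 'a measure) \<Rightarrow> (nat \<Rightarrow> nat \<Rightarrow> 'w \<Rightarrow> 'a) \<Rightarrow> bool" where
  "interacting_mcmc P S M \<nu> X \<longleftrightarrow>
     prob_space P \<and>
     (\<forall>k n. X k n \<in> P \<rightarrow>\<^sub>M S k) \<and>
     (\<forall>k n. (\<lambda>(u, x). M k (empirical (S (k - 1)) n u) x)
        \<in> (\<Pi>\<^sub>M p\<in>{..n}. S (k - 1)) \<Otimes>\<^sub>M S k \<rightarrow>\<^sub>M prob_algebra (S k)) \<and>
     distr P (S 0) (X 0 0) = \<nu> 0 \<and>
     (\<forall>n. cond_law P (generated_by P S X ({0} \<times> {..n})) (S 0) (X 0 (Suc n))
        (\<lambda>\<omega>. M 0 (level_empirical S X 0 n \<omega>) (X 0 n \<omega>))) \<and>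
     (\<forall>k\<ge>1. cond_law P (generated_by P S X ({k - 1} \<times> UNIV)) (S k) (X k 0) (\<lambda>\<omega>. \<nu> k)) \<and>
     (\<forall>k\<ge>1. \<forall>n. cond_law P (generated_by P S X ({k - 1} \<times> UNIV \<union> {k} \<times> {..n}))
        (S k) (X k (Suc n))
        (\<lambda>\<omega>. M k (level_empirical S X (k - 1) n \<omega>) (X k n \<omega>))) \<and>
     (\<forall>m\<ge>1. \<forall>n. cond_law P (generated_by P S X ({..m} \<times> {..n}))
        (\<Pi>\<^sub>M l\<in>{..m}. S l) (joint X m (Suc n))
        (\<lambda>\<omega>. \<Pi>\<^sub>M l\<in>{..m}. M l (level_empirical S X (l - 1) n \<omega>) (X l n \<omega>)))"

text \<open>The logarithm on \<open>[0, 1]\<close> with \<open>log 0 = -\<infinity>\<close> (whereas \<^term>\<open>ln (0::real) = 0\<close>).\<close>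

definition eln :: "real \<Rightarrow> ereal" where
  "eln p = (if p = 0 then -\<infinity> else ereal (ln p))"

end

theory Submission
  imports Defs
begin

text \<open>
  The empirical average \<open>F\<close> of \<open>f\<close> over the times \<open>0, \<dots>, n\<close> is a function of the history of
  the levels \<open>0, \<dots>, m\<close> that changes by at most \<open>2 / (n + 1)\<close> when one coordinate is changed.
  The theorem follows from two facts about such functions.

  Concentration. Consider the Doob martingale of \<open>F\<close> in time. Its increment at time \<open>k\<close> is
  the sensitivity of the conditional expectation of \<open>F\<close> to the state at time \<open>k\<close>. Within its
  own level, the state is forgotten after a bounded time, by the contraction assumption. But it also enters
  all later empirical measures of its level, with weight \<open>1/q\<close> at time \<open>q\<close>, and thereby the
  transitions of the level above. A backward induction in time with one weight for each level shows
  that this raises the sensitivity at most by the factor \<open>(n/k)\<^sup>\<gamma>\<close> with \<open>\<gamma> = 1/4\<close>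
  (\<open>value_at_osc\<close>, \<open>value_at_block\<close>). As \<open>\<gamma> < 1/2\<close>, the squares of the increments still
  sum up to \<open>O(1/n)\<close> (\<open>sum_block_osc\<close>), and Azuma's inequality gives a Gaussian tail at speed
  \<open>n\<close> around the mean given the starting point (\<open>run_tail\<close>). The constant depends on neither
  \<open>f\<close> nor \<open>n\<close>.

  Convergence of the mean, uniformly in the starting point. Over a fixed number of steps the
  transitions hardly change, so the mean of \<open>f\<close> at time \<open>p\<close> is close to that of the
  integral of \<open>f\<close> with respect to the product of the measures \<open>\<Phi>\<^sub>l(\<eta>)\<close>, where \<open>\<eta>\<close> is the empirical
  measure of level \<open>l - 1\<close> (\<open>run_near_\<Psi>m\<close>). In this product the factors are replaced by their limits one after
  another. For one factor, the error is the integral of \<open>u(h, x)\<close> over \<open>\<Theta>\<^sub>h(dx)\<close>, where \<open>\<Theta>\<^sub>h\<close> is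
  the random product of the other factors and, for each fixed \<open>x\<close>, the mean of \<open>u(h, x)\<close> is small by
  the regularity of \<open>\<Phi>\<^sub>l\<close> and the law of large numbers one level below. The difficulty is
  that \<open>x\<close> is chosen by \<open>\<Theta>\<^sub>h\<close>, which depends on the same history \<open>h\<close>: regularity of \<open>\<Phi>\<^sub>l\<close> controls
  one function at a time and not a random one. However, both \<open>\<Theta>\<^sub>h\<close> and \<open>u(h, x)\<close> change by
  \<open>O(1/n)\<close> only with each coordinate of \<open>h\<close>. If the common randomness of a time step
  is replaced by two independent copies, one for \<open>\<Theta>\<close> and one for \<open>u\<close>, the mean
  changes by at most a product of two martingale increments, and the sum of these is
  \<open>O(1/n)\<close> again (\<open>decouple\<close>). After all steps have been split, \<open>x\<close> and \<open>h\<close> are independent.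
\<close>

section \<open>Bounded functions and Markov kernels\<close>

text \<open>
  Unlike the extensional functions of \<open>bmeas\<close>, these are closed under pointwise operations;
  restriction to the space leads from one class to the other.
\<close>

definition bfun :: "'a measure \<Rightarrow> ('a \<Rightarrow> real) set" where
  "bfun A = {f \<in> borel_measurable A. \<exists>B. \<forall>x\<in>space A. \<bar>f x\<bar> \<le> B}"

text \<open>
  A bound instead of the supremum \<open>osc\<close>, whose value says something only if the function is bounded.
\<close>

definition osc_le :: "'a set \<Rightarrow> ('a \<Rightarrow> real) \<Rightarrow> real \<Rightarrow> bool" where
  "osc_le A f a \<longleftrightarrow> (\<forall>x\<in>A. \<forall>y\<in>A. \<bar>f x - f y\<bar> \<le> a)"

lemma osc_leI: "(\<And>x y. x \<in> A \<Longrightarrow> y \<in> A \<Longrightarrow> \<bar>f x - f y\<bar> \<le> a) \<Longrightarrow> osc_le A f a"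
  by (auto simp: osc_le_def)

lemma osc_leD: "osc_le A f a \<Longrightarrow> x \<in> A \<Longrightarrow> y \<in> A \<Longrightarrow> \<bar>f x - f y\<bar> \<le> a"
  by (auto simp: osc_le_def)

lemma osc_le_mono: "osc_le A f a \<Longrightarrow> a \<le> b \<Longrightarrow> osc_le A f b"
  by (force simp: osc_le_def)

lemma bfun_meas [measurable_dest]: "f \<in> bfun A \<Longrightarrow> f \<in> borel_measurable A"
  by (simp add: bfun_def)

lemma bfunI: "f \<in> borel_measurable A \<Longrightarrow> (\<And>x. x \<in> space A \<Longrightarrow> \<bar>f x\<bar> \<le> B) \<Longrightarrow> f \<in> bfun A"
  by (auto simp: bfun_def)

lemma bfunE:
  assumes "f \<in> bfun A" obtains B where "B \<ge> 0" "\<And>x. x \<in> space A \<Longrightarrow> \<bar>f x\<bar> \<le> B"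
proof -
  obtain B where B: "\<forall>x\<in>space A. \<bar>f x\<bar> \<le> B" using assms by (auto simp: bfun_def)
  show ?thesis
    by (rule that[of "\<bar>B\<bar>"]) (use B in force)+
qed

lemma bfun_const: "(\<lambda>x. c) \<in> bfun A"
  by (rule bfunI[where B="\<bar>c\<bar>"]) auto

lemma bfun_add: assumes "f \<in> bfun A" "g \<in> bfun A" shows "(\<lambda>x. f x + g x) \<in> bfun A"
proof -
  obtain B C where "B \<ge> 0" "C \<ge> 0" and b: "\<And>x. x \<in> space A \<Longrightarrow> \<bar>f x\<bar> \<le> B" "\<And>x. x \<in> space A \<Longrightarrow> \<bar>g x\<bar> \<le> C"
    using assms by (auto elim!: bfunE)
  note [measurable] = assms[THEN bfun_meas]
  show ?thesis
    by (rule bfunI[where B="B + C"], measurable) (use b in force)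
qed

lemma bfun_minus: assumes "f \<in> bfun A" shows "(\<lambda>x. - f x) \<in> bfun A"
  using assms by (auto simp: bfun_def)

lemma bfun_diff: "f \<in> bfun A \<Longrightarrow> g \<in> bfun A \<Longrightarrow> (\<lambda>x. f x - g x) \<in> bfun A"
  using bfun_add[of f A "\<lambda>x. - g x"] bfun_minus by auto

lemma bfun_abs: "f \<in> bfun A \<Longrightarrow> (\<lambda>x. \<bar>f x\<bar>) \<in> bfun A"
  by (auto simp: bfun_def)

lemma bfun_mult: assumes "f \<in> bfun A" "g \<in> bfun A" shows "(\<lambda>x. f x * g x) \<in> bfun A"
proof -
  obtain B C where "B \<ge> 0" "C \<ge> 0" and b: "\<And>x. x \<in> space A \<Longrightarrow> \<bar>f x\<bar> \<le> B" "\<And>x. x \<in> space A \<Longrightarrow> \<bar>g x\<bar> \<le> C"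
    using assms by (auto elim!: bfunE)
  note [measurable] = assms[THEN bfun_meas]
  show ?thesis
    by (rule bfunI[where B="B * C"], measurable) (use b \<open>B \<ge> 0\<close> in \<open>auto simp: abs_mult intro!: mult_mono\<close>)
qed

lemma bfun_sum: "(\<And>i. i \<in> I \<Longrightarrow> f i \<in> bfun A) \<Longrightarrow> (\<lambda>x. \<Sum>i\<in>I. f i x) \<in> bfun A"
  by (induction I rule: infinite_finite_induct) (auto intro: bfun_const bfun_add)

lemma bfun_exp: assumes "f \<in> bfun A" shows "(\<lambda>x. exp (f x)) \<in> bfun A"
proof -
  obtain B where b: "\<And>x. x \<in> space A \<Longrightarrow> \<bar>f x\<bar> \<le> B" using bfunE[OF assms] by metis
  note [measurable] = assms[THEN bfun_meas]
  show ?thesis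
    by (rule bfunI[where B="exp B"], measurable) (use b in \<open>auto simp: abs_le_iff\<close>)
qed

lemma bfun_compose: assumes "f \<in> bfun B" "g \<in> A \<rightarrow>\<^sub>M B" shows "(\<lambda>x. f (g x)) \<in> bfun A"
proof -
  obtain C where b: "\<And>x. x \<in> space B \<Longrightarrow> \<bar>f x\<bar> \<le> C" using bfunE[OF assms(1)] by metis
  note [measurable] = assms(2) assms(1)[THEN bfun_meas]
  show ?thesis
    by (rule bfunI[where B=C], measurable) (use b measurable_space[OF assms(2)] in auto)
qed

lemma bfun_indicator: "X \<in> sets A \<Longrightarrow> (indicator X :: _ \<Rightarrow> real) \<in> bfun A"
  by (rule bfunI[where B=1]) (auto simp: indicator_def)

abbreviation pr :: "'a measure \<Rightarrow> 'a measure set" where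
  "pr A \<equiv> space (prob_algebra A)"

lemma prD: assumes "\<mu> \<in> pr A"
  shows "prob_space \<mu>" "sets \<mu> = sets A" "space \<mu> = space A"
  using assms by (auto simp: space_prob_algebra dest: sets_eq_imp_space_eq)

lemma prI: "prob_space \<mu> \<Longrightarrow> sets \<mu> = sets A \<Longrightarrow> \<mu> \<in> pr A"
  by (simp add: space_prob_algebra)

lemma kernel_pr: "K \<in> A \<rightarrow>\<^sub>M prob_algebra B \<Longrightarrow> x \<in> space A \<Longrightarrow> K x \<in> pr B"
  by (rule measurable_space)

lemma pr_nonempty: "\<mu> \<in> pr A \<Longrightarrow> space A \<noteq> {}"
  using prD prob_space.not_empty by metis

lemma bfun_integrable: assumes "\<mu> \<in> pr A" "f \<in> bfun A" shows "integrable \<mu> f"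
proof -
  interpret prob_space \<mu> using prD assms by blast
  obtain B where B: "\<And>x. x \<in> space A \<Longrightarrow> \<bar>f x\<bar> \<le> B" using bfunE[OF assms(2)] by metis
  show ?thesis
    by (rule integrable_const_bound[where B=B])
       (use assms B prD[OF assms(1)] in \<open>auto dest: bfun_meas cong: measurable_cong_sets\<close>)
qed

lemma integral_bounds:
  assumes "\<mu> \<in> pr A" "f \<in> bfun A"
  shows "(\<And>x. x \<in> space A \<Longrightarrow> f x \<le> b) \<Longrightarrow> integral\<^sup>L \<mu> f \<le> b"
    and "(\<And>x. x \<in> space A \<Longrightarrow> b \<le> f x) \<Longrightarrow> b \<le> integral\<^sup>L \<mu> f"
    and "(\<And>x. x \<in> space A \<Longrightarrow> \<bar>f x\<bar> \<le> b) \<Longrightarrow> \<bar>integral\<^sup>L \<mu> f\<bar> \<le> b"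
proof -
  interpret prob_space \<mu> using prD assms by blast
  note i = bfun_integrable[OF assms] and s = prD(3)[OF assms(1)]
  show 1: "integral\<^sup>L \<mu> f \<le> b" if "\<And>x. x \<in> space A \<Longrightarrow> f x \<le> b" for b
  proof -
    have "integral\<^sup>L \<mu> f \<le> (\<integral>x. b \<partial>\<mu>)" by (rule integral_mono[OF i]) (auto simp: s that)
    then show ?thesis by (simp add: prob_space)
  qed
  show 2: "b \<le> integral\<^sup>L \<mu> f" if "\<And>x. x \<in> space A \<Longrightarrow> b \<le> f x" for b
  proof -
    have "(\<integral>x. b \<partial>\<mu>) \<le> integral\<^sup>L \<mu> f" by (rule integral_mono[OF _ i]) (auto simp: s that)
    then show ?thesis by (simp add: prob_space)
  qed
  show "\<bar>integral\<^sup>L \<mu> f\<bar> \<le> b" if "\<And>x. x \<in> space A \<Longrightarrow> \<bar>f x\<bar> \<le> b"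
    using 1[of b] 2[of "-b"] that by (fastforce simp: abs_le_iff)
qed

lemma pr_integral_mono:
  assumes "\<mu> \<in> pr A" "f \<in> bfun A" "g \<in> bfun A" "\<And>x. x \<in> space A \<Longrightarrow> f x \<le> g x"
  shows "integral\<^sup>L \<mu> f \<le> integral\<^sup>L \<mu> g"
  using assms by (intro integral_mono bfun_integrable) (auto simp: prD)

lemma pr_integral_cong:
  "\<mu> \<in> pr A \<Longrightarrow> (\<And>x. x \<in> space A \<Longrightarrow> f x = g x) \<Longrightarrow> integral\<^sup>L \<mu> f = integral\<^sup>L \<mu> g"
  by (intro Bochner_Integration.integral_cong) (auto simp: prD)

lemma pr_integral_diff:
  assumes "\<mu> \<in> pr A" "f \<in> bfun A" "g \<in> bfun A"
  shows "(\<integral>x. f x - g x \<partial>\<mu>) = integral\<^sup>L \<mu> f - integral\<^sup>L \<mu> g"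
  using assms by (intro Bochner_Integration.integral_diff bfun_integrable)

lemma pr_integral_add:
  assumes "\<mu> \<in> pr A" "f \<in> bfun A" "g \<in> bfun A"
  shows "(\<integral>x. f x + g x \<partial>\<mu>) = integral\<^sup>L \<mu> f + integral\<^sup>L \<mu> g"
  using assms by (intro Bochner_Integration.integral_add bfun_integrable)

lemma pr_integral_const: "\<mu> \<in> pr A \<Longrightarrow> (\<integral>x. c \<partial>\<mu>) = (c::real)"
  using prD(1) prob_space.prob_space by force

lemma pr_integral_near:
  assumes "\<mu> \<in> pr A" "f \<in> bfun A" "g \<in> bfun A" "\<And>x. x \<in> space A \<Longrightarrow> \<bar>f x - g x\<bar> \<le> b"
  shows "\<bar>integral\<^sup>L \<mu> f - integral\<^sup>L \<mu> g\<bar> \<le> b"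
  using integral_bounds(3)[OF assms(1) bfun_diff[OF assms(2,3)], of b] assms
  by (simp add: pr_integral_diff)

lemma pr_integral_near_const:
  assumes "\<mu> \<in> pr A" "f \<in> bfun A" "\<And>x. x \<in> space A \<Longrightarrow> \<bar>f x - c\<bar> \<le> b"
  shows "\<bar>integral\<^sup>L \<mu> f - c\<bar> \<le> b"
  using pr_integral_near[OF assms(1,2) bfun_const[of c], of b] assms(3)
  unfolding pr_integral_const[OF assms(1)] by blast

lemma integral_osc:
  assumes "\<mu> \<in> pr A" "\<nu> \<in> pr A" "f \<in> bfun A" "osc_le (space A) f a"
  shows "\<bar>integral\<^sup>L \<mu> f - integral\<^sup>L \<nu> f\<bar> \<le> a"
    and "x \<in> space A \<Longrightarrow> \<bar>f x - integral\<^sup>L \<nu> f\<bar> \<le> a"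
proof -
  have 1: "\<bar>f x - integral\<^sup>L \<nu> f\<bar> \<le> a" if "x \<in> space A" for x
    using pr_integral_near_const[OF assms(2,3), of "f x" a] osc_leD[OF assms(4)] that
    by (simp add: abs_minus_commute)
  then show "x \<in> space A \<Longrightarrow> \<bar>f x - integral\<^sup>L \<nu> f\<bar> \<le> a" .
  show "\<bar>integral\<^sup>L \<mu> f - integral\<^sup>L \<nu> f\<bar> \<le> a"
    by (rule pr_integral_near_const[OF assms(1,3) 1])
qed

lemma osc_from_bound: "(\<And>x. x \<in> A \<Longrightarrow> \<bar>f x\<bar> \<le> b) \<Longrightarrow> osc_le A f (2 * b)"
  by (rule osc_leI) (smt (verit, best))

lemma bfun_kernel_integral:
  assumes K: "K \<in> X \<rightarrow>\<^sub>M prob_algebra Y" and f: "(\<lambda>(x, y). f x y) \<in> bfun (X \<Otimes>\<^sub>M Y)"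
  shows "(\<lambda>x. \<integral>y. f x y \<partial>K x) \<in> bfun X"
proof -
  obtain B where B: "B \<ge> 0" "\<And>z. z \<in> space (X \<Otimes>\<^sub>M Y) \<Longrightarrow> \<bar>case z of (x, y) \<Rightarrow> f x y\<bar> \<le> B"
    using bfunE[OF f] by metis
  have [measurable]: "(\<lambda>(x, y). f x y) \<in> borel_measurable (X \<Otimes>\<^sub>M Y)" using f by (rule bfun_meas)
  have [measurable]: "K \<in> X \<rightarrow>\<^sub>M subprob_algebra Y" by (rule measurable_prob_algebraD[OF K])
  have d: "(\<lambda>x. distr (K x) (X \<Otimes>\<^sub>M Y) (\<lambda>y. (x, y))) \<in> X \<rightarrow>\<^sub>M subprob_algebra (X \<Otimes>\<^sub>M Y)"
    by (rule measurable_distr2[where M=Y]) measurable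
  have "(\<lambda>x. integral\<^sup>L (distr (K x) (X \<Otimes>\<^sub>M Y) (\<lambda>y. (x, y))) (\<lambda>(x, y). f x y)) \<in> borel_measurable X"
    by (rule measurable_compose[OF d]) measurable
  also have "?this \<longleftrightarrow> (\<lambda>x. \<integral>y. f x y \<partial>K x) \<in> borel_measurable X"
  proof (rule measurable_cong)
    fix x assume x: "x \<in> space X"
    have [measurable_cong]: "sets (K x) = sets Y" using prD kernel_pr[OF K x] by blast
    show "integral\<^sup>L (distr (K x) (X \<Otimes>\<^sub>M Y) (\<lambda>y. (x, y))) (\<lambda>(x, y). f x y) = (\<integral>y. f x y \<partial>K x)"
      using x by (subst integral_distr) auto
  qed
  finally have m: "(\<lambda>x. \<integral>y. f x y \<partial>K x) \<in> borel_measurable X" .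
  show ?thesis
  proof (rule bfunI[OF m, where B=B])
    fix x assume x: "x \<in> space X"
    have "f x \<in> bfun Y"
      by (rule bfunI[where B=B]) (use B x in \<open>auto simp: space_pair_measure\<close>)
    then show "\<bar>\<integral>y. f x y \<partial>K x\<bar> \<le> B"
      by (rule integral_bounds(3)[OF kernel_pr[OF K x]]) (use B x in \<open>auto simp: space_pair_measure\<close>)
  qed
qed

lemma bfun_kernel_integral1:
  assumes K: "K \<in> X \<rightarrow>\<^sub>M prob_algebra Y" and f: "f \<in> bfun Y"
  shows "(\<lambda>x. integral\<^sup>L (K x) f) \<in> bfun X"
proof -
  have "(\<lambda>(x, y). f y) \<in> bfun (X \<Otimes>\<^sub>M Y)"
    using bfun_compose[OF f measurable_snd[of X]] by (simp add: split_def)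
  from bfun_kernel_integral[OF K this] show ?thesis .
qed

lemma bfun_section:
  assumes "(\<lambda>(x, y). f x y) \<in> bfun (X \<Otimes>\<^sub>M Y)"
  shows "x \<in> space X \<Longrightarrow> f x \<in> bfun Y" and "y \<in> space Y \<Longrightarrow> (\<lambda>x. f x y) \<in> bfun X"
  using bfun_compose[OF assms, of "\<lambda>y. (x, y)" Y] bfun_compose[OF assms, of "\<lambda>x. (x, y)" X]
  by auto

lemma pr_integral_bind:
  assumes "\<mu> \<in> pr X" "K \<in> X \<rightarrow>\<^sub>M prob_algebra Y" "f \<in> bfun Y"
  shows "integral\<^sup>L (bind \<mu> K) f = (\<integral>x. integral\<^sup>L (K x) f \<partial>\<mu>)"
proof -
  obtain B where B: "\<And>z. z \<in> space Y \<Longrightarrow> \<bar>f z\<bar> \<le> B" using bfunE[OF assms(3)] by metis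
  have K: "K \<in> \<mu> \<rightarrow>\<^sub>M subprob_algebra Y"
    using measurable_prob_algebraD[OF assms(2)] prD(2)[OF assms(1)] by (simp cong: measurable_cong_sets)
  have emK: "emeasure (K x) (space (K x)) = 1" if "x \<in> space X" for x
    using prD(1)[OF kernel_pr[OF assms(2) that]] by (rule prob_space.emeasure_space_1)
  show ?thesis
  proof (rule integral_bind[OF bfun_meas[OF assms(3)] B K])
    show "finite_measure \<mu>" using prD(1)[OF assms(1)] prob_space.finite_measure by blast
    show "AE x in \<mu>. emeasure (K x) (space (K x)) \<le> ennreal 1"
      using kernel_pr[OF assms(2)] prD[OF assms(1)] prD(1) prob_space.emeasure_space_1
      by (intro AE_I2) (simp add: emK)
  qed auto
qed

lemma pr_bind: "\<mu> \<in> pr X \<Longrightarrow> K \<in> X \<rightarrow>\<^sub>M prob_algebra Y \<Longrightarrow> bind \<mu> K \<in> pr Y"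
  by (rule prI[OF prob_space_bind' sets_bind'])

lemma pr_distr: "\<mu> \<in> pr X \<Longrightarrow> g \<in> X \<rightarrow>\<^sub>M Y \<Longrightarrow> distr \<mu> Y g \<in> pr Y"
  using measurable_space[OF measurable_distr_prob_space] by blast

lemma pr_integral_distr:
  fixes f :: "'b \<Rightarrow> real"
  assumes "\<mu> \<in> pr X" "g \<in> X \<rightarrow>\<^sub>M Y" "f \<in> borel_measurable Y"
  shows "integral\<^sup>L (distr \<mu> Y g) f = (\<integral>x. f (g x) \<partial>\<mu>)"
proof (rule integral_distr)
  show "g \<in> \<mu> \<rightarrow>\<^sub>M Y" using assms(2) prD(2)[OF assms(1)] by (simp cong: measurable_cong_sets)
qed (rule assms(3))

lemma pr_fubini:
  assumes m: "\<mu> \<in> pr X" and n: "\<nu> \<in> pr Y" and f: "(\<lambda>(x, y). f x y) \<in> bfun (X \<Otimes>\<^sub>M Y)"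
  shows "(\<integral>x. (\<integral>y. f x y \<partial>\<nu>) \<partial>\<mu>) = (\<integral>y. (\<integral>x. f x y \<partial>\<mu>) \<partial>\<nu>)"
    and "integral\<^sup>L (\<mu> \<Otimes>\<^sub>M \<nu>) (\<lambda>(x, y). f x y) = (\<integral>x. (\<integral>y. f x y \<partial>\<nu>) \<partial>\<mu>)"
proof -
  interpret M: prob_space \<mu> using prD m by blast
  interpret N: prob_space \<nu> using prD n by blast
  interpret pair_prob_space \<mu> \<nu> ..
  have "\<mu> \<Otimes>\<^sub>M \<nu> \<in> pr (X \<Otimes>\<^sub>M Y)"
    by (rule prI[OF prob_space_axioms sets_pair_measure_cong[OF prD(2)[OF m] prD(2)[OF n]]])
  then have i: "integrable (\<mu> \<Otimes>\<^sub>M \<nu>) (\<lambda>(x, y). f x y)"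
    using f by (rule bfun_integrable)
  show "(\<integral>x. (\<integral>y. f x y \<partial>\<nu>) \<partial>\<mu>) = (\<integral>y. (\<integral>x. f x y \<partial>\<mu>) \<partial>\<nu>)"
    by (rule Fubini_integral[OF i, symmetric])
  show "integral\<^sup>L (\<mu> \<Otimes>\<^sub>M \<nu>) (\<lambda>(x, y). f x y) = (\<integral>x. (\<integral>y. f x y \<partial>\<nu>) \<partial>\<mu>)"
    using integral_fst'[OF i] by simp
qed

section \<open>Products of probability measures\<close>

lemma pr_PiM:
  assumes "\<And>i. i \<in> I \<Longrightarrow> \<mu> i \<in> pr (S i)"
  shows "PiM I \<mu> \<in> pr (PiM I S)"
  by (rule prI[OF prob_space_PiM sets_PiM_cong]) (use assms prD in blast)+

lemma emeasure_PiM_rect: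
  assumes "finite I" "\<And>i. i \<in> I \<Longrightarrow> \<mu> i \<in> pr (S i)" "\<And>i. i \<in> I \<Longrightarrow> A i \<in> sets (S i)"
  shows "emeasure (PiM I \<mu>) (Pi\<^sub>E I A) = (\<Prod>i\<in>I. emeasure (\<mu> i) (A i))"
proof -
  \<comment> \<open>the product locales want a probability measure at every index of the type\<close>
  define \<mu>' where "\<mu>' i = (if i \<in> I then \<mu> i else count_space {undefined})" for i
  have p: "prob_space (\<mu>' i)" for i
    using assms(2)[of i] prD(1) by (cases "i \<in> I") (auto simp: \<mu>'_def intro!: prob_spaceI[of "count_space {undefined}"])
  interpret product_prob_space \<mu>'
    unfolding product_prob_space_def product_prob_space_axioms_def product_sigma_finite_def
    using p prob_space_imp_sigma_finite by blast
  interpret finite_product_prob_space \<mu>' I by standard fact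
  have "PiM I \<mu> = PiM I \<mu>'" by (rule PiM_cong) (auto simp: \<mu>'_def)
  then have "emeasure (PiM I \<mu>) (Pi\<^sub>E I A) = emeasure (PiM I \<mu>') (Pi\<^sub>E I A)" by simp
  also have "\<dots> = (\<Prod>i\<in>I. emeasure (\<mu>' i) (A i))"
    using assms by (intro emeasure_PiM) (auto simp: \<mu>'_def prD(2)[OF assms(2)])
  finally show ?thesis by (simp add: \<mu>'_def)
qed

lemma PiM_eqI_pr:
  assumes "finite I" "\<And>i. i \<in> I \<Longrightarrow> \<mu> i \<in> pr (S i)" "sets P = sets (PiM I S)"
    and "\<And>A. (\<And>i. i \<in> I \<Longrightarrow> A i \<in> sets (S i)) \<Longrightarrow> emeasure P (Pi\<^sub>E I A) = (\<Prod>i\<in>I. emeasure (\<mu> i) (A i))"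
  shows "P = PiM I \<mu>"
proof -
  define \<mu>' where "\<mu>' i = (if i \<in> I then \<mu> i else count_space {undefined})" for i
  have p: "prob_space (\<mu>' i)" for i
    using assms(2)[of i] prD(1) by (cases "i \<in> I") (auto simp: \<mu>'_def intro!: prob_spaceI[of "count_space {undefined}"])
  interpret product_prob_space \<mu>'
    unfolding product_prob_space_def product_prob_space_axioms_def product_sigma_finite_def
    using p prob_space_imp_sigma_finite by blast
  have eq: "PiM I \<mu> = PiM I \<mu>'" by (rule PiM_cong) (auto simp: \<mu>'_def)
  show ?thesis unfolding eq
  proof (rule PiM_eqI[OF assms(1)])
    have "sets (PiM I \<mu>') = sets (PiM I S)"
      by (rule sets_PiM_cong) (auto simp: \<mu>'_def prD(2)[OF assms(2)])
    then show "sets P = sets (PiM I \<mu>')" using assms(3) by simp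
    fix A assume "\<And>i. i \<in> I \<Longrightarrow> A i \<in> sets (\<mu>' i)"
    then have "\<And>i. i \<in> I \<Longrightarrow> A i \<in> sets (S i)" by (auto simp: \<mu>'_def prD(2)[OF assms(2)])
    from assms(4)[OF this] show "emeasure P (Pi\<^sub>E I A) = (\<Prod>i\<in>I. emeasure (\<mu>' i) (A i))"
      by (simp add: \<mu>'_def)
  qed
qed

lemma measurable_PiM_kernel:
  assumes fin: "finite I" and K: "\<And>i. i \<in> I \<Longrightarrow> K i \<in> X \<rightarrow>\<^sub>M prob_algebra (S i)"
  shows "(\<lambda>x. PiM I (\<lambda>i. K i x)) \<in> X \<rightarrow>\<^sub>M prob_algebra (PiM I S)"
proof (rule measurable_prob_algebra_generated[OF sets_PiM Int_stable_prod_algebra prod_algebra_sets_into_space])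
  fix x assume x: "x \<in> space X"
  have "PiM I (\<lambda>i. K i x) \<in> pr (PiM I S)"
    by (rule pr_PiM) (rule kernel_pr[OF K x])
  then show "prob_space (PiM I (\<lambda>i. K i x))" "sets (PiM I (\<lambda>i. K i x)) = sets (PiM I S)"
    by (auto simp: prD)
next
  fix A assume "A \<in> prod_algebra I S"
  then obtain E where A: "A = Pi\<^sub>E I E" "\<And>i. i \<in> I \<Longrightarrow> E i \<in> sets (S i)"
    by (auto simp: prod_algebra_eq_finite[OF fin])
  have "(\<lambda>x. emeasure (PiM I (\<lambda>i. K i x)) A) \<in> borel_measurable X \<longleftrightarrow>
        (\<lambda>x. \<Prod>i\<in>I. emeasure (K i x) (E i)) \<in> borel_measurable X"
    unfolding A(1) by (intro measurable_cong emeasure_PiM_rect[OF fin kernel_pr[OF K] A(2)])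
  moreover have "(\<lambda>x. emeasure (K i x) (E i)) \<in> borel_measurable X" if "i \<in> I" for i
    using measurable_prob_algebraD[OF K[OF that]] A(2)[OF that] by measurable
  ultimately show "(\<lambda>x. emeasure (PiM I (\<lambda>i. K i x)) A) \<in> borel_measurable X"
    by (simp add: borel_measurable_prod_ennreal)
qed

lemma fun_upd_PiM_space:
  "y \<in> space (PiM I S) \<Longrightarrow> i \<in> I \<Longrightarrow> z \<in> space (S i) \<Longrightarrow> y(i := z) \<in> space (PiM I S)"
  by (auto simp: space_PiM PiE_iff extensional_def)

lemma measurable_fun_upd_pair:
  assumes "i \<in> I"
  shows "(\<lambda>(y, z). y(i := z)) \<in> PiM I S \<Otimes>\<^sub>M S i \<rightarrow>\<^sub>M PiM I S"
  unfolding case_prod_beta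
  by (rule measurable_fun_upd[where J="I"]) (use assms in auto)

lemma bfun_fun_upd:
  assumes "i \<in> I" "f \<in> bfun (PiM I S)"
  shows "(\<lambda>(y, z). f (y(i := z))) \<in> bfun (PiM I S \<Otimes>\<^sub>M S i)"
  using bfun_compose[OF assms(2) measurable_fun_upd_pair[OF assms(1)]] by (simp add: split_def)

text \<open>
  To change one factor is to redraw one coordinate. Every comparison of
  product measures below is reduced to a single coordinate in this way.
\<close>

lemma PiM_resample:
  assumes fin: "finite I" and i: "i \<in> I" and \<mu>: "\<And>j. j \<in> I \<Longrightarrow> \<mu> j \<in> pr (S j)" and \<nu>: "\<nu> \<in> pr (S i)"
    and f: "f \<in> bfun (PiM I S)"
  shows "integral\<^sup>L (PiM I (\<mu>(i := \<nu>))) f = (\<integral>y. (\<integral>z. f (y(i := z)) \<partial>\<nu>) \<partial>PiM I \<mu>)"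
proof -
  have P: "PiM I \<mu> \<in> pr (PiM I S)" by (rule pr_PiM[OF \<mu>])
  interpret N: prob_space \<nu> using prD[OF \<nu>] by blast
  have pp: "PiM I \<mu> \<Otimes>\<^sub>M \<nu> \<in> pr (PiM I S \<Otimes>\<^sub>M S i)"
    using P \<nu> by (intro prI prob_space_pair sets_pair_measure_cong) (auto simp: prD)
  let ?D = "distr (PiM I \<mu> \<Otimes>\<^sub>M \<nu>) (PiM I S) (\<lambda>(y, z). y(i := z))"
  have "?D = PiM I (\<mu>(i := \<nu>))"
  proof (rule PiM_eqI_pr[OF fin])
    fix A assume A: "\<And>i. i \<in> I \<Longrightarrow> A i \<in> sets (S i)"
    let ?B = "Pi\<^sub>E I (A(i := space (S i)))"
    have "emeasure ?D (Pi\<^sub>E I A) = emeasure (PiM I \<mu> \<Otimes>\<^sub>M \<nu>)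
        ((\<lambda>(y, z). y(i := z)) -` Pi\<^sub>E I A \<inter> space (PiM I \<mu> \<Otimes>\<^sub>M \<nu>))"
      using A fin pp measurable_fun_upd_pair[OF i, of S]
      by (intro emeasure_distr) (auto simp: prD cong: measurable_cong_sets)
    also have "(\<lambda>(y, z). y(i := z)) -` Pi\<^sub>E I A \<inter> space (PiM I \<mu> \<Otimes>\<^sub>M \<nu>) = ?B \<times> A i"
    proof -
      have sub: "x \<in> space (S j)" if "j \<in> I" "x \<in> A j" for j x
        using sets.sets_into_space[OF A[OF that(1)]] that(2) by auto
      have "(y \<in> Pi\<^sub>E I (\<lambda>j. space (S j)) \<and> z \<in> space (S i) \<and> y(i := z) \<in> Pi\<^sub>E I A)
          \<longleftrightarrow> (y \<in> ?B \<and> z \<in> A i)" for y z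
      proof
        assume l: "y \<in> Pi\<^sub>E I (\<lambda>j. space (S j)) \<and> z \<in> space (S i) \<and> y(i := z) \<in> Pi\<^sub>E I A"
        have "(y(i := z)) j \<in> A j" if "j \<in> I" for j using l that by (meson PiE_mem)
        note up = this
        have "y j \<in> (A(i := space (S i))) j" if "j \<in> I" for j
          using l up[OF that] PiE_mem[of y I, OF _ that] by (cases "j = i") auto
        moreover have "z \<in> A i" using up[OF i] by simp
        ultimately show "y \<in> ?B \<and> z \<in> A i"
          using l by (simp add: PiE_iff)
      next
        assume r: "y \<in> ?B \<and> z \<in> A i"
        then have yj: "y j \<in> (A(i := space (S i))) j" if "j \<in> I" for j using that by (meson PiE_mem)
        have "y j \<in> space (S j)" if "j \<in> I" for j
          using yj[OF that] sub[OF that] by (auto split: if_splits)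
        moreover have "y \<in> extensional I" using r by (simp add: PiE_iff)
        moreover have "(y(i := z)) j \<in> A j" if "j \<in> I" for j
          using yj[OF that] r by (auto split: if_splits)
        moreover have "y(i := z) \<in> extensional I"
          using calculation(2) i by (auto simp: extensional_def)
        ultimately show "y \<in> Pi\<^sub>E I (\<lambda>j. space (S j)) \<and> z \<in> space (S i) \<and> y(i := z) \<in> Pi\<^sub>E I A"
          using sub[OF i] r by (simp add: PiE_iff)
      qed
      note iff = this
      have sp: "space (PiM I \<mu> \<Otimes>\<^sub>M \<nu>) = Pi\<^sub>E I (\<lambda>j. space (S j)) \<times> space (S i)"
        by (simp only: space_pair_measure prD(3)[OF P] prD(3)[OF \<nu>]) (simp only: space_PiM)
      show ?thesis
      proof (rule set_eqI)
        fix w :: "('a \<Rightarrow> 'b) \<times> 'b"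
        obtain y z where w: "w = (y, z)" by (cases w)
        show "w \<in> (\<lambda>(y, z). y(i := z)) -` Pi\<^sub>E I A \<inter> space (PiM I \<mu> \<Otimes>\<^sub>M \<nu>) \<longleftrightarrow> w \<in> ?B \<times> A i"
          unfolding w sp vimage_eq Int_iff mem_Sigma_iff case_prod_conv iff[symmetric] by blast
      qed
    qed
    also have "emeasure (PiM I \<mu> \<Otimes>\<^sub>M \<nu>) (?B \<times> A i) = emeasure (PiM I \<mu>) ?B * emeasure \<nu> (A i)"
      using A i fin by (intro N.emeasure_pair_measure_Times) (auto simp: prD[OF P] prD[OF \<nu>] intro!: sets_PiM_I_finite)
    also have "emeasure (PiM I \<mu>) ?B = (\<Prod>j\<in>I. emeasure (\<mu> j) ((A(i := space (S i))) j))"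
      using A by (intro emeasure_PiM_rect[OF fin \<mu>]) auto
    also have "\<dots> = (\<Prod>j\<in>I - {i}. emeasure (\<mu> j) (A j))"
      using prod.remove[OF fin i, of "\<lambda>j. emeasure (\<mu> j) ((A(i := space (S i))) j)"]
        prob_space.emeasure_space_1[OF prD(1)[OF \<mu>[OF i]]] prD(3)[OF \<mu>[OF i]] by auto
    also have "(\<Prod>j\<in>I - {i}. emeasure (\<mu> j) (A j)) * emeasure \<nu> (A i) = (\<Prod>j\<in>I. emeasure ((\<mu>(i := \<nu>)) j) (A j))"
      using prod.remove[OF fin i, of "\<lambda>j. emeasure ((\<mu>(i := \<nu>)) j) (A j)"] by (simp add: mult.commute)
    finally show "emeasure ?D (Pi\<^sub>E I A) = (\<Prod>j\<in>I. emeasure ((\<mu>(i := \<nu>)) j) (A j))" .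
  qed (use \<mu> \<nu> in auto)
  then have "integral\<^sup>L (PiM I (\<mu>(i := \<nu>))) f = integral\<^sup>L ?D f" by simp
  also have "\<dots> = integral\<^sup>L (PiM I \<mu> \<Otimes>\<^sub>M \<nu>) (\<lambda>(y, z). f (y(i := z)))"
    using pr_integral_distr[OF pp measurable_fun_upd_pair[OF i] bfun_meas[OF f]] by (simp add: split_def)
  also have "\<dots> = (\<integral>y. (\<integral>z. f (y(i := z)) \<partial>\<nu>) \<partial>PiM I \<mu>)"
    using pr_fubini(2)[OF P \<nu> bfun_fun_upd[OF i f]] .
  finally show ?thesis .
qed

text \<open>
  This makes the iterates of a product kernel products of iterates, so that
  several levels with frozen kernels can be treated one by one.
\<close>

lemma PiM_bind:
  assumes fin: "finite I" and \<mu>: "\<And>i. i \<in> I \<Longrightarrow> \<mu> i \<in> pr (S i)"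
    and K: "\<And>i. i \<in> I \<Longrightarrow> K i \<in> S i \<rightarrow>\<^sub>M prob_algebra (S i)"
  shows "bind (PiM I \<mu>) (\<lambda>y. PiM I (\<lambda>i. K i (y i))) = PiM I (\<lambda>i. bind (\<mu> i) (K i))"
proof (rule PiM_eqI_pr[OF fin])
  have PP: "PiM I \<mu> \<in> pr (PiM I S)" by (rule pr_PiM[OF \<mu>])
  have K': "(\<lambda>y. PiM I (\<lambda>i. K i (y i))) \<in> PiM I S \<rightarrow>\<^sub>M prob_algebra (PiM I S)"
    by (rule measurable_PiM_kernel[OF fin]) (rule measurable_compose[OF measurable_component_singleton], assumption, rule K)
  show "sets (bind (PiM I \<mu>) (\<lambda>y. PiM I (\<lambda>i. K i (y i)))) = sets (PiM I S)"
    by (rule sets_bind'[OF PP K'])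
  show "bind (\<mu> i) (K i) \<in> pr (S i)" if "i \<in> I" for i by (rule pr_bind[OF \<mu>[OF that] K[OF that]])
  fix A assume A: "\<And>i. i \<in> I \<Longrightarrow> A i \<in> sets (S i)"
  define \<mu>' where "\<mu>' i = (if i \<in> I then \<mu> i else count_space {undefined})" for i
  have "prob_space (\<mu>' i)" for i
    using \<mu>[of i] prD(1) by (cases "i \<in> I") (auto simp: \<mu>'_def intro!: prob_spaceI[of "count_space {undefined}"])
  then interpret product_prob_space \<mu>'
    unfolding product_prob_space_def product_prob_space_axioms_def product_sigma_finite_def
    using prob_space_imp_sigma_finite by blast
  have eq: "PiM I \<mu> = PiM I \<mu>'" by (rule PiM_cong) (auto simp: \<mu>'_def)
  have "emeasure (bind (PiM I \<mu>) (\<lambda>y. PiM I (\<lambda>i. K i (y i)))) (Pi\<^sub>E I A) =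
      (\<integral>\<^sup>+y. emeasure (PiM I (\<lambda>i. K i (y i))) (Pi\<^sub>E I A) \<partial>PiM I \<mu>)"
    using A fin by (intro emeasure_bind_prob_algebra[OF PP K'] sets_PiM_I_finite) auto
  also have "\<dots> = (\<integral>\<^sup>+y. (\<Prod>i\<in>I. emeasure (K i (y i)) (A i)) \<partial>PiM I \<mu>')"
    unfolding eq[symmetric]
  proof (intro nn_integral_cong emeasure_PiM_rect[OF fin kernel_pr[OF K] A])
    fix x i assume "x \<in> space (PiM I \<mu>)" "i \<in> I"
    then show "x i \<in> space (S i)"
      unfolding prD(3)[OF PP] by (auto simp: space_PiM)
  qed
  also have "\<dots> = (\<Prod>i\<in>I. (\<integral>\<^sup>+x. emeasure (K i x) (A i) \<partial>\<mu>' i))"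
  proof (rule product_nn_integral_prod[OF fin])
    fix i assume i: "i \<in> I"
    have "(\<lambda>x. emeasure (K i x) (A i)) \<in> borel_measurable (S i)"
      using measurable_prob_algebraD[OF K[OF i]] A[OF i] by measurable
    then show "(\<lambda>x. emeasure (K i x) (A i)) \<in> borel_measurable (\<mu>' i)"
      using i prD(2)[OF \<mu>[OF i]] by (simp add: \<mu>'_def cong: measurable_cong_sets)
  qed
  also have "\<dots> = (\<Prod>i\<in>I. emeasure (bind (\<mu> i) (K i)) (A i))"
    by (intro prod.cong refl) (simp add: \<mu>'_def emeasure_bind_prob_algebra[OF \<mu> K A])
  finally show "emeasure (bind (PiM I \<mu>) (\<lambda>y. PiM I (\<lambda>i. K i (y i)))) (Pi\<^sub>E I A) =
      (\<Prod>i\<in>I. emeasure (bind (\<mu> i) (K i)) (A i))" .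
qed

lemma PiM_return:
  assumes fin: "finite I" and x: "x \<in> space (PiM I S)"
  shows "return (PiM I S) x = PiM I (\<lambda>i. return (S i) (x i))"
proof (rule PiM_eqI_pr[OF fin])
  show "return (S i) (x i) \<in> pr (S i)" if "i \<in> I" for i
    using x that by (intro prI prob_space_return) (auto simp: space_PiM)
  fix A assume A: "\<And>i. i \<in> I \<Longrightarrow> A i \<in> sets (S i)"
  have x': "x \<in> Pi\<^sub>E I A \<longleftrightarrow> (\<forall>i\<in>I. x i \<in> A i)" using x by (auto simp: space_PiM PiE_iff)
  have "emeasure (return (PiM I S) x) (Pi\<^sub>E I A) = indicator (Pi\<^sub>E I A) x"
    by (rule emeasure_return) (rule sets_PiM_I_finite[OF fin A])
  also have "\<dots> = (\<Prod>i\<in>I. indicator (A i) (x i))"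
    using fin x' by (cases "\<forall>i\<in>I. x i \<in> A i") (auto simp: indicator_def prod_zero_iff)
  also have "\<dots> = (\<Prod>i\<in>I. emeasure (return (S i) (x i)) (A i))"
    using A by (intro prod.cong refl) simp
  finally show "emeasure (return (PiM I S) x) (Pi\<^sub>E I A) = (\<Prod>i\<in>I. emeasure (return (S i) (x i)) (A i))" .
qed auto

lemma PiM_diff_one:
  assumes fin: "finite I" and i: "i \<in> I" and \<mu>: "\<And>j. j \<in> I \<Longrightarrow> \<mu> j \<in> pr (S j)" and \<nu>: "\<nu> \<in> pr (S i)"
    and f: "f \<in> bfun (PiM I S)"
    and d: "\<And>y. y \<in> space (PiM I S) \<Longrightarrow> \<bar>(\<integral>z. f (y(i := z)) \<partial>\<nu>) - (\<integral>z. f (y(i := z)) \<partial>\<mu> i)\<bar> \<le> a"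
  shows "\<bar>integral\<^sup>L (PiM I (\<mu>(i := \<nu>))) f - integral\<^sup>L (PiM I \<mu>) f\<bar> \<le> a"
proof -
  have P: "PiM I \<mu> \<in> pr (PiM I S)" by (rule pr_PiM[OF \<mu>])
  have b: "(\<lambda>y. \<integral>z. f (y(i := z)) \<partial>\<eta>) \<in> bfun (PiM I S)" if "\<eta> \<in> pr (S i)" for \<eta>
    by (rule bfun_kernel_integral[OF _ bfun_fun_upd[OF i f]]) (use that in auto)
  have "integral\<^sup>L (PiM I \<mu>) f = (\<integral>y. (\<integral>z. f (y(i := z)) \<partial>\<mu> i) \<partial>PiM I \<mu>)"
    using PiM_resample[OF fin i \<mu> \<mu>[OF i] f] by simp
  then show ?thesis
    using pr_integral_near[OF P b[OF \<nu>] b[OF \<mu>[OF i]] d] PiM_resample[OF fin i \<mu> \<nu> f] by simp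
qed

text \<open>
  The factors are exchanged one after another.
\<close>

lemma PiM_diff:
  assumes fin: "finite I" and \<mu>: "\<And>j. j \<in> I \<Longrightarrow> \<mu> j \<in> pr (S j)" and \<nu>: "\<And>j. j \<in> I \<Longrightarrow> \<nu> j \<in> pr (S j)"
    and f: "f \<in> bfun (PiM I S)"
    and d: "\<And>i y. i \<in> I \<Longrightarrow> y \<in> space (PiM I S) \<Longrightarrow>
       \<bar>(\<integral>z. f (y(i := z)) \<partial>\<nu> i) - (\<integral>z. f (y(i := z)) \<partial>\<mu> i)\<bar> \<le> a i"
  shows "\<bar>integral\<^sup>L (PiM I \<nu>) f - integral\<^sup>L (PiM I \<mu>) f\<bar> \<le> (\<Sum>i\<in>I. a i)"
proof -
  have "\<bar>integral\<^sup>L (PiM I (\<lambda>i. if i \<in> J then \<nu> i else \<mu> i)) f - integral\<^sup>L (PiM I \<mu>) f\<bar> \<le> (\<Sum>i\<in>J. a i)"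
    if "finite J" "J \<subseteq> I" for J
    using that
  proof (induction J rule: finite_induct)
    case empty then show ?case by simp
  next
    case (insert i J)
    let ?m = "\<lambda>j. if j \<in> J then \<nu> j else \<mu> j"
    have i: "i \<in> I" using insert by auto
    have e: "(\<lambda>j. if j \<in> insert i J then \<nu> j else \<mu> j) = ?m(i := \<nu> i)" by auto
    have "\<bar>integral\<^sup>L (PiM I (?m(i := \<nu> i))) f - integral\<^sup>L (PiM I ?m) f\<bar> \<le> a i"
      by (rule PiM_diff_one[OF fin i _ \<nu>[OF i] f]) (use \<mu> \<nu> d[OF i] insert in auto)
    moreover have "\<bar>integral\<^sup>L (PiM I ?m) f - integral\<^sup>L (PiM I \<mu>) f\<bar> \<le> (\<Sum>i\<in>J. a i)"
      using insert by auto
    ultimately show ?case unfolding e using insert by simp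
  qed
  from this[OF fin order_refl] show ?thesis
    by (simp cong: PiM_cong)
qed

section \<open>Iterated kernels\<close>

context
  fixes A :: "'a measure" and \<kappa> :: "'a \<Rightarrow> 'a measure"
  assumes \<kappa>: "\<kappa> \<in> A \<rightarrow>\<^sub>M prob_algebra A"
begin

lemma kernel_pow_kernel: "kernel_pow A \<kappa> i \<in> A \<rightarrow>\<^sub>M prob_algebra A"
  by (induction i) (auto intro: measurable_bind_prob_space[OF \<kappa>])

lemmas kernel_pow_pr = kernel_pr[OF kernel_pow_kernel]

lemma kernel_pow_bfun: "g \<in> bfun A \<Longrightarrow> (\<lambda>x. integral\<^sup>L (kernel_pow A \<kappa> i x) g) \<in> bfun A"
  by (rule bfun_kernel_integral1[OF kernel_pow_kernel])

lemma kernel_pow_0_integral: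
  "g \<in> bfun A \<Longrightarrow> x \<in> space A \<Longrightarrow> integral\<^sup>L (kernel_pow A \<kappa> 0 x) g = g x"
  by (simp add: integral_return bfun_meas)

lemma kernel_pow_Suc_integral:
  "g \<in> bfun A \<Longrightarrow> x \<in> space A \<Longrightarrow>
     integral\<^sup>L (kernel_pow A \<kappa> (Suc i) x) g = (\<integral>y. integral\<^sup>L (kernel_pow A \<kappa> i y) g \<partial>\<kappa> x)"
  using pr_integral_bind[OF kernel_pr[OF \<kappa>] kernel_pow_kernel] by simp

text \<open>
  By definition \<open>kernel_pow\<close> splits off the first step; the propagation of oscillations
  needs to split off the last one.
\<close>

lemma kernel_pow_Suc_integral':
  "g \<in> bfun A \<Longrightarrow> x \<in> space A \<Longrightarrow>
     integral\<^sup>L (kernel_pow A \<kappa> (Suc i) x) g = (\<integral>y. integral\<^sup>L (\<kappa> y) g \<partial>kernel_pow A \<kappa> i x)"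
proof (induction i arbitrary: x)
  case 0
  then show ?case
    using kernel_pow_0_integral[OF bfun_kernel_integral1[OF \<kappa>]] kernel_pow_Suc_integral[of g x 0]
      pr_integral_cong[OF kernel_pr[OF \<kappa>], of x "\<lambda>y. integral\<^sup>L (kernel_pow A \<kappa> 0 y) g" g]
      kernel_pow_0_integral by simp
next
  case (Suc i)
  have "integral\<^sup>L (kernel_pow A \<kappa> (Suc (Suc i)) x) g
      = (\<integral>y. (\<integral>z. integral\<^sup>L (\<kappa> z) g \<partial>kernel_pow A \<kappa> i y) \<partial>\<kappa> x)"
    unfolding kernel_pow_Suc_integral[OF Suc.prems]
    by (intro pr_integral_cong[OF kernel_pr[OF \<kappa> Suc.prems(2)]] Suc.IH Suc.prems)
  also have "\<dots> = (\<integral>z. integral\<^sup>L (\<kappa> z) g \<partial>kernel_pow A \<kappa> (Suc i) x)"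
    by (rule kernel_pow_Suc_integral[symmetric]) (intro bfun_kernel_integral1[OF \<kappa>] Suc.prems)+
  finally show ?case .
qed

lemma kernel_osc_le:
  "g \<in> bfun A \<Longrightarrow> osc_le (space A) g a \<Longrightarrow> osc_le (space A) (\<lambda>x. integral\<^sup>L (\<kappa> x) g) a"
  by (rule osc_leI) (rule integral_osc(1)[OF kernel_pr[OF \<kappa>] kernel_pr[OF \<kappa>]])

lemma kernel_pow_osc_le:
  "g \<in> bfun A \<Longrightarrow> osc_le (space A) g a \<Longrightarrow> osc_le (space A) (\<lambda>x. integral\<^sup>L (kernel_pow A \<kappa> i x) g) a"
  by (rule osc_leI) (rule integral_osc(1)[OF kernel_pow_pr kernel_pow_pr])

lemma kernel_pow_add_integral:
  assumes "g \<in> bfun A" "x \<in> space A"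
  shows "integral\<^sup>L (kernel_pow A \<kappa> (i + j) x) g =
     (\<integral>y. integral\<^sup>L (kernel_pow A \<kappa> j y) g \<partial>kernel_pow A \<kappa> i x)"
  using assms(2)
proof (induction i arbitrary: x)
  case 0
  then show ?case using kernel_pow_0_integral[OF kernel_pow_bfun[OF assms(1)], of x j] by simp
next
  case (Suc i)
  have "integral\<^sup>L (kernel_pow A \<kappa> (Suc i + j) x) g = (\<integral>y. integral\<^sup>L (kernel_pow A \<kappa> (i + j) y) g \<partial>\<kappa> x)"
    using kernel_pow_Suc_integral[OF assms(1) Suc.prems] by simp
  also have "\<dots> = (\<integral>y. (\<integral>z. integral\<^sup>L (kernel_pow A \<kappa> j z) g \<partial>kernel_pow A \<kappa> i y) \<partial>\<kappa> x)"
    by (intro pr_integral_cong[OF kernel_pr[OF \<kappa> Suc.prems]] Suc.IH)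
  also have "\<dots> = (\<integral>z. integral\<^sup>L (kernel_pow A \<kappa> j z) g \<partial>kernel_pow A \<kappa> (Suc i) x)"
    using kernel_pow_Suc_integral[OF kernel_pow_bfun[OF assms(1)] Suc.prems] by simp
  finally show ?case .
qed

lemma kernel_pow_contract_iterate:
  assumes contr: "\<And>g a. g \<in> bfun A \<Longrightarrow> osc_le (space A) g a \<Longrightarrow>
      osc_le (space A) (\<lambda>x. integral\<^sup>L (kernel_pow A \<kappa> n x) g) (b * a)"
    and g: "g \<in> bfun A" "osc_le (space A) g a"
  shows "osc_le (space A) (\<lambda>x. integral\<^sup>L (kernel_pow A \<kappa> (n * j) x) g) (b ^ j * a)"
proof (induction j)
  case 0
  show ?case using g kernel_pow_osc_le[OF g, of 0] by simp
next
  case (Suc j)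
  have "osc_le (space A) (\<lambda>x. \<integral>y. integral\<^sup>L (kernel_pow A \<kappa> (n * j) y) g \<partial>kernel_pow A \<kappa> n x) (b * (b ^ j * a))"
    by (rule contr[OF kernel_pow_bfun[OF g(1)] Suc])
  then show ?case
    using kernel_pow_add_integral[OF g(1), of _ n "n * j"] by (auto simp: osc_le_def mult.assoc)
qed

text \<open>
  The \<open>i\<close> factors are exchanged one at a time. Each exchange costs \<open>\<epsilon> a\<close>, since the other
  factors do not increase oscillations.
\<close>

lemma kernel_pow_perturb:
  assumes \<kappa>': "\<kappa>' \<in> A \<rightarrow>\<^sub>M prob_algebra A"
    and near: "\<And>x g a. x \<in> space A \<Longrightarrow> g \<in> bfun A \<Longrightarrow> osc_le (space A) g a \<Longrightarrow>
        \<bar>integral\<^sup>L (\<kappa> x) g - integral\<^sup>L (\<kappa>' x) g\<bar> \<le> \<epsilon> * a"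
    and g: "g \<in> bfun A" "osc_le (space A) g a" and x: "x \<in> space A"
  shows "\<bar>integral\<^sup>L (kernel_pow A \<kappa> i x) g - integral\<^sup>L (kernel_pow A \<kappa>' i x) g\<bar> \<le> real i * (\<epsilon> * a)"
  using x
proof (induction i arbitrary: x)
  case 0
  then show ?case by simp
next
  case (Suc i)
  have k'p: "kernel_pow A \<kappa>' i \<in> A \<rightarrow>\<^sub>M prob_algebra A" for i
    by (induction i) (auto intro: measurable_bind_prob_space[OF \<kappa>'])
  note b' = bfun_kernel_integral1[OF k'p g(1)]
  have "osc_le (space A) (\<lambda>x. integral\<^sup>L (kernel_pow A \<kappa>' i x) g) a"
    by (rule osc_leI) (rule integral_osc(1)[OF kernel_pr[OF k'p] kernel_pr[OF k'p] g])
  from near[OF Suc.prems b' this]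
  have "\<bar>(\<integral>y. integral\<^sup>L (kernel_pow A \<kappa>' i y) g \<partial>\<kappa> x) - (\<integral>y. integral\<^sup>L (kernel_pow A \<kappa>' i y) g \<partial>\<kappa>' x)\<bar> \<le> \<epsilon> * a" .
  moreover have "\<bar>(\<integral>y. integral\<^sup>L (kernel_pow A \<kappa> i y) g \<partial>\<kappa> x) - (\<integral>y. integral\<^sup>L (kernel_pow A \<kappa>' i y) g \<partial>\<kappa> x)\<bar> \<le> real i * (\<epsilon> * a)"
    by (rule pr_integral_near[OF kernel_pr[OF \<kappa> Suc.prems] kernel_pow_bfun[OF g(1)] b' Suc.IH])
  moreover have "integral\<^sup>L (kernel_pow A \<kappa>' (Suc i) x) g = (\<integral>y. integral\<^sup>L (kernel_pow A \<kappa>' i y) g \<partial>\<kappa>' x)"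
    using pr_integral_bind[OF kernel_pr[OF \<kappa>' Suc.prems] k'p g(1)] by simp
  ultimately show ?case
    unfolding kernel_pow_Suc_integral[OF g(1) Suc.prems] by (simp add: algebra_simps)
qed

end

lemma measurable_kernel_pow:
  assumes "(\<lambda>(h, x). \<kappa> h x) \<in> X \<Otimes>\<^sub>M A \<rightarrow>\<^sub>M prob_algebra A"
  shows "(\<lambda>(h, x). kernel_pow A (\<kappa> h) i x) \<in> X \<Otimes>\<^sub>M A \<rightarrow>\<^sub>M prob_algebra A"
proof (induction i)
  case 0
  show ?case by (simp add: split_def)
next
  case (Suc i)
  have "(\<lambda>z. bind (case z of (h, x) \<Rightarrow> \<kappa> h x) (\<lambda>y. kernel_pow A (\<kappa> (fst z)) i y)) \<in> X \<Otimes>\<^sub>M A \<rightarrow>\<^sub>M prob_algebra A"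
  proof (rule measurable_bind_prob_space2[OF assms])
    have "(\<lambda>z. (fst (fst z), snd z)) \<in> (X \<Otimes>\<^sub>M A) \<Otimes>\<^sub>M A \<rightarrow>\<^sub>M X \<Otimes>\<^sub>M A" by measurable
    from measurable_compose[OF this Suc]
    show "(\<lambda>(z, y). kernel_pow A (\<kappa> (fst z)) i y) \<in> (X \<Otimes>\<^sub>M A) \<Otimes>\<^sub>M A \<rightarrow>\<^sub>M prob_algebra A"
      by (simp add: split_def)
  qed
  then show ?case by (simp add: split_def)
qed

section \<open>Chains of interacting levels\<close>

text \<open>
  The index \<open>(l, p)\<close> is level \<open>l\<close> at time \<open>p\<close>. The time horizon is infinite so that the functionals
  of all times live on one space.
\<close>

definition hist :: "(nat \<Rightarrow> 'a measure) \<Rightarrow> nat \<Rightarrow> (nat \<times> nat \<Rightarrow> 'a) measure" where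
  "hist S m = (\<Pi>\<^sub>M i\<in>{..m} \<times> UNIV. S (fst i))"

definition upd :: "nat \<Rightarrow> nat \<Rightarrow> (nat \<times> nat \<Rightarrow> 'a) \<Rightarrow> (nat \<Rightarrow> 'a) \<Rightarrow> nat \<times> nat \<Rightarrow> 'a" where
  "upd m k h y = (\<lambda>i\<in>{..m} \<times> UNIV. if snd i = k then y (fst i) else h i)"

lemma hist_component:
  "l \<le> m \<Longrightarrow> (\<lambda>h. h (l, p)) \<in> hist S m \<rightarrow>\<^sub>M S l"
  unfolding hist_def using measurable_component_singleton[of "(l, p)" "{..m} \<times> UNIV" "\<lambda>i. S (fst i)"] by simp

lemma hist_spaceD: "h \<in> space (hist S m) \<Longrightarrow> l \<le> m \<Longrightarrow> h (l, p) \<in> space (S l)"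
  by (auto dest: measurable_space[OF hist_component])

lemma upd_measurable: "(\<lambda>(h, y). upd m k h y) \<in> hist S m \<Otimes>\<^sub>M PiM {..m} S \<rightarrow>\<^sub>M hist S m"
  unfolding upd_def hist_def split_def
proof (rule measurable_restrict)
  fix i :: "nat \<times> nat" assume i: "i \<in> {..m} \<times> UNIV"
  have 1: "(\<lambda>x. snd x (fst i)) \<in> (\<Pi>\<^sub>M i\<in>{..m} \<times> UNIV. S (fst i)) \<Otimes>\<^sub>M PiM {..m} S \<rightarrow>\<^sub>M S (fst i)"
    by (rule measurable_compose[OF measurable_snd measurable_component_singleton]) (use i in auto)
  have 2: "(\<lambda>x. fst x i) \<in> (\<Pi>\<^sub>M i\<in>{..m} \<times> UNIV. S (fst i)) \<Otimes>\<^sub>M PiM {..m} S \<rightarrow>\<^sub>M S (fst i)"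
    by (rule measurable_compose[OF measurable_fst measurable_component_singleton]) (use i in auto)
  show "(\<lambda>x. if snd i = k then snd x (fst i) else fst x i)
      \<in> (\<Pi>\<^sub>M i\<in>{..m} \<times> UNIV. S (fst i)) \<Otimes>\<^sub>M PiM {..m} S \<rightarrow>\<^sub>M S (fst i)"
    using 1 2 by (cases "snd i = k") simp_all
qed

lemma upd_space: "h \<in> space (hist S m) \<Longrightarrow> y \<in> space (PiM {..m} S) \<Longrightarrow> upd m k h y \<in> space (hist S m)"
  using measurable_space[OF upd_measurable, of "(h, y)"] by (auto simp: space_pair_measure)

lemma upd_measurable1: "h \<in> space (hist S m) \<Longrightarrow> upd m k h \<in> PiM {..m} S \<rightarrow>\<^sub>M hist S m"
  using measurable_compose[OF measurable_Pair1' upd_measurable, of h S m k] unfolding case_prod_conv by blast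

lemma hist_fun_upd: "h \<in> space (hist S m) \<Longrightarrow> l \<le> m \<Longrightarrow> z \<in> space (S l) \<Longrightarrow> h((l, k) := z) \<in> space (hist S m)"
  unfolding hist_def by (rule fun_upd_PiM_space) auto

lemma upd_apply: "l \<le> m \<Longrightarrow> upd m k h y (l, p) = (if p = k then y l else h (l, p))"
  by (simp add: upd_def)

lemma upd_fun_upd_new: "l \<le> m \<Longrightarrow> upd m k h (y(l := z)) = (upd m k h y)((l, k) := z)"
  by (auto simp: upd_def fun_eq_iff)

lemma upd_fun_upd_old: "l \<le> m \<Longrightarrow> j \<noteq> k \<Longrightarrow> upd m k (h((l, j) := z)) y = (upd m k h y)((l, j) := z)"
  by (auto simp: upd_def fun_eq_iff)

text \<open>
  Given the history \<open>h\<close>, the kernel \<open>K l k h\<close> moves level \<open>l\<close> from time \<open>k\<close> to \<open>k + 1\<close>. It reads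
  level \<open>l - 1\<close> up to time \<open>k\<close> only. The bounds of order \<open>1 / (k + 1)\<close> express that it does so
  through the empirical measure: this measure moves by such an amount when one of its points is
  changed or when one more point is added. The last assumption is ergodicity of the kernels
  at a frozen history, uniform over histories.
\<close>

locale interacting_chains =
  fixes S :: "nat \<Rightarrow> 'a measure" and m :: nat
    and K :: "nat \<Rightarrow> nat \<Rightarrow> (nat \<times> nat \<Rightarrow> 'a) \<Rightarrow> 'a \<Rightarrow> 'a measure"
    and c :: real and n0 :: nat
  assumes c_nonneg: "0 \<le> c" and n0_pos: "0 < n0"
    and K_meas: "\<And>l k. l \<le> m \<Longrightarrow> (\<lambda>(h, x). K l k h x) \<in> hist S m \<Otimes>\<^sub>M S l \<rightarrow>\<^sub>M prob_algebra (S l)"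
    and K_local: "\<And>l k h h'. l \<le> m \<Longrightarrow> h \<in> space (hist S m) \<Longrightarrow> h' \<in> space (hist S m) \<Longrightarrow>
        (\<And>p. l \<noteq> 0 \<Longrightarrow> p \<le> k \<Longrightarrow> h (l - 1, p) = h' (l - 1, p)) \<Longrightarrow> K l k h = K l k h'"
    and K_coord: "\<And>l k h y j x g a. Suc l \<le> m \<Longrightarrow> h \<in> space (hist S m) \<Longrightarrow> y \<in> space (S l) \<Longrightarrow> j \<le> k \<Longrightarrow>
        x \<in> space (S (Suc l)) \<Longrightarrow> g \<in> bfun (S (Suc l)) \<Longrightarrow> osc_le (space (S (Suc l))) g a \<Longrightarrow>
        \<bar>integral\<^sup>L (K (Suc l) k (h((l, j) := y)) x) g - integral\<^sup>L (K (Suc l) k h x) g\<bar> \<le> c / real (Suc k) * a"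
    and K_time: "\<And>l k h x g a. l \<le> m \<Longrightarrow> h \<in> space (hist S m) \<Longrightarrow>
        x \<in> space (S l) \<Longrightarrow> g \<in> bfun (S l) \<Longrightarrow> osc_le (space (S l)) g a \<Longrightarrow>
        \<bar>integral\<^sup>L (K l (Suc k) h x) g - integral\<^sup>L (K l k h x) g\<bar> \<le> c / real (Suc k) * a"
    and K_contract: "\<And>l k h g a. l \<le> m \<Longrightarrow> h \<in> space (hist S m) \<Longrightarrow> g \<in> bfun (S l) \<Longrightarrow> osc_le (space (S l)) g a \<Longrightarrow>
        osc_le (space (S l)) (\<lambda>x. integral\<^sup>L (kernel_pow (S l) (K l k h) n0 x) g) (1/2 * a)"
begin

abbreviation H where "H \<equiv> hist S m"
abbreviation E where "E \<equiv> PiM {..m} S"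

lemma K_kernel: "l \<le> m \<Longrightarrow> h \<in> space H \<Longrightarrow> K l k h \<in> S l \<rightarrow>\<^sub>M prob_algebra (S l)"
  using measurable_compose[OF measurable_Pair1' K_meas, of h l k] unfolding case_prod_conv by blast

lemma K_pr: "l \<le> m \<Longrightarrow> h \<in> space H \<Longrightarrow> x \<in> space (S l) \<Longrightarrow> K l k h x \<in> pr (S l)"
  by (rule kernel_pr[OF K_kernel])

lemma K_meas': "l \<le> m \<Longrightarrow> g \<in> X \<rightarrow>\<^sub>M H \<Longrightarrow> f \<in> X \<rightarrow>\<^sub>M S l \<Longrightarrow> (\<lambda>x. K l k (g x) (f x)) \<in> X \<rightarrow>\<^sub>M prob_algebra (S l)"
  using measurable_compose[OF measurable_Pair K_meas, of g X f l k] unfolding case_prod_conv by blast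

abbreviation Kp where "Kp l k h i \<equiv> kernel_pow (S l) (K l k h) i"

definition law :: "nat \<Rightarrow> (nat \<times> nat \<Rightarrow> 'a) \<Rightarrow> (nat \<Rightarrow> 'a) measure" where
  "law k h = PiM {..m} (\<lambda>l. K l k h (h (l, k)))"

definition step :: "nat \<Rightarrow> (nat \<times> nat \<Rightarrow> 'a) \<Rightarrow> (nat \<times> nat \<Rightarrow> 'a) measure" where
  "step k h = distr (law k h) H (upd m (Suc k) h)"

text \<open>
  The law of the history after \<open>d\<close> further steps from time \<open>k\<close>.
\<close>

primrec run :: "nat \<Rightarrow> nat \<Rightarrow> (nat \<times> nat \<Rightarrow> 'a) \<Rightarrow> (nat \<times> nat \<Rightarrow> 'a) measure" where
  "run 0 k h = return H h"
| "run (Suc d) k h = bind (step k h) (run d (Suc k))"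

lemma law_kernel: "law k \<in> H \<rightarrow>\<^sub>M prob_algebra E"
  unfolding law_def by (intro measurable_PiM_kernel K_meas' hist_component) auto

lemma law_pr: "h \<in> space H \<Longrightarrow> law k h \<in> pr E"
  by (rule kernel_pr[OF law_kernel])

lemma step_kernel: "step k \<in> H \<rightarrow>\<^sub>M prob_algebra H"
  unfolding step_def
  by (rule measurable_distr_prob_space2[OF law_kernel upd_measurable])

lemma step_pr: "h \<in> space H \<Longrightarrow> step k h \<in> pr H"
  by (rule kernel_pr[OF step_kernel])

lemma step_integral:
  "h \<in> space H \<Longrightarrow> F \<in> bfun H \<Longrightarrow> integral\<^sup>L (step k h) F = (\<integral>y. F (upd m (Suc k) h y) \<partial>law k h)"
  unfolding step_def by (rule pr_integral_distr[OF law_pr upd_measurable1 bfun_meas])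

lemma run_kernel: "run d k \<in> H \<rightarrow>\<^sub>M prob_algebra H"
proof (induction d arbitrary: k)
  case 0 show ?case unfolding run.simps by simp
next
  case (Suc d)
  show ?case unfolding run.simps by (rule measurable_bind_prob_space[OF step_kernel Suc])
qed

lemma run_pr: "h \<in> space H \<Longrightarrow> run d k h \<in> pr H"
  by (rule kernel_pr[OF run_kernel])

lemma run_bfun: "F \<in> bfun H \<Longrightarrow> (\<lambda>h. integral\<^sup>L (run d k h) F) \<in> bfun H"
  by (rule bfun_kernel_integral1[OF run_kernel])

lemma run_0_integral: "h \<in> space H \<Longrightarrow> F \<in> bfun H \<Longrightarrow> integral\<^sup>L (run 0 k h) F = F h"
  by (simp add: integral_return bfun_meas)

lemma run_Suc_integral:
  "h \<in> space H \<Longrightarrow> F \<in> bfun H \<Longrightarrow>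
     integral\<^sup>L (run (Suc d) k h) F = (\<integral>h'. integral\<^sup>L (run d (Suc k) h') F \<partial>step k h)"
  using pr_integral_bind[OF step_pr run_kernel] by simp

lemma run_add: "h \<in> space H \<Longrightarrow> F \<in> bfun H \<Longrightarrow>
   integral\<^sup>L (run (d + e) k h) F = (\<integral>h'. integral\<^sup>L (run e (k + d) h') F \<partial>run d k h)"
proof (induction d arbitrary: k h)
  case 0
  then show ?case using run_0_integral[OF _ run_bfun, of h F k e k] by simp
next
  case (Suc d)
  have "integral\<^sup>L (run (Suc d + e) k h) F = (\<integral>h'. integral\<^sup>L (run (d + e) (Suc k) h') F \<partial>step k h)"
    using run_Suc_integral[OF Suc.prems, of "d + e"] by simp
  also have "\<dots> = (\<integral>h'. (\<integral>h''. integral\<^sup>L (run e (k + Suc d) h'') F \<partial>run d (Suc k) h') \<partial>step k h)"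
    using Suc.IH[OF _ Suc.prems(2), of _ "Suc k"] by (intro pr_integral_cong[OF step_pr[OF Suc.prems(1)]]) simp
  also have "\<dots> = (\<integral>h''. integral\<^sup>L (run e (k + Suc d) h'') F \<partial>run (Suc d) k h)"
    by (rule run_Suc_integral[OF Suc.prems(1) run_bfun[OF Suc.prems(2)], symmetric])
  finally show ?case .
qed

text \<open>
  Steps from time \<open>k\<close> on overwrite only coordinates of later times.
\<close>

lemma run_adapted:
  assumes F: "F \<in> bfun H" and h: "h \<in> space H"
    and ad: "\<And>h' h''. h' \<in> space H \<Longrightarrow> h'' \<in> space H \<Longrightarrow>
       (\<And>l p. l \<le> m \<Longrightarrow> p \<le> k \<Longrightarrow> h' (l, p) = h'' (l, p)) \<Longrightarrow> F h' = F h''"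
    and kk: "k \<le> k'"
  shows "integral\<^sup>L (run d k' h) F = F h"
  using h kk
proof (induction d arbitrary: k' h)
  case 0 then show ?case using run_0_integral[OF _ F] by blast
next
  case (Suc d)
  have "integral\<^sup>L (run (Suc d) k' h) F = (\<integral>h'. F h' \<partial>step k' h)"
    unfolding run_Suc_integral[OF Suc.prems(1) F]
    by (intro pr_integral_cong[OF step_pr[OF Suc.prems(1)]] Suc.IH) (use Suc.prems in auto)
  also have "\<dots> = (\<integral>y. F (upd m (Suc k') h y) \<partial>law k' h)"
    by (rule step_integral[OF Suc.prems(1) F])
  also have "\<dots> = (\<integral>y. F h \<partial>law k' h)"
    using Suc.prems
    by (intro pr_integral_cong[OF law_pr[OF Suc.prems(1)]] ad upd_space) (auto simp: upd_apply)
  also have "\<dots> = F h" by (rule pr_integral_const[OF law_pr[OF Suc.prems(1)]])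
  finally show ?case .
qed

subsection \<open>Propagation of oscillations\<close>

text \<open>
  A single frozen step need not contract oscillations, only \<open>n0\<close> steps do. The sensitivity to the
  coordinate at the current time is therefore measured along all powers \<open>i \<le> n0\<close> of the frozen
  kernel, against weights that decrease linearly from \<open>1\<close> to \<open>1/2\<close>. Then every step gains the fixed
  amount \<open>1 / (2 n0)\<close>, and the contraction closes the cycle, as it takes the power \<open>n0\<close> back to the
  power \<open>0\<close>.
\<close>

definition wt :: "nat \<Rightarrow> real" where "wt i = 1 - real i / (2 * real n0)"

definition past_osc :: "nat \<Rightarrow> nat \<Rightarrow> ((nat \<times> nat \<Rightarrow> 'a) \<Rightarrow> real) \<Rightarrow> real \<Rightarrow> bool" where
  "past_osc k l G \<alpha> \<longleftrightarrow> (\<forall>j<k. \<forall>h\<in>space H. \<forall>z\<in>space (S l). \<bar>G (h((l, j) := z)) - G h\<bar> \<le> \<alpha>)"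

definition present_osc :: "nat \<Rightarrow> nat \<Rightarrow> ((nat \<times> nat \<Rightarrow> 'a) \<Rightarrow> real) \<Rightarrow> real \<Rightarrow> bool" where
  "present_osc k l G B \<longleftrightarrow> (\<forall>h\<in>space H. \<forall>i\<le>n0.
     osc_le (space (S l)) (\<lambda>x. \<integral>z. G (h((l, k) := z)) \<partial>Kp l k h i x) (wt i * B))"

lemma wt_0 [simp]: "wt 0 = 1" and wt_n0 [simp]: "wt n0 = 1/2"
  using n0_pos by (auto simp: wt_def)

lemma wt_Suc: "wt (Suc i) = wt i - 1 / (2 * real n0)"
  by (simp add: wt_def add_divide_distrib)

lemma wt_bounds: "i \<le> n0 \<Longrightarrow> 1/2 \<le> wt i" "wt i \<le> 1"
  using n0_pos by (auto simp: wt_def field_simps)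

lemma bfun_coord:
  assumes "G \<in> bfun H" "h \<in> space H" "l \<le> m"
  shows "(\<lambda>z. G (h((l, k) := z))) \<in> bfun (S l)"
proof (rule bfun_compose[OF assms(1)])
  have "(\<lambda>(y, z). y((l, k) := z)) \<in> hist S m \<Otimes>\<^sub>M S l \<rightarrow>\<^sub>M hist S m"
    using measurable_fun_upd_pair[of "(l, k)" "{..m} \<times> UNIV" "\<lambda>i. S (fst i)"] assms(3) by (simp add: hist_def)
  from measurable_compose[OF measurable_Pair1'[OF assms(2)] this]
  show "(\<lambda>z. h((l, k) := z)) \<in> S l \<rightarrow>\<^sub>M H" unfolding case_prod_conv .
qed

lemma present_oscD:
  assumes "present_osc k l G B" "G \<in> bfun H" "h \<in> space H" "l \<le> m"
  shows "osc_le (space (S l)) (\<lambda>z. G (h((l, k) := z))) B"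
proof -
  have "osc_le (space (S l)) (\<lambda>x. \<integral>z. G (h((l, k) := z)) \<partial>Kp l k h 0 x) (wt 0 * B)"
    using assms unfolding present_osc_def by blast
  moreover have "(\<integral>z. G (h((l, k) := z)) \<partial>Kp l k h 0 x) = G (h((l, k) := x))" if "x \<in> space (S l)" for x
    by (rule kernel_pow_0_integral[OF K_kernel[OF assms(4,3)] bfun_coord[OF assms(2-4)] that])
  ultimately show ?thesis by (simp add: osc_le_def del: kernel_pow.simps)
qed

text \<open>
  A change of the coordinate \<open>(l, j)\<close> acts on the expectation after one step in three ways: through
  the dependence of \<open>G\<close> on this coordinate (the term \<open>\<alpha>\<close>), through the kernel of
  level \<open>l + 1\<close> (the term with \<open>\<beta>\<close>) and, if \<open>j = k\<close>, through the starting point of level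
  \<open>l\<close>. The third effect is not small; it is kept in the product on the right.
\<close>

lemma step_coord_change:
  assumes G: "G \<in> bfun H" and h: "h \<in> space H" and l: "l \<le> m" and j: "j \<le> k" and z: "z \<in> space (S l)"
    and past: "past_osc (Suc k) l G \<alpha>" and \<beta>: "0 \<le> \<beta>"
    and pres: "Suc l \<le> m \<Longrightarrow> present_osc (Suc k) (Suc l) G \<beta>"
  defines "x \<equiv> (if j = k then z else h (l, k))"
  shows "\<bar>integral\<^sup>L (step k (h((l, j) := z))) G
      - (\<integral>y. G (upd m (Suc k) h y) \<partial>PiM {..m} ((\<lambda>l'. K l' k h (h (l', k)))(l := K l k h x)))\<bar>
      \<le> \<alpha> + c / real (Suc k) * \<beta>"
proof -
  define h' where "h' = h((l, j) := z)"
  define \<mu> where "\<mu> = (\<lambda>l'. K l' k h (h (l', k)))(l := K l k h x)"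
  define \<mu>' where "\<mu>' l' = K l' k h' (h' (l', k))" for l'
  have h': "h' \<in> space H" unfolding h'_def by (rule hist_fun_upd[OF h l z])
  have x: "x \<in> space (S l)" using z hist_spaceD[OF h l] by (simp add: x_def)
  have \<mu>_pr: "\<mu> l' \<in> pr (S l')" if "l' \<in> {..m}" for l'
    using that K_pr[OF _ h] hist_spaceD[OF h] x l by (auto simp: \<mu>_def)
  have \<mu>'_pr: "\<mu>' l' \<in> pr (S l')" if "l' \<in> {..m}" for l'
    unfolding \<mu>'_def using that K_pr[OF _ h'] hist_spaceD[OF h'] by auto
  let ?f = "\<lambda>y. G (upd m (Suc k) h y)"
  have f: "?f \<in> bfun E" by (rule bfun_compose[OF G upd_measurable1[OF h]])
  have f': "(\<lambda>y. G (upd m (Suc k) h' y)) \<in> bfun E" by (rule bfun_compose[OF G upd_measurable1[OF h']])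
  have law': "law k h' = PiM {..m} \<mu>'" by (simp add: law_def \<mu>'_def[abs_def])
  have "integral\<^sup>L (step k h') G = (\<integral>y. G (upd m (Suc k) h' y) \<partial>PiM {..m} \<mu>')"
    using step_integral[OF h' G] law' by simp
  moreover have "\<bar>(\<integral>y. G (upd m (Suc k) h' y) \<partial>PiM {..m} \<mu>') - (\<integral>y. ?f y \<partial>PiM {..m} \<mu>')\<bar> \<le> \<alpha>"
  proof (rule pr_integral_near[OF pr_PiM f' f])
    show "\<mu>' l' \<in> pr (S l')" if "l' \<in> {..m}" for l' by (rule \<mu>'_pr[OF that])
    fix y assume y: "y \<in> space E"
    have "upd m (Suc k) h' y = (upd m (Suc k) h y)((l, j) := z)"
      unfolding h'_def using upd_fun_upd_old[OF l, of j "Suc k" h z y] j by simp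
    then show "\<bar>G (upd m (Suc k) h' y) - G (upd m (Suc k) h y)\<bar> \<le> \<alpha>"
      using past upd_space[OF h y] z j unfolding past_osc_def by simp
  qed
  moreover have "\<bar>(\<integral>y. ?f y \<partial>PiM {..m} \<mu>') - (\<integral>y. ?f y \<partial>PiM {..m} \<mu>)\<bar> \<le> c / real (Suc k) * \<beta>"
  proof -
    have same: "\<mu>' l' = \<mu> l'" if "l' \<le> m" "l' \<noteq> Suc l" for l'
    proof -
      have "K l' k h' = K l' k h"
        by (rule K_local[OF that(1) h' h]) (use that(2) in \<open>auto simp: h'_def\<close>)
      then show ?thesis by (auto simp: \<mu>'_def \<mu>_def h'_def x_def)
    qed
    show ?thesis
    proof (cases "Suc l \<le> m")
      case False
      then have "PiM {..m} \<mu>' = PiM {..m} \<mu>" by (intro PiM_cong) (auto intro: same)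
      then show ?thesis using c_nonneg \<beta> by simp
    next
      \<comment> \<open>only the factor of level \<open>l + 1\<close> reads level \<open>l\<close>\<close>
      case True
      let ?h1 = "h (Suc l, k)"
      have \<mu>1: "\<mu> (Suc l) = K (Suc l) k h ?h1" by (simp add: \<mu>_def)
      have eq: "PiM {..m} \<mu>' = PiM {..m} (\<mu>(Suc l := K (Suc l) k h' ?h1))"
      proof (rule PiM_cong[OF refl])
        fix l' assume "l' \<in> {..m}"
        then show "\<mu>' l' = (\<mu>(Suc l := K (Suc l) k h' ?h1)) l'"
          using same[of l'] by (auto simp: \<mu>'_def h'_def)
      qed
      show ?thesis unfolding eq
      proof (rule PiM_diff_one[OF _ _ \<mu>_pr _ f])
        show "K (Suc l) k h' ?h1 \<in> pr (S (Suc l))" by (rule K_pr[OF True h' hist_spaceD[OF h True]])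
        fix y assume y: "y \<in> space E"
        have e: "?f (y(Suc l := w)) = G ((upd m (Suc k) h y)((Suc l, Suc k) := w))" for w
          by (simp only: upd_fun_upd_new[OF True])
        have "osc_le (space (S (Suc l))) (\<lambda>w. ?f (y(Suc l := w))) \<beta>"
          unfolding e by (rule present_oscD[OF pres[OF True] G upd_space[OF h y] True])
        moreover have "(\<lambda>w. ?f (y(Suc l := w))) \<in> bfun (S (Suc l))"
          unfolding e by (rule bfun_coord[OF G upd_space[OF h y] True])
        ultimately show "\<bar>(\<integral>w. ?f (y(Suc l := w)) \<partial>K (Suc l) k h' ?h1) - (\<integral>w. ?f (y(Suc l := w)) \<partial>\<mu> (Suc l))\<bar>
            \<le> c / real (Suc k) * \<beta>"
          unfolding \<mu>1 unfolding h'_def by (intro K_coord[OF True h z j hist_spaceD[OF h True]])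
      qed (use True in auto)
    qed
  qed
  ultimately show ?thesis unfolding h'_def \<mu>_def by linarith
qed

lemma step_past_osc:
  assumes G: "G \<in> bfun H" and l: "l \<le> m"
    and past: "past_osc (Suc k) l G \<alpha>" and \<beta>: "0 \<le> \<beta>"
    and pres: "Suc l \<le> m \<Longrightarrow> present_osc (Suc k) (Suc l) G \<beta>"
  shows "past_osc k l (\<lambda>h. integral\<^sup>L (step k h) G) (\<alpha> + c / real (Suc k) * \<beta>)"
  unfolding past_osc_def
proof (intro allI impI ballI)
  fix j h z assume j: "j < k" and h: "h \<in> space H" and z: "z \<in> space (S l)"
  have "(\<lambda>l'. K l' k h (h (l', k)))(l := K l k h (h (l, k))) = (\<lambda>l'. K l' k h (h (l', k)))" by auto
  then show "\<bar>integral\<^sup>L (step k (h((l, j) := z))) G - integral\<^sup>L (step k h) G\<bar> \<le> \<alpha> + c / real (Suc k) * \<beta>"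
    using step_coord_change[OF G h l less_imp_le[OF j] z past \<beta> pres] j step_integral[OF h G]
    by (simp add: law_def)
qed

text \<open>
  Power \<open>i\<close> of the frozen kernel applied after the step is, up to errors, power \<open>i + 1\<close> applied
  before it. The errors are the two of the preceding lemma on a change of coordinate, and the change
  of the frozen kernel itself from time \<open>k\<close> to \<open>k + 1\<close>.
\<close>

lemma step_present_osc:
  assumes G: "G \<in> bfun H" and l: "l \<le> m"
    and past: "past_osc (Suc k) l G \<alpha>" and \<beta>: "0 \<le> \<beta>"
    and presS: "Suc l \<le> m \<Longrightarrow> present_osc (Suc k) (Suc l) G \<beta>"
    and pres: "present_osc (Suc k) l G B" and B: "0 \<le> B"
    and B': "\<And>i. i < n0 \<Longrightarrow> wt (Suc i) * B + 2 * (real n0 * (c / real (Suc k) * B))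
        + 2 * (\<alpha> + c / real (Suc k) * \<beta>) \<le> wt i * B'"
  shows "present_osc k l (\<lambda>h. integral\<^sup>L (step k h) G) B'"
proof -
  let ?G = "\<lambda>h. integral\<^sup>L (step k h) G"
  let ?\<epsilon> = "\<alpha> + c / real (Suc k) * \<beta>"
  have G': "?G \<in> bfun H" by (rule bfun_kernel_integral1[OF step_kernel G])
  have main: "osc_le (space (S l)) (\<lambda>x. \<integral>z. ?G (h((l, k) := z)) \<partial>Kp l k h i x) (wt i * B')"
    if h: "h \<in> space H" and i: "i < n0" for h i
  proof -
    note Kk = K_kernel[OF l h]
    let ?\<mu> = "\<lambda>l'. K l' k h (h (l', k))"
    have \<mu>: "?\<mu> l' \<in> pr (S l')" if "l' \<in> {..m}" for l'
      using that by (intro K_pr[OF _ h] hist_spaceD[OF h]) auto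
    have L: "PiM {..m} ?\<mu> \<in> pr E" by (rule pr_PiM[OF \<mu>])
    let ?f = "\<lambda>y. G (upd m (Suc k) h y)"
    have f: "?f \<in> bfun E" by (rule bfun_compose[OF G upd_measurable1[OF h]])
    have ff: "(\<lambda>(y, z). ?f (y(l := z))) \<in> bfun (E \<Otimes>\<^sub>M S l)" by (rule bfun_fun_upd[OF _ f]) (use l in auto)
    define g where "g y z = ?f (y(l := z))" for y z
    have g: "(\<lambda>(y, z). g y z) \<in> bfun (E \<Otimes>\<^sub>M S l)" unfolding g_def by (rule ff)
    have gy: "g y \<in> bfun (S l)" if "y \<in> space E" for y by (rule bfun_section(1)[OF g that])
    define \<phi> where "\<phi> y x = integral\<^sup>L (K l k h x) (g y)" for y x
    have \<phi>: "(\<lambda>(y, x). \<phi> y x) \<in> bfun (E \<Otimes>\<^sub>M S l)"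
    proof -
      have "(\<lambda>p. \<integral>z. g (fst p) z \<partial>K l k h (snd p)) \<in> bfun (E \<Otimes>\<^sub>M S l)"
      proof (rule bfun_kernel_integral[where Y="S l"])
        show "(\<lambda>p. K l k h (snd p)) \<in> E \<Otimes>\<^sub>M S l \<rightarrow>\<^sub>M prob_algebra (S l)"
          by (rule measurable_compose[OF measurable_snd Kk])
        have "(\<lambda>q. (fst (fst q), snd q)) \<in> (E \<Otimes>\<^sub>M S l) \<Otimes>\<^sub>M S l \<rightarrow>\<^sub>M E \<Otimes>\<^sub>M S l" by measurable
        from bfun_compose[OF g this]
        show "(\<lambda>(p, z). g (fst p) z) \<in> bfun ((E \<Otimes>\<^sub>M S l) \<Otimes>\<^sub>M S l)" by (simp add: split_def)
      qed
      then show ?thesis by (simp add: \<phi>_def split_def)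
    qed
    define \<Phi> where "\<Phi> x = (\<integral>y. \<phi> y x \<partial>PiM {..m} ?\<mu>)" for x
    have \<phi>': "(\<lambda>(x, y). \<phi> y x) \<in> bfun (S l \<Otimes>\<^sub>M E)"
      using bfun_compose[OF \<phi> measurable_pair_swap'[of "S l" E]] by (simp add: split_def)
    have \<Phi>: "\<Phi> \<in> bfun (S l)"
      unfolding \<Phi>_def by (rule bfun_kernel_integral[OF _ \<phi>']) (use L in auto)
    \<comment> \<open>\<open>\<Phi>\<close>: the step with the starting point of level \<open>l\<close> set to \<open>x\<close> and everything else frozen\<close>
    have near: "\<bar>?G (h((l, k) := x)) - \<Phi> x\<bar> \<le> ?\<epsilon>" if x: "x \<in> space (S l)" for x
    proof -
      have "(\<integral>y. ?f y \<partial>PiM {..m} (?\<mu>(l := K l k h x))) = \<Phi> x"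
        unfolding \<Phi>_def \<phi>_def g_def
        by (rule PiM_resample[OF _ _ \<mu> K_pr[OF l h x] f]) (use l in auto)
      then show ?thesis
        using step_coord_change[OF G h l order_refl x past \<beta> presS] by simp
    qed
    \<comment> \<open>level \<open>l\<close> moves independently of the other levels, so its next step can be taken last\<close>
    have \<Phi>_pow: "(\<integral>z. \<Phi> z \<partial>Kp l k h i x) = (\<integral>y. (integral\<^sup>L (Kp l k h (Suc i) x) (g y)) \<partial>PiM {..m} ?\<mu>)"
      if x: "x \<in> space (S l)" for x
    proof -
      have "(\<integral>z. \<Phi> z \<partial>Kp l k h i x) = (\<integral>y. (\<integral>z. \<phi> y z \<partial>Kp l k h i x) \<partial>PiM {..m} ?\<mu>)"
        unfolding \<Phi>_def by (rule pr_fubini(1)[OF kernel_pow_pr[OF Kk x] L \<phi>'])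
      also have "\<dots> = (\<integral>y. (integral\<^sup>L (Kp l k h (Suc i) x) (g y)) \<partial>PiM {..m} ?\<mu>)"
        unfolding \<phi>_def
        by (rule pr_integral_cong[OF L]) (rule kernel_pow_Suc_integral'[OF Kk gy x, symmetric])
      finally show ?thesis .
    qed
    have osc_y: "osc_le (space (S l)) (\<lambda>x. integral\<^sup>L (Kp l k h (Suc i) x) (g y))
        (wt (Suc i) * B + 2 * (real n0 * (c / real (Suc k) * B)))" if y: "y \<in> space E" for y
    proof -
      define h2 where "h2 = upd m (Suc k) h y"
      have h2: "h2 \<in> space H" unfolding h2_def by (rule upd_space[OF h y])
      have gy2: "g y z = G (h2((l, Suc k) := z))" for z
        unfolding g_def h2_def by (simp only: upd_fun_upd_new[OF l])
      have o: "osc_le (space (S l)) (g y) B"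
        unfolding gy2[abs_def] by (rule present_oscD[OF pres G h2 l])
      have o2: "osc_le (space (S l)) (\<lambda>x. integral\<^sup>L (Kp l (Suc k) h2 (Suc i) x) (g y)) (wt (Suc i) * B)"
        unfolding gy2[abs_def] using pres h2 i unfolding present_osc_def by (auto simp del: kernel_pow.simps)
      have Kh2: "K l k h2 = K l k h"
        by (rule K_local[OF l h2 h]) (use l in \<open>auto simp: h2_def upd_apply\<close>)
      have pert: "\<bar>integral\<^sup>L (Kp l (Suc k) h2 (Suc i) x) (g y) - integral\<^sup>L (Kp l k h (Suc i) x) (g y)\<bar>
          \<le> real n0 * (c / real (Suc k) * B)" if x: "x \<in> space (S l)" for x
      proof -
        have "\<bar>integral\<^sup>L (Kp l (Suc k) h2 (Suc i) x) (g y) - integral\<^sup>L (Kp l k h (Suc i) x) (g y)\<bar>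
          \<le> real (Suc i) * (c / real (Suc k) * B)"
          unfolding Kh2[symmetric]
          by (rule kernel_pow_perturb[OF K_kernel[OF l h2] K_kernel[OF l h2] K_time[OF l h2] gy[OF y] o x])
        also have "\<dots> \<le> real n0 * (c / real (Suc k) * B)"
          using i c_nonneg B by (intro mult_right_mono) auto
        finally show ?thesis .
      qed
      show ?thesis
      proof (rule osc_leI)
        fix x x' assume xx: "x \<in> space (S l)" "x' \<in> space (S l)"
        show "\<bar>integral\<^sup>L (Kp l k h (Suc i) x) (g y) - integral\<^sup>L (Kp l k h (Suc i) x') (g y)\<bar>
          \<le> wt (Suc i) * B + 2 * (real n0 * (c / real (Suc k) * B))"
          using osc_leD[OF o2 xx] pert[OF xx(1)] pert[OF xx(2)] by linarith
      qed
    qed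
    show ?thesis
    proof (rule osc_leI)
      fix x x' assume xx: "x \<in> space (S l)" "x' \<in> space (S l)"
      have bf: "(\<lambda>y. integral\<^sup>L (Kp l k h (Suc i) x) (g y)) \<in> bfun E" if "x \<in> space (S l)" for x
        by (rule bfun_kernel_integral[OF _ g]) (use kernel_pow_pr[OF Kk that] in \<open>auto simp del: kernel_pow.simps\<close>)
      have "\<bar>(\<integral>z. \<Phi> z \<partial>Kp l k h i x) - (\<integral>z. \<Phi> z \<partial>Kp l k h i x')\<bar>
          \<le> wt (Suc i) * B + 2 * (real n0 * (c / real (Suc k) * B))"
        unfolding \<Phi>_pow[OF xx(1)] \<Phi>_pow[OF xx(2)]
        by (rule pr_integral_near[OF L bf[OF xx(1)] bf[OF xx(2)] osc_leD[OF osc_y xx]])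
      moreover have "\<bar>(\<integral>z. ?G (h((l, k) := z)) \<partial>Kp l k h i x) - (\<integral>z. \<Phi> z \<partial>Kp l k h i x)\<bar> \<le> ?\<epsilon>"
        if "x \<in> space (S l)" for x
        by (rule pr_integral_near[OF kernel_pow_pr[OF Kk that] bfun_coord[OF G' h l] \<Phi> near])
      note near2 = this[OF xx(1)] this[OF xx(2)]
      have ar: "\<bar>p - q\<bar> \<le> W" if "\<bar>a - b\<bar> \<le> w" "\<bar>p - a\<bar> \<le> e" "\<bar>q - b\<bar> \<le> e" "w + 2 * e \<le> W"
        for a b p q w e W :: real using that by linarith
      ultimately show "\<bar>(\<integral>z. ?G (h((l, k) := z)) \<partial>Kp l k h i x) - (\<integral>z. ?G (h((l, k) := z)) \<partial>Kp l k h i x')\<bar>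
          \<le> wt i * B'"
        using ar near2 B'[OF i] by blast
    qed
  qed
  show ?thesis unfolding present_osc_def
  proof (intro ballI allI impI)
    fix h i assume h: "h \<in> space H" and i: "i \<le> n0"
    show "osc_le (space (S l)) (\<lambda>x. \<integral>z. ?G (h((l, k) := z)) \<partial>Kp l k h i x) (wt i * B')"
    proof (cases "i < n0")
      case True then show ?thesis by (rule main[OF h])
    next
      case False
      then have i: "i = n0" using i by simp
      have "osc_le (space (S l)) (\<lambda>x. \<integral>z. ?G (h((l, k) := z)) \<partial>Kp l k h 0 x) (wt 0 * B')"
        by (rule main[OF h n0_pos])
      moreover have "(\<integral>z. ?G (h((l, k) := z)) \<partial>Kp l k h 0 x) = ?G (h((l, k) := x))" if "x \<in> space (S l)" for x
        by (rule kernel_pow_0_integral[OF K_kernel[OF l h] bfun_coord[OF G' h l] that])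
      ultimately have "osc_le (space (S l)) (\<lambda>z. ?G (h((l, k) := z))) B'"
        by (simp add: osc_le_def del: kernel_pow.simps)
      from K_contract[OF l h bfun_coord[OF G' h l] this, of k] show ?thesis
        unfolding i by simp
    qed
  qed
qed

end

section \<open>Growth of sensitivities backwards in time\<close>

context interacting_chains begin

definition lip :: "((nat \<times> nat \<Rightarrow> 'a) \<Rightarrow> real) \<Rightarrow> real \<Rightarrow> bool" where
  "lip F a \<longleftrightarrow> (\<forall>l\<le>m. \<forall>j. \<forall>h\<in>space H. \<forall>z\<in>space (S l). \<bar>F (h((l, j) := z)) - F h\<bar> \<le> a)"

text \<open>
  The sensitivity at level \<open>l\<close> carries the weight \<open>rate ^ (m - l)\<close>. So the
  influence of level \<open>l\<close> on level \<open>l + 1\<close>, which is of order \<open>1/k\<close> at time \<open>k\<close>, appears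
  divided by \<open>rate\<close>. The value makes the growth of the sensitivity in one step backwards at most
  \<open>1 + 1 / (8 (k + 1))\<close>, which accumulates to less than a fourth root of \<open>n / k\<close>. Before the time \<open>burn_in\<close>
  the kernels vary too fast for the contraction to be of use, and each step costs a constant factor.
\<close>

definition rate :: real where "rate = 128 * real n0 * c + 1"
definition burn_in :: nat where "burn_in = nat \<lceil>16 * (real n0)\<^sup>2 * c\<rceil>"
definition burn_factor :: real where "burn_factor = 2 * (3 + 2 * real n0 * c)"
definition profile :: "nat \<Rightarrow> nat \<Rightarrow> real" where
  "profile n k = burn_factor ^ (burn_in - k) * (real (Suc n) / real (Suc k)) powr (1/4)"

definition value_at :: "nat \<Rightarrow> ((nat \<times> nat \<Rightarrow> 'a) \<Rightarrow> real) \<Rightarrow> nat \<Rightarrow> (nat \<times> nat \<Rightarrow> 'a) \<Rightarrow> real" where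
  "value_at n F k h = integral\<^sup>L (run (n - k) k h) F"

lemma value_at_bfun: "F \<in> bfun H \<Longrightarrow> value_at n F k \<in> bfun H"
  unfolding value_at_def[abs_def] by (rule run_bfun)

lemma value_at_last: "F \<in> bfun H \<Longrightarrow> h \<in> space H \<Longrightarrow> value_at n F n h = F h"
  unfolding value_at_def by (simp only: diff_self_eq_0 run_0_integral)

lemma value_at_step:
  "F \<in> bfun H \<Longrightarrow> h \<in> space H \<Longrightarrow> k < n \<Longrightarrow> value_at n F k h = integral\<^sup>L (step k h) (value_at n F (Suc k))"
  unfolding value_at_def using run_Suc_integral[of h F "n - Suc k" k] by (simp only: Suc_diff_Suc)

lemma rate_ge_1: "1 \<le> rate" and burn_factor_ge: "6 \<le> burn_factor"
  using c_nonneg by (auto simp: rate_def burn_factor_def)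

lemma profile_nonneg: "0 \<le> profile n k"
  unfolding profile_def using burn_factor_ge by simp

lemma root4_growth:
  fixes x :: real assumes "0 \<le> x" "x \<le> 1" shows "1 + x / 8 \<le> (1 + x) powr (1/4)"
proof -
  have "(1 + x / 8) ^ 4 = 1 + x / 2 + 3 * x\<^sup>2 / 32 + x ^ 3 / 128 + x ^ 4 / 4096"
    by (simp add: power4_eq_xxxx power3_eq_cube power2_eq_square field_simps)
  moreover have "x\<^sup>2 \<le> x" "x ^ 3 \<le> x" "x ^ 4 \<le> x"
    using assms power_decreasing[of 1 2 x] power_decreasing[of 1 3 x] power_decreasing[of 1 4 x] by auto
  ultimately have "(1 + x / 8) ^ 4 \<le> 1 + x" using assms by linarith
  then have "((1 + x / 8) ^ 4) powr (1/4) \<le> (1 + x) powr (1/4)"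
    using assms by (intro powr_mono2) auto
  moreover have "((1 + x / 8) ^ 4) powr (1/4) = 1 + x / 8"
  proof -
    have "(1 + x / 8) ^ 4 = (1 + x / 8) powr (real 4)" using assms by (subst powr_realpow) auto
    then have "((1 + x / 8) ^ 4) powr (1/4) = (1 + x / 8) powr (real 4 * (1/4))" by (simp only: powr_powr)
    then show ?thesis using assms by simp
  qed
  ultimately show ?thesis by simp
qed

lemma profile_growth: "(1 + 1 / (8 * real (Suc k))) * profile n (Suc k) \<le> profile n k"
  and profile_burn: "k < burn_in \<Longrightarrow> burn_factor * profile n (Suc k) \<le> profile n k"
proof -
  let ?P = "\<lambda>k. (real (Suc n) / real (Suc k)) powr (1/4)"
  have e: "real (Suc n) / real (Suc k) = (1 + 1 / real (Suc k)) * (real (Suc n) / real (Suc (Suc k)))"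
  proof -
    have "N / r = (1 + 1 / r) * (N / (r + 1))" if "r > 0" for N r :: real
    proof -
      have "1 + 1 / r = (r + 1) / r" using that by (simp add: field_simps)
      then show ?thesis using that by simp
    qed
    from this[of "real (Suc k)" "real (Suc n)"] show ?thesis by (simp add: add.commute)
  qed
  have P: "?P k = (1 + 1 / real (Suc k)) powr (1/4) * ?P (Suc k)"
    unfolding e by (rule powr_mult)
  have g: "1 + 1 / (8 * real (Suc k)) \<le> (1 + 1 / real (Suc k)) powr (1/4)"
    using root4_growth[of "1 / real (Suc k)"] by (simp add: mult.commute del: of_nat_Suc)
  then have P1: "(1 + 1 / (8 * real (Suc k))) * ?P (Suc k) \<le> ?P k"
    unfolding P by (intro mult_right_mono) auto
  have b: "burn_factor ^ (burn_in - Suc k) \<le> burn_factor ^ (burn_in - k)"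
    using burn_factor_ge by (intro power_increasing) auto
  have "(1 + 1 / (8 * real (Suc k))) * profile n (Suc k) = burn_factor ^ (burn_in - Suc k) * ((1 + 1 / (8 * real (Suc k))) * ?P (Suc k))"
    by (simp add: profile_def)
  also have "\<dots> \<le> burn_factor ^ (burn_in - k) * ?P k"
    using burn_factor_ge by (intro mult_mono b P1) auto
  finally show "(1 + 1 / (8 * real (Suc k))) * profile n (Suc k) \<le> profile n k"
    by (simp add: profile_def)
  have "1 \<le> (1 + 1 / real (Suc k)) powr (1/4)" by (intro ge_one_powr_ge_zero) auto
  then have P2: "?P (Suc k) \<le> ?P k" unfolding P using mult_right_mono[of 1 _ "?P (Suc k)"] by auto
  assume k: "k < burn_in"
  have "burn_factor * profile n (Suc k) = burn_factor ^ (burn_in - k) * ?P (Suc k)"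
    using k by (simp add: profile_def Suc_diff_Suc flip: power_Suc)
  also have "\<dots> \<le> profile n k"
    unfolding profile_def using burn_factor_ge P2 by (intro mult_left_mono) auto
  finally show "burn_factor * profile n (Suc k) \<le> profile n k" .
qed

lemma profile_mono: "profile n (Suc k) \<le> profile n k"
proof -
  have "1 * profile n (Suc k) \<le> (1 + 1 / (8 * real (Suc k))) * profile n (Suc k)"
    by (intro mult_right_mono profile_nonneg) auto
  with profile_growth[of k n] show ?thesis by linarith
qed

lemma profile_last: "1 \<le> profile n n"
  unfolding profile_def using burn_factor_ge by simp

text \<open>
  The four terms are the contraction, the variation of the frozen kernel, the past of the own
  level and the influence of the next level. Each of the last three is at most a quarter of the gain of the first.
\<close>

lemma present_budget:
  assumes i: "i < n0" and k: "k \<ge> burn_in"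
  shows "wt (Suc i) + 2 * real n0 * c / real (Suc k) + 2 / (16 * real n0) + 2 * c / (real (Suc k) * rate) \<le> wt i"
proof -
  have n0: "1 \<le> real n0" using n0_pos by simp
  have "16 * (real n0)\<^sup>2 * c \<le> real burn_in" unfolding burn_in_def by linarith
  also have "\<dots> \<le> real (Suc k)" using k by simp
  finally have "2 * real n0 * c / real (Suc k) \<le> 1 / (8 * real n0)"
    using n0 by (simp add: field_simps power2_eq_square)
  moreover have "2 * c / (real (Suc k) * rate) \<le> 1 / (8 * real n0)"
  proof -
    have "16 * real n0 * c \<le> rate" using c_nonneg n0 by (simp add: rate_def)
    also have "\<dots> \<le> real (Suc k) * rate" using rate_ge_1 by simp
    finally have "2 * c * (8 * real n0) \<le> real (Suc k) * rate" by (simp only: mult_ac)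
    then show ?thesis using rate_ge_1 n0 by (simp add: divide_simps del: of_nat_Suc)
  qed
  moreover have "2 / (16 * real n0) = 1 / (8 * real n0)" by simp
  moreover have "3 * (1 / (8 * real n0)) \<le> 1 / (2 * real n0)" using n0 by (simp add: field_simps)
  ultimately show ?thesis unfolding wt_Suc by linarith
qed

lemma present_budget_burn:
  assumes i: "i < n0"
  shows "wt (Suc i) + 2 * real n0 * c / real (Suc k) + 2 / (16 * real n0) + 2 * c / (real (Suc k) * rate)
     \<le> wt i * burn_factor"
proof -
  have n0: "1 \<le> real n0" using n0_pos by simp
  have "2 * real n0 * c / real (Suc k) \<le> 2 * real n0 * c / 1"
    using c_nonneg by (intro divide_left_mono) auto
  moreover have "2 * c / (real (Suc k) * rate) \<le> 1"
  proof -
    have "2 * c \<le> 128 * real n0 * c + 1"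
      using mult_right_mono[OF n0, of "128 * c"] c_nonneg by simp
    also have "\<dots> \<le> real (Suc k) * rate"
      using mult_right_mono[of 1 "real (Suc k)" rate] rate_ge_1 by (simp add: rate_def)
    finally show ?thesis using rate_ge_1 by (simp add: divide_simps)
  qed
  moreover have "2 / (16 * real n0) \<le> 1" using n0 by (simp add: field_simps)
  moreover have "wt (Suc i) \<le> 1" using wt_bounds[of "Suc i"] i by simp
  moreover have "1/2 * burn_factor \<le> wt i * burn_factor"
    using wt_bounds[of i] i burn_factor_ge by (intro mult_right_mono) auto
  ultimately show ?thesis unfolding burn_factor_def by simp
qed

lemma lip_diff: "lip F a \<Longrightarrow> l \<le> m \<Longrightarrow> h \<in> space H \<Longrightarrow> osc_le (space (S l)) (\<lambda>z. F (h((l, k) := z))) a"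
proof (rule osc_leI)
  fix x y assume *: "lip F a" "l \<le> m" "h \<in> space H" "x \<in> space (S l)" "y \<in> space (S l)"
  have "\<bar>F ((h((l, k) := y))((l, k) := x)) - F (h((l, k) := y))\<bar> \<le> a"
    using * hist_fun_upd[OF *(3,2,5)] unfolding lip_def by blast
  then show "\<bar>F (h((l, k) := x)) - F (h((l, k) := y))\<bar> \<le> a" by simp
qed

text \<open>
  Backward induction in time, simultaneously for all levels.
\<close>

lemma value_at_osc:
  assumes F: "F \<in> bfun H" and lipF: "lip F a" and a: "0 \<le> a"
  shows "k \<le> n \<Longrightarrow> l \<le> m \<Longrightarrow> past_osc k l (value_at n F k) (a * rate ^ (m - l) * profile n k) \<and>
     present_osc k l (value_at n F k) (16 * real n0 * (a * rate ^ (m - l) * profile n k))"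
proof (induction "n - k" arbitrary: k l)
  case 0
  then have k: "k = n" by simp
  have "1 * 1 \<le> rate ^ (m - l) * profile n n"
    using rate_ge_1 by (intro mult_mono profile_last one_le_power) auto
  from mult_left_mono[OF this a]
  have A: "a \<le> a * rate ^ (m - l) * profile n n" (is "a \<le> ?A") by (simp add: mult.assoc)
  have "past_osc n l (value_at n F n) ?A"
    unfolding past_osc_def
  proof (intro allI impI ballI)
    fix j h z assume *: "j < n" "h \<in> space H" "z \<in> space (S l)"
    then have "\<bar>F (h((l, j) := z)) - F h\<bar> \<le> a" using lipF 0 unfolding lip_def by blast
    then show "\<bar>value_at n F n (h((l, j) := z)) - value_at n F n h\<bar> \<le> ?A"
      using A value_at_last[OF F] hist_fun_upd[OF *(2) 0(3) *(3)] * by simp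
  qed
  moreover have "present_osc n l (value_at n F n) (16 * real n0 * ?A)"
    unfolding present_osc_def
  proof (intro ballI allI impI)
    fix h i assume h: "h \<in> space H" and i: "i \<le> n0"
    have "osc_le (space (S l)) (\<lambda>z. value_at n F n (h((l, n) := z))) a"
      using lip_diff[OF lipF 0(3) h, of n] value_at_last[OF F hist_fun_upd[OF h 0(3)], of _ n n]
      by (simp add: osc_le_def)
    from kernel_pow_osc_le[OF K_kernel[OF 0(3) h] bfun_coord[OF value_at_bfun[OF F] h 0(3)] this]
    have "osc_le (space (S l)) (\<lambda>x. \<integral>z. value_at n F n (h((l, n) := z)) \<partial>Kp l n h i x) a" .
    moreover have "a \<le> wt i * (16 * real n0 * ?A)"
    proof -
      have "1 \<le> wt i * (16 * real n0)"
      proof -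
        have "1/2 * 16 \<le> wt i * (16 * real n0)"
          using wt_bounds(1)[OF i] n0_pos by (intro mult_mono) auto
        then show ?thesis by linarith
      qed
      then have "1 * a \<le> wt i * (16 * real n0) * ?A" by (intro mult_mono A) (use a wt_bounds(1)[OF i] in auto)
      then show ?thesis by (simp only: mult.assoc mult_1)
    qed
    ultimately show "osc_le (space (S l)) (\<lambda>x. \<integral>z. value_at n F n (h((l, n) := z)) \<partial>Kp l n h i x) (wt i * (16 * real n0 * ?A))"
      by (rule osc_le_mono)
  qed
  ultimately show ?case unfolding k ..
next
  case (Suc d)
  then have kn: "k < n" by simp
  have IH: "past_osc (Suc k) l' (value_at n F (Suc k)) (a * rate ^ (m - l') * profile n (Suc k))"
    "present_osc (Suc k) l' (value_at n F (Suc k)) (16 * real n0 * (a * rate ^ (m - l') * profile n (Suc k)))"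
    if "l' \<le> m" for l'
    using Suc(1)[of "Suc k" l'] Suc(2) kn that by auto
  let ?A = "\<lambda>k. a * rate ^ (m - l) * profile n k"
  let ?Q = "16 * real n0"
  let ?\<beta> = "?Q * ?A (Suc k) / rate"
  note G = value_at_bfun[OF F, of n "Suc k"]
  have A0: "0 \<le> ?A k'" for k' using a rate_ge_1 profile_nonneg by simp
  have \<beta>: "0 \<le> ?\<beta>" using A0[of "Suc k"] rate_ge_1 by simp
  \<comment> \<open>one level up the invariant has one factor \<open>rate\<close> less\<close>
  have presS: "present_osc (Suc k) (Suc l) (value_at n F (Suc k)) ?\<beta>" if "Suc l \<le> m"
  proof -
    have "m - l = Suc (m - Suc l)" using that by simp
    then have "rate ^ (m - l) = rate * rate ^ (m - Suc l)" by simp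
    then have "?\<beta> = ?Q * (a * rate ^ (m - Suc l) * profile n (Suc k))" using rate_ge_1 by simp
    then show ?thesis using IH(2)[OF that] by simp
  qed
  have V: "value_at n F k h = integral\<^sup>L (step k h) (value_at n F (Suc k))" if "h \<in> space H" for h
    by (rule value_at_step[OF F that kn])
  have "past_osc k l (\<lambda>h. integral\<^sup>L (step k h) (value_at n F (Suc k))) (?A (Suc k) + c / real (Suc k) * ?\<beta>)"
    by (rule step_past_osc[OF G Suc(4) IH(1)[OF Suc(4)] \<beta> presS])
  moreover have "?A (Suc k) + c / real (Suc k) * ?\<beta> \<le> ?A k"
  proof -
    have "c * ?Q * 8 \<le> rate" by (simp add: rate_def)
    then have "c * ?Q / rate \<le> 1 / 8" using rate_ge_1 by (simp add: divide_simps)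
    then have "c * ?Q / rate * (?A (Suc k) / real (Suc k)) \<le> 1/8 * (?A (Suc k) / real (Suc k))"
      using A0[of "Suc k"] by (intro mult_right_mono) auto
    then have "?A (Suc k) + c / real (Suc k) * ?\<beta> \<le> ?A (Suc k) + 1/8 * (?A (Suc k) / real (Suc k))"
      by (simp add: mult_ac)
    also have "\<dots> = (a * rate ^ (m - l)) * ((1 + 1 / (8 * real (Suc k))) * profile n (Suc k))"
      by (simp add: algebra_simps)
    also have "\<dots> \<le> ?A k"
      using mult_left_mono[OF profile_growth[of k n], of "a * rate ^ (m - l)"] a rate_ge_1 by simp
    finally show ?thesis .
  qed
  ultimately have 1: "past_osc k l (\<lambda>h. integral\<^sup>L (step k h) (value_at n F (Suc k))) (?A k)"
    unfolding past_osc_def by (meson order_trans)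
  have 2: "present_osc k l (\<lambda>h. integral\<^sup>L (step k h) (value_at n F (Suc k))) (?Q * ?A k)"
  proof (rule step_present_osc[OF G Suc(4) IH(1)[OF Suc(4)] \<beta> presS IH(2)[OF Suc(4)]])
    show "0 \<le> ?Q * ?A (Suc k)" using A0 by simp
    fix i assume i: "i < n0"
    let ?br = "wt (Suc i) + 2 * real n0 * c / real (Suc k) + 2 / ?Q + 2 * c / (real (Suc k) * rate)"
    have "wt (Suc i) * (?Q * ?A (Suc k)) + 2 * (real n0 * (c / real (Suc k) * (?Q * ?A (Suc k))))
        + 2 * (?A (Suc k) + c / real (Suc k) * ?\<beta>) = ?Q * ?A (Suc k) * ?br"
      using n0_pos rate_ge_1 by (simp add: field_simps del: of_nat_Suc)
    also have "\<dots> \<le> wt i * (?Q * ?A k)"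
    proof (cases "k < burn_in")
      case True
      have "?Q * ?A (Suc k) * ?br \<le> ?Q * ?A (Suc k) * (wt i * burn_factor)"
        using A0 by (intro mult_left_mono present_budget_burn[OF i]) auto
      also have "\<dots> = wt i * ?Q * (a * rate ^ (m - l)) * (burn_factor * profile n (Suc k))"
        by (simp add: mult_ac)
      also have "\<dots> \<le> wt i * ?Q * (a * rate ^ (m - l)) * profile n k"
        using a rate_ge_1 wt_bounds(1)[of i] i by (intro mult_left_mono profile_burn[OF True]) auto
      finally show ?thesis by (simp add: mult_ac)
    next
      case False
      have "?Q * ?A (Suc k) * ?br \<le> ?Q * ?A (Suc k) * wt i"
        using A0 False by (intro mult_left_mono present_budget[OF i]) auto
      also have "\<dots> = wt i * ?Q * (a * rate ^ (m - l)) * profile n (Suc k)"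
        by (simp add: mult_ac)
      also have "\<dots> \<le> wt i * ?Q * (a * rate ^ (m - l)) * profile n k"
        using a rate_ge_1 wt_bounds(1)[of i] i by (intro mult_left_mono profile_mono) auto
      finally show ?thesis by (simp add: mult_ac)
    qed
    finally show "wt (Suc i) * (?Q * ?A (Suc k)) + 2 * (real n0 * (c / real (Suc k) * (?Q * ?A (Suc k))))
        + 2 * (?A (Suc k) + c / real (Suc k) * ?\<beta>) \<le> wt i * (?Q * ?A k)" .
  qed
  have "past_osc k l (value_at n F k) (?A k)"
    using 1 V hist_fun_upd[OF _ Suc(4)] unfolding past_osc_def by (metis (no_types, lifting))
  moreover have "present_osc k l (value_at n F k) (?Q * ?A k)"
  proof -
    have "(\<integral>z. value_at n F k (h((l, k) := z)) \<partial>Kp l k h i x)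
        = (\<integral>z. integral\<^sup>L (step k (h((l, k) := z))) (value_at n F (Suc k)) \<partial>Kp l k h i x)"
      if "h \<in> space H" "x \<in> space (S l)" for h x i
      by (rule pr_integral_cong[OF kernel_pow_pr[OF K_kernel[OF Suc(4) that(1)] that(2)]])
         (rule V[OF hist_fun_upd[OF that(1) Suc(4)]])
    then show ?thesis using 2 unfolding present_osc_def osc_le_def by (simp del: kernel_pow.simps)
  qed
  ultimately show ?case ..
qed

definition block_osc :: "nat \<Rightarrow> nat \<Rightarrow> real" where
  "block_osc n k = real (Suc m) * (16 * real n0) * rate ^ m * profile n k"

lemma block_osc_nonneg: "0 \<le> block_osc n k"
  using rate_ge_1 profile_nonneg by (simp add: block_osc_def)

text \<open>
  The levels are changed one after another.
\<close>

lemma value_at_block: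
  assumes F: "F \<in> bfun H" and lipF: "lip F a" and a: "0 \<le> a" and k: "k \<le> n" and h: "h \<in> space H"
    and y: "y \<in> space E" "y' \<in> space E"
  shows "\<bar>value_at n F k (upd m k h y) - value_at n F k (upd m k h y')\<bar> \<le> a * block_osc n k"
proof -
  let ?G = "value_at n F k"
  let ?b = "\<lambda>l. 16 * real n0 * (a * rate ^ (m - l) * profile n k)"
  let ?y = "\<lambda>J l. if l \<in> J then y l else y' l"
  have yJ: "?y J \<in> space E" for J using y by (auto simp: space_PiM PiE_iff extensional_def)
  have "\<bar>?G (upd m k h (?y J)) - ?G (upd m k h y')\<bar> \<le> (\<Sum>l\<in>J. ?b l)" if "finite J" "J \<subseteq> {..m}" for J
    using that
  proof (induction J rule: finite_induct)
    case empty then show ?case by simp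
  next
    case (insert l J)
    have l: "l \<le> m" using insert by auto
    let ?h = "upd m k h (?y J)"
    have hJ: "?h \<in> space H" by (rule upd_space[OF h yJ])
    have e: "?y (insert l J) = (?y J)(l := y l)" by auto
    have 1: "upd m k h (?y (insert l J)) = ?h((l, k) := y l)" unfolding e by (rule upd_fun_upd_new[OF l])
    have yl: "y l \<in> space (S l)" using y(1) l by (auto simp: space_PiM)
    have "\<bar>?G (?h((l, k) := y l)) - ?G (?h((l, k) := ?h (l, k)))\<bar> \<le> ?b l"
      using value_at_osc[OF F lipF a k l]
      by (intro osc_leD[OF present_oscD[OF _ value_at_bfun[OF F] hJ l]] yl hist_spaceD[OF hJ l]) auto
    then have "\<bar>?G (upd m k h (?y (insert l J))) - ?G ?h\<bar> \<le> ?b l" unfolding 1 by simp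
    moreover have "\<bar>?G ?h - ?G (upd m k h y')\<bar> \<le> (\<Sum>l\<in>J. ?b l)" using insert by auto
    moreover have "(\<Sum>l\<in>insert l J. ?b l) = ?b l + (\<Sum>l\<in>J. ?b l)" using insert by simp
    ultimately show ?case by linarith
  qed
  from this[of "{..m}"]
  have "\<bar>?G (upd m k h (?y {..m})) - ?G (upd m k h y')\<bar> \<le> (\<Sum>l\<le>m. ?b l)" by simp
  also have "(\<Sum>l\<le>m. ?b l) \<le> (\<Sum>l\<le>m. 16 * real n0 * (a * rate ^ m * profile n k))"
    using a rate_ge_1 profile_nonneg
    by (intro sum_mono mult_left_mono mult_right_mono power_increasing) auto
  also have "\<dots> = a * block_osc n k" by (simp add: block_osc_def)
  also have "upd m k h (?y {..m}) = upd m k h y" by (auto simp: upd_def fun_eq_iff)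
  finally show ?thesis .
qed

lemma sum_inverse_sqrt: "(\<Sum>k\<le>n. 1 / sqrt (real (Suc k))) \<le> 2 * sqrt (real (Suc n))"
proof (induction n)
  case 0 show ?case by simp
next
  case (Suc n)
  let ?x = "real (Suc n)" and ?y = "real (Suc (Suc n))"
  have yx: "?y = ?x + 1" by simp
  have "(sqrt ?y - sqrt ?x) * (sqrt ?y + sqrt ?x) = 1"
    using yx by (simp add: algebra_simps)
  moreover have "(sqrt ?y - sqrt ?x) * (sqrt ?y + sqrt ?x) \<le> (sqrt ?y - sqrt ?x) * (2 * sqrt ?y)"
    by (intro mult_left_mono) auto
  ultimately have "1 \<le> (sqrt ?y - sqrt ?x) * (2 * sqrt ?y)" by (simp only:)
  then have "1 \<le> (sqrt ?y - sqrt ?x) * 2 * sqrt ?y" by (simp only: mult.assoc)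
  then have "1 / sqrt ?y \<le> (sqrt ?y - sqrt ?x) * 2" by (subst pos_divide_le_eq) auto
  with Suc show ?case unfolding sum.atMost_Suc by (simp add: algebra_simps)
qed

definition vconst :: real where
  "vconst = 2 * (real (Suc m) * (16 * real n0) * rate ^ m * burn_factor ^ burn_in)\<^sup>2"

lemma vconst_pos: "0 < vconst"
  unfolding vconst_def using rate_ge_1 burn_factor_ge n0_pos
  by (intro mult_pos_pos zero_less_power) auto

text \<open>
  The squares grow like \<open>(n / k)\<^sup>1\<^sup>/\<^sup>2\<close>, which is summable over \<open>k \<le> n\<close> at the rate \<open>n\<close>, the one
  of independent variables.
\<close>

lemma sum_block_osc: "(\<Sum>k\<le>n. (block_osc n k)\<^sup>2) \<le> vconst * real (Suc n)"
proof -
  let ?C = "real (Suc m) * (16 * real n0) * rate ^ m * burn_factor ^ burn_in"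
  have C0: "0 \<le> ?C" using rate_ge_1 burn_factor_ge by simp
  have "(block_osc n k)\<^sup>2 \<le> ?C\<^sup>2 * sqrt (real (Suc n)) * (1 / sqrt (real (Suc k)))" for k
  proof -
    let ?q = "real (Suc n) / real (Suc k)"
    have "burn_factor ^ (burn_in - k) \<le> burn_factor ^ burn_in"
      using burn_factor_ge by (intro power_increasing) auto
    then have "profile n k \<le> burn_factor ^ burn_in * ?q powr (1/4)"
      unfolding profile_def by (intro mult_right_mono) auto
    then have "block_osc n k \<le> ?C * ?q powr (1/4)"
      unfolding block_osc_def using rate_ge_1
      by (subst mult.assoc, intro mult_left_mono) auto
    then have "(block_osc n k)\<^sup>2 \<le> (?C * ?q powr (1/4))\<^sup>2"
      by (intro power_mono block_osc_nonneg)
    also have "\<dots> = ?C\<^sup>2 * (?q powr (1/4))\<^sup>2" by (rule power_mult_distrib)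
    also have "(?q powr (1/4))\<^sup>2 = sqrt ?q"
      by (simp add: powr_half_sqrt[symmetric] power2_eq_square flip: powr_add)
    also have "sqrt ?q = sqrt (real (Suc n)) * (1 / sqrt (real (Suc k)))" by (simp add: real_sqrt_divide)
    finally show ?thesis by (simp add: mult.assoc)
  qed
  then have "(\<Sum>k\<le>n. (block_osc n k)\<^sup>2) \<le> (\<Sum>k\<le>n. ?C\<^sup>2 * sqrt (real (Suc n)) * (1 / sqrt (real (Suc k))))"
    by (intro sum_mono)
  also have "\<dots> = ?C\<^sup>2 * sqrt (real (Suc n)) * (\<Sum>k\<le>n. 1 / sqrt (real (Suc k)))"
    by (rule sum_distrib_left[symmetric])
  also have "\<dots> \<le> ?C\<^sup>2 * sqrt (real (Suc n)) * (2 * sqrt (real (Suc n)))"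
    by (intro mult_left_mono sum_inverse_sqrt) auto
  also have "\<dots> = (2 * ?C\<^sup>2) * (sqrt (real (Suc n)) * sqrt (real (Suc n)))" by (simp only: mult_ac)
  also have "\<dots> = vconst * real (Suc n)" unfolding vconst_def by (simp only: real_sqrt_mult_self abs_of_nat)
  finally show ?thesis .
qed

end

section \<open>Concentration and decoupling\<close>

lemma hoeffding_pr:
  assumes \<mu>: "\<mu> \<in> pr A" and f: "f \<in> bfun A" and o: "osc_le (space A) f d"
  shows "(\<integral>x. exp (s * (f x - integral\<^sup>L \<mu> f)) \<partial>\<mu>) \<le> exp (s\<^sup>2 * d\<^sup>2 / 2)"
proof -
  have main: "(\<integral>x. exp (s * (f x - integral\<^sup>L \<mu> f)) \<partial>\<mu>) \<le> exp (s\<^sup>2 * d\<^sup>2 / 2)"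
    if s: "s > 0" and f: "f \<in> bfun A" and o: "osc_le (space A) f d" for s f
  proof -
    interpret prob_space \<mu> using prD \<mu> by blast
    let ?e = "integral\<^sup>L \<mu> f"
    interpret interval_bounded_random_variable \<mu> f "?e - d" "?e + d"
    proof
      show "random_variable borel f"
        using bfun_meas[OF f] prD(2)[OF \<mu>] by (simp cong: measurable_cong_sets)
      show "AE x in \<mu>. f x \<in> {?e - d..?e + d}"
        using integral_osc(2)[OF \<mu> \<mu> f o] prD(3)[OF \<mu>] by (intro AE_I2) (fastforce simp: abs_le_iff)
    qed
    have b: "(\<lambda>x. exp (s * (f x - ?e))) \<in> bfun A"
      by (intro bfun_exp bfun_mult bfun_diff f bfun_const)
    have "ennreal (\<integral>x. exp (s * (f x - ?e)) \<partial>\<mu>) = (\<integral>\<^sup>+x. ennreal (exp (s * (f x - ?e))) \<partial>\<mu>)"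
      by (rule nn_integral_eq_integral[OF bfun_integrable[OF \<mu> b], symmetric]) auto
    also have "\<dots> \<le> ennreal (exp (s\<^sup>2 * (?e + d - (?e - d))\<^sup>2 / 8))"
      by (rule Hoeffdings_lemma_nn_integral[OF s])
    finally have "(\<integral>x. exp (s * (f x - ?e)) \<partial>\<mu>) \<le> exp (s\<^sup>2 * (?e + d - (?e - d))\<^sup>2 / 8)"
      by (subst (asm) ennreal_le_iff) auto
    also have "s\<^sup>2 * (?e + d - (?e - d))\<^sup>2 / 8 = s\<^sup>2 * d\<^sup>2 / 2" by (simp add: power2_eq_square)
    finally show ?thesis .
  qed
  consider "s > 0" | "s = 0" | "s < 0" by linarith
  then show ?thesis
  proof cases
    case 1 then show ?thesis by (rule main[OF _ f o])
  next
    case 2 then show ?thesis using pr_integral_const[OF \<mu>, of 1] by simp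
  next
    case 3
    have "osc_le (space A) (\<lambda>x. - f x) d" using o by (auto simp: osc_le_def abs_minus_commute)
    from main[OF _ bfun_minus[OF f] this, of "- s"] 3 show ?thesis by (simp add: algebra_simps)
  qed
qed

text \<open>
  Let \<open>x\<close> and \<open>y\<close> be independent with law \<open>\<mu>\<close>. As they can be exchanged, twice the difference
  is the mean of the mixed second difference of \<open>A\<close>.
\<close>

lemma decouple_pr:
  assumes \<mu>: "\<mu> \<in> pr X" and A: "(\<lambda>(x, y). A x y) \<in> bfun (X \<Otimes>\<^sub>M X)"
    and mixed: "\<And>x y. x \<in> space X \<Longrightarrow> y \<in> space X \<Longrightarrow> \<bar>A x x - A x y - A y x + A y y\<bar> \<le> \<delta>"
  shows "\<bar>(\<integral>x. A x x \<partial>\<mu>) - (\<integral>x. (\<integral>y. A x y \<partial>\<mu>) \<partial>\<mu>)\<bar> \<le> \<delta> / 2"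
proof -
  have d: "(\<lambda>x. A x x) \<in> bfun X"
    using bfun_compose[OF A, of "\<lambda>x. (x, x)" X] by simp
  have A2: "(\<lambda>(x, y). A y x) \<in> bfun (X \<Otimes>\<^sub>M X)"
    using bfun_compose[OF A measurable_pair_swap'[of X X]] by (simp add: split_def)
  have K: "(\<lambda>x. \<mu>) \<in> X \<rightarrow>\<^sub>M prob_algebra X" using \<mu> by simp
  note i1 = bfun_kernel_integral[OF K A] and i2 = bfun_kernel_integral[OF K A2]
  let ?D = "\<integral>x. A x x \<partial>\<mu>"
  let ?I = "\<integral>x. (\<integral>y. A x y \<partial>\<mu>) \<partial>\<mu>"
  have inner: "\<bar>(A x x + ?D) - ((\<integral>y. A x y \<partial>\<mu>) + (\<integral>y. A y x \<partial>\<mu>))\<bar> \<le> \<delta>" if x: "x \<in> space X" for x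
  proof -
    note s1 = bfun_section(1)[OF A x] and s2 = bfun_section(2)[OF A x]
    have "\<bar>(\<integral>y. A x x + A y y \<partial>\<mu>) - (\<integral>y. A x y + A y x \<partial>\<mu>)\<bar> \<le> \<delta>"
    proof (rule pr_integral_near[OF \<mu>])
      show "(\<lambda>y. A x x + A y y) \<in> bfun X" "(\<lambda>y. A x y + A y x) \<in> bfun X"
        by (intro bfun_add bfun_const d s1 s2)+
      show "\<bar>A x x + A y y - (A x y + A y x)\<bar> \<le> \<delta>" if "y \<in> space X" for y
        using mixed[OF x that] by (simp add: algebra_simps)
    qed
    then show ?thesis
      by (simp add: pr_integral_add[OF \<mu>] bfun_const d s1 s2 prob_space.prob_space[OF prD(1)[OF \<mu>]])
  qed
  have "\<bar>(\<integral>x. A x x + ?D \<partial>\<mu>) - (\<integral>x. (\<integral>y. A x y \<partial>\<mu>) + (\<integral>y. A y x \<partial>\<mu>) \<partial>\<mu>)\<bar> \<le> \<delta>"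
    by (rule pr_integral_near[OF \<mu> _ _ inner]) (intro bfun_add bfun_const d i1 i2)+
  then have "\<bar>(?D + ?D) - (?I + (\<integral>x. (\<integral>y. A y x \<partial>\<mu>) \<partial>\<mu>))\<bar> \<le> \<delta>"
    by (simp add: pr_integral_add[OF \<mu>] bfun_const d i1 i2 prob_space.prob_space[OF prD(1)[OF \<mu>]])
  moreover have "(\<integral>x. (\<integral>y. A y x \<partial>\<mu>) \<partial>\<mu>) = ?I"
    by (rule pr_fubini(1)[OF \<mu> \<mu> A2])
  ultimately show ?thesis by linarith
qed

context interacting_chains begin

text \<open>
  Azuma's argument: condition on the first step, use the bound for the remaining steps, and
  apply Hoeffding's lemma to the conditional expectation as a function of the first step.
\<close>

lemma run_mgf:
  assumes F: "F \<in> bfun H" and lipF: "lip F a" and a: "0 \<le> a"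
  shows "k \<le> n \<Longrightarrow> h \<in> space H \<Longrightarrow> (\<integral>h'. exp (s * (F h' - value_at n F k h)) \<partial>run (n - k) k h)
     \<le> exp (s\<^sup>2 * (\<Sum>j\<in>{k<..n}. (a * block_osc n j)\<^sup>2) / 2)"
proof (induction "n - k" arbitrary: k h)
  case 0
  then have k: "k = n" by simp
  have b: "(\<lambda>h'. exp (s * (F h' - value_at n F n h))) \<in> bfun H"
    by (intro bfun_exp bfun_mult bfun_diff F bfun_const)
  show ?case unfolding k
    using run_0_integral[OF 0(3) b] value_at_last[OF F 0(3)] by (simp del: run.simps)
next
  case (Suc d)
  then have kn: "k < n" and d: "n - k = Suc (n - Suc k)" by auto
  note h = Suc(4)
  let ?V = "value_at n F (Suc k)"
  let ?v = "value_at n F k h"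
  let ?S = "\<lambda>k. \<Sum>j\<in>{k<..n}. (a * block_osc n j)\<^sup>2"
  have b: "(\<lambda>h'. exp (s * (F h' - v))) \<in> bfun H" for v
    by (intro bfun_exp bfun_mult bfun_diff F bfun_const)
  have bV: "(\<lambda>h'. exp (s * (?V h' - v))) \<in> bfun H" for v
    by (intro bfun_exp bfun_mult bfun_diff value_at_bfun F bfun_const)
  have "(\<integral>h'. exp (s * (F h' - ?v)) \<partial>run (n - k) k h)
      = (\<integral>h1. (\<integral>h'. exp (s * (F h' - ?v)) \<partial>run (n - Suc k) (Suc k) h1) \<partial>step k h)"
    unfolding d by (rule run_Suc_integral[OF h b])
  also have "\<dots> \<le> (\<integral>h1. exp (s\<^sup>2 * ?S (Suc k) / 2) * exp (s * (?V h1 - ?v)) \<partial>step k h)"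
  proof (rule pr_integral_mono[OF step_pr[OF h]])
    fix h1 assume h1: "h1 \<in> space H"
    have "(\<integral>h'. exp (s * (F h' - ?v)) \<partial>run (n - Suc k) (Suc k) h1)
       = (\<integral>h'. exp (s * (?V h1 - ?v)) * exp (s * (F h' - ?V h1)) \<partial>run (n - Suc k) (Suc k) h1)"
      by (intro Bochner_Integration.integral_cong refl) (simp add: right_diff_distrib flip: exp_add)
    also have "\<dots> = exp (s * (?V h1 - ?v)) * (\<integral>h'. exp (s * (F h' - ?V h1)) \<partial>run (n - Suc k) (Suc k) h1)"
      by (rule integral_mult_right_zero)
    also have "\<dots> \<le> exp (s * (?V h1 - ?v)) * exp (s\<^sup>2 * ?S (Suc k) / 2)"
      using Suc kn h1 by (intro mult_left_mono Suc(1)) auto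
    finally show "(\<integral>h'. exp (s * (F h' - ?v)) \<partial>run (n - Suc k) (Suc k) h1)
        \<le> exp (s\<^sup>2 * ?S (Suc k) / 2) * exp (s * (?V h1 - ?v))" by (simp add: mult.commute)
  qed (intro run_bfun b bfun_mult bfun_const bV)+
  also have "\<dots> = exp (s\<^sup>2 * ?S (Suc k) / 2) * (\<integral>h1. exp (s * (?V h1 - ?v)) \<partial>step k h)"
    by (rule integral_mult_right_zero)
  also have "(\<integral>h1. exp (s * (?V h1 - ?v)) \<partial>step k h) = (\<integral>y. exp (s * (?V (upd m (Suc k) h y) - ?v)) \<partial>law k h)"
    by (rule step_integral[OF h bV])
  also have "(\<integral>y. exp (s * (?V (upd m (Suc k) h y) - ?v)) \<partial>law k h) \<le> exp (s\<^sup>2 * (a * block_osc n (Suc k))\<^sup>2 / 2)"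
  proof -
    have v: "?v = (\<integral>y. ?V (upd m (Suc k) h y) \<partial>law k h)"
      using value_at_step[OF F h kn] step_integral[OF h value_at_bfun[OF F], of k n "Suc k"] by simp
    show ?thesis unfolding v
      by (rule hoeffding_pr[OF law_pr[OF h] bfun_compose[OF value_at_bfun[OF F] upd_measurable1[OF h]]])
         (rule osc_leI, rule value_at_block[OF F lipF a _ h], use kn in auto)
  qed
  finally have "(\<integral>h'. exp (s * (F h' - ?v)) \<partial>run (n - k) k h)
     \<le> exp (s\<^sup>2 * ?S (Suc k) / 2) * exp (s\<^sup>2 * (a * block_osc n (Suc k))\<^sup>2 / 2)" by simp
  also have "\<dots> = exp (s\<^sup>2 * ?S k / 2)"
  proof -
    have "{k<..n} = insert (Suc k) {Suc k<..n}" using kn by auto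
    then have "?S k = (a * block_osc n (Suc k))\<^sup>2 + ?S (Suc k)" by simp
    then show ?thesis by (simp add: algebra_simps add_divide_distrib flip: exp_add)
  qed
  finally show ?case .
qed

lemma run_mgf_vconst:
  assumes F: "F \<in> bfun H" and lipF: "lip F a" and a: "0 \<le> a" and h: "h \<in> space H"
  shows "(\<integral>h'. exp (s * (F h' - value_at n F 0 h)) \<partial>run n 0 h) \<le> exp (s\<^sup>2 * (a\<^sup>2 * (vconst * real (Suc n))) / 2)"
proof -
  have "(\<Sum>j\<in>{0<..n}. (a * block_osc n j)\<^sup>2) \<le> (\<Sum>j\<le>n. (a * block_osc n j)\<^sup>2)"
    by (intro sum_mono2) auto
  also have "\<dots> = a\<^sup>2 * (\<Sum>j\<le>n. (block_osc n j)\<^sup>2)"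
    by (simp add: power_mult_distrib sum_distrib_left)
  also have "\<dots> \<le> a\<^sup>2 * (vconst * real (Suc n))"
    by (intro mult_left_mono sum_block_osc) auto
  finally have "exp (s\<^sup>2 * (\<Sum>j\<in>{0<..n}. (a * block_osc n j)\<^sup>2) / 2) \<le> exp (s\<^sup>2 * (a\<^sup>2 * (vconst * real (Suc n))) / 2)"
    by (simp add: mult_left_mono)
  note bound = this
  have "(\<integral>h'. exp (s * (F h' - value_at n F 0 h)) \<partial>run n 0 h) \<le> exp (s\<^sup>2 * (\<Sum>j\<in>{0<..n}. (a * block_osc n j)\<^sup>2) / 2)"
    using run_mgf[OF F lipF a _ h, of 0 n s] by simp
  from order_trans[OF this bound] show ?thesis .
qed

lemma run_tail:
  assumes F: "F \<in> bfun H" and lipF: "lip F a" and a: "0 < a" and h: "h \<in> space H" and r: "0 \<le> r"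
  shows "measure (run n 0 h) {h' \<in> space H. r < \<bar>F h' - value_at n F 0 h\<bar>}
     \<le> 2 * exp (- (r\<^sup>2 / (2 * (a\<^sup>2 * (vconst * real (Suc n))))))"
proof -
  let ?\<mu> = "run n 0 h"
  let ?v = "value_at n F 0 h"
  define w where "w = a\<^sup>2 * (vconst * real (Suc n))"
  have w: "0 < w" unfolding w_def using a vconst_pos by simp
  define s where "s = r / w"
  have s: "0 \<le> s" unfolding s_def using w r by simp
  interpret prob_space ?\<mu> by (rule prD(1)[OF run_pr[OF h]])
  have b: "(\<lambda>h'. exp (s * (F h' - ?v))) \<in> bfun H" for s
    by (intro bfun_exp bfun_mult bfun_diff F bfun_const)
  let ?X = "{h' \<in> space H. r < \<bar>F h' - ?v\<bar>}"
  have X: "?X \<in> sets H" using bfun_meas[OF F] by measurable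
  then have Xs: "?X \<in> sets ?\<mu>" by (simp add: prD(2)[OF run_pr[OF h]])
  have "measure ?\<mu> ?X = (\<integral>h'. indicator ?X h' \<partial>?\<mu>)" using Xs by simp
  also have "\<dots> \<le> (\<integral>h'. exp (- s * r) * (exp (s * (F h' - ?v)) + exp ((- s) * (F h' - ?v))) \<partial>?\<mu>)"
  proof (rule pr_integral_mono[OF run_pr[OF h]])
    show "(indicator ?X :: _ \<Rightarrow> real) \<in> bfun H" by (rule bfun_indicator[OF X])
    show "(\<lambda>h'. exp (- s * r) * (exp (s * (F h' - ?v)) + exp ((- s) * (F h' - ?v)))) \<in> bfun H"
      by (intro bfun_mult bfun_const bfun_add b)
    fix h' assume h': "h' \<in> space H"
    show "indicator ?X h' \<le> exp (- s * r) * (exp (s * (F h' - ?v)) + exp ((- s) * (F h' - ?v)))"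
    proof (cases "h' \<in> ?X")
      case True
      have "1 \<le> exp (- s * r) * exp (s * \<bar>F h' - ?v\<bar>)"
        using True mult_left_mono[OF _ s, of r "\<bar>F h' - ?v\<bar>"] by (simp flip: exp_add)
      also have "\<dots> \<le> exp (- s * r) * (exp (s * (F h' - ?v)) + exp ((- s) * (F h' - ?v)))"
      proof (intro mult_left_mono)
        show "exp (s * \<bar>F h' - ?v\<bar>) \<le> exp (s * (F h' - ?v)) + exp ((- s) * (F h' - ?v))"
        proof (cases "F h' - ?v \<ge> 0")
          case False
          then have "s * \<bar>F h' - ?v\<bar> = (- s) * (F h' - ?v)" by (simp add: algebra_simps)
          then show ?thesis by (simp only:) simp
        qed simp
      qed simp
      finally show ?thesis using True by simp
    next
      case False
      have "0 \<le> exp (- s * r) * (exp (s * (F h' - ?v)) + exp ((- s) * (F h' - ?v)))"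
        by (intro mult_nonneg_nonneg add_nonneg_nonneg) auto
      with False show ?thesis unfolding indicator_def by (simp only: of_bool_eq)
    qed
  qed
  also have "\<dots> = exp (- s * r) * ((\<integral>h'. exp (s * (F h' - ?v)) \<partial>?\<mu>) + (\<integral>h'. exp ((- s) * (F h' - ?v)) \<partial>?\<mu>))"
    unfolding integral_mult_right_zero pr_integral_add[OF run_pr[OF h] b b] ..
  also have "\<dots> \<le> exp (- s * r) * (exp (s\<^sup>2 * w / 2) + exp ((- s)\<^sup>2 * w / 2))"
    unfolding w_def using a by (intro mult_left_mono add_mono run_mgf_vconst[OF F lipF _ h]) auto
  also have "\<dots> = 2 * exp (- s * r + s\<^sup>2 * w / 2)" unfolding exp_add by simp
  also have "- s * r + s\<^sup>2 * w / 2 = - (r\<^sup>2 / (2 * w))"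
    unfolding s_def using w by (simp add: field_simps power2_eq_square)
  finally show ?thesis unfolding w_def .
qed

text \<open>
  Integrate \<open>\<bar>s z\<bar> \<le> exp (s z) + exp (- s z) - 1\<close>, with \<open>1/s\<close> of the size of the standard deviation.
\<close>

lemma run_abs_dev:
  assumes F: "F \<in> bfun H" and lipF: "lip F a" and a: "0 < a" and h: "h \<in> space H"
  shows "(\<integral>h'. \<bar>F h' - value_at n F 0 h\<bar> \<partial>run n 0 h) \<le> 3 * (a * sqrt (vconst * real (Suc n)))"
proof -
  let ?\<mu> = "run n 0 h"
  let ?v = "value_at n F 0 h"
  define w where "w = a * sqrt (vconst * real (Suc n))"
  have w: "0 < w" unfolding w_def using a vconst_pos by simp
  have w2: "w\<^sup>2 = a\<^sup>2 * (vconst * real (Suc n))" unfolding w_def using vconst_pos by (simp add: power_mult_distrib)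
  define s where "s = 1 / w"
  have b: "(\<lambda>h'. exp (s * (F h' - ?v))) \<in> bfun H" for s
    by (intro bfun_exp bfun_mult bfun_diff F bfun_const)
  have "(\<integral>h'. \<bar>F h' - ?v\<bar> \<partial>?\<mu>) \<le> (\<integral>h'. w * (exp (s * (F h' - ?v)) + exp ((- s) * (F h' - ?v)) - 1) \<partial>?\<mu>)"
  proof (rule pr_integral_mono[OF run_pr[OF h]])
    show "(\<lambda>h'. \<bar>F h' - ?v\<bar>) \<in> bfun H" by (intro bfun_abs bfun_diff F bfun_const)
    show "(\<lambda>h'. w * (exp (s * (F h' - ?v)) + exp ((- s) * (F h' - ?v)) - 1)) \<in> bfun H"
      by (intro bfun_mult bfun_const bfun_diff bfun_add b)
    fix h'
    let ?t = "s * (F h' - ?v)"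
    have "1 + \<bar>?t\<bar> \<le> exp \<bar>?t\<bar>" by simp
    also have "\<dots> \<le> exp ?t + exp (- ?t)" by (cases "?t \<ge> 0") auto
    finally have "\<bar>?t\<bar> \<le> exp ?t + exp (- ?t) - 1" by simp
    from mult_left_mono[OF this less_imp_le[OF w]]
    have "w * \<bar>?t\<bar> \<le> w * (exp ?t + exp (- ?t) - 1)" .
    moreover have "w * \<bar>?t\<bar> = \<bar>F h' - ?v\<bar>" using w by (simp add: s_def abs_mult)
    ultimately show "\<bar>F h' - ?v\<bar> \<le> w * (exp (s * (F h' - ?v)) + exp ((- s) * (F h' - ?v)) - 1)" by simp
  qed
  also have "\<dots> = w * ((\<integral>h'. exp (s * (F h' - ?v)) \<partial>?\<mu>) + (\<integral>h'. exp ((- s) * (F h' - ?v)) \<partial>?\<mu>) - 1)"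
    using pr_integral_diff[OF run_pr[OF h] bfun_add[OF b b] bfun_const[of 1]]
    unfolding integral_mult_right_zero by (simp only: pr_integral_add[OF run_pr[OF h] b b] pr_integral_const[OF run_pr[OF h]])
  also have "\<dots> \<le> w * (exp (s\<^sup>2 * w\<^sup>2 / 2) + exp ((- s)\<^sup>2 * w\<^sup>2 / 2) - 1)"
    unfolding w2 using a w by (intro mult_left_mono diff_right_mono add_mono run_mgf_vconst[OF F lipF _ h]) auto
  also have "\<dots> = w * (2 * exp (1/2) - 1)"
    using w by (simp add: s_def power_divide)
  also have "\<dots> \<le> w * 3"
  proof -
    have "exp (1/2::real) \<le> 2" using exp_bound_half[of "1/2::real"] by simp
    then show ?thesis using w by (intro mult_left_mono) auto
  qed
  finally show ?thesis unfolding w_def by (simp add: mult.commute)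
qed

lemma value_at_bind:
  assumes \<Theta>: "\<Theta> \<in> H \<rightarrow>\<^sub>M prob_algebra T" and g: "g \<in> bfun T" and h: "h \<in> space H"
  shows "value_at n (\<lambda>h'. integral\<^sup>L (\<Theta> h') g) k h = integral\<^sup>L (bind (run (n - k) k h) \<Theta>) g"
  unfolding value_at_def by (rule pr_integral_bind[OF run_pr[OF h] \<Theta> g, symmetric])

text \<open>
  On the left the random measure \<open>\<Theta>\<close> and the function \<open>u\<close> see the same history, on the right
  independent ones. The induction splits the randomness of one step at a time. What a step costs
  is a mixed second difference, that is the change of the measure applied to the change of the
  function, and each of these is bounded by a martingale increment.
\<close>

lemma decouple:
  fixes T :: "'t measure"
  assumes \<Theta>: "\<Theta> \<in> H \<rightarrow>\<^sub>M prob_algebra T" and u: "(\<lambda>(h, x). u h x) \<in> bfun (H \<Otimes>\<^sub>M T)"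
    and lip\<Theta>: "\<And>g b. g \<in> bfun T \<Longrightarrow> (\<And>x. x \<in> space T \<Longrightarrow> \<bar>g x\<bar> \<le> b) \<Longrightarrow> lip (\<lambda>h. integral\<^sup>L (\<Theta> h) g) (a1 * b)"
    and lipu: "\<And>x. x \<in> space T \<Longrightarrow> lip (\<lambda>h. u h x) a2"
    and a: "0 \<le> a1" "0 \<le> a2"
  shows "k \<le> n \<Longrightarrow> h \<in> space H \<Longrightarrow>
     \<bar>(\<integral>h'. integral\<^sup>L (\<Theta> h') (u h') \<partial>run (n - k) k h)
       - (\<integral>x. value_at n (\<lambda>h'. u h' x) k h \<partial>bind (run (n - k) k h) \<Theta>)\<bar>
     \<le> a1 * a2 * (\<Sum>j\<in>{k<..n}. (block_osc n j)\<^sup>2)"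
proof (induction "n - k" arbitrary: k h)
  case 0
  then have k: "k = n" by simp
  have ub: "u h' \<in> bfun T" if "h' \<in> space H" for h' by (rule bfun_section(1)[OF u that])
  have Lb: "(\<lambda>h'. integral\<^sup>L (\<Theta> h') (u h')) \<in> bfun H" by (rule bfun_kernel_integral[OF \<Theta> u])
  have "(\<integral>x. value_at n (\<lambda>h'. u h' x) n h \<partial>bind (run 0 n h) \<Theta>) = (\<integral>x. u h x \<partial>bind (run 0 n h) \<Theta>)"
    by (rule pr_integral_cong[OF pr_bind[OF run_pr[OF 0(3)] \<Theta>]])
       (rule value_at_last[OF bfun_section(2)[OF u] 0(3)])
  also have "\<dots> = integral\<^sup>L (\<Theta> h) (u h)"
    using pr_integral_bind[OF run_pr[OF 0(3)] \<Theta> ub[OF 0(3)], of 0 n]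
      run_0_integral[OF 0(3) bfun_kernel_integral1[OF \<Theta> ub[OF 0(3)]]] by (simp del: run.simps)
  finally show ?case unfolding k using run_0_integral[OF 0(3) Lb] by (simp del: run.simps)
next
  case (Suc d)
  then have kn: "k < n" and dk: "n - k = Suc (n - Suc k)" by auto
  note h = Suc(4)
  define L where "L h' = integral\<^sup>L (\<Theta> h') (u h')" for h'
  have Lb: "L \<in> bfun H" unfolding L_def[abs_def] by (rule bfun_kernel_integral[OF \<Theta> u])
  have ub: "u h' \<in> bfun T" if "h' \<in> space H" for h' by (rule bfun_section(1)[OF u that])
  have ux: "(\<lambda>h'. u h' x) \<in> bfun H" if "x \<in> space T" for x by (rule bfun_section(2)[OF u that])
  define ubar where "ubar k h' x = value_at n (\<lambda>h'. u h' x) k h'" for k h' x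
  have ubar: "(\<lambda>(h', x). ubar k h' x) \<in> bfun (H \<Otimes>\<^sub>M T)" for k
  proof -
    have "(\<lambda>p. \<integral>h'. u h' (snd p) \<partial>run (n - k) k (fst p)) \<in> bfun (H \<Otimes>\<^sub>M T)"
    proof (rule bfun_kernel_integral[where Y=H])
      show "(\<lambda>p. run (n - k) k (fst p)) \<in> H \<Otimes>\<^sub>M T \<rightarrow>\<^sub>M prob_algebra H"
        by (rule measurable_compose[OF measurable_fst run_kernel])
      have "(\<lambda>q. (snd q, snd (fst q))) \<in> (H \<Otimes>\<^sub>M T) \<Otimes>\<^sub>M H \<rightarrow>\<^sub>M H \<Otimes>\<^sub>M T" by measurable
      from bfun_compose[OF u this]
      show "(\<lambda>(p, h'). u h' (snd p)) \<in> bfun ((H \<Otimes>\<^sub>M T) \<Otimes>\<^sub>M H)" by (simp add: split_def)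
    qed
    then show ?thesis by (simp add: ubar_def value_at_def split_def)
  qed
  define \<theta> where "\<theta> k h' = bind (run (n - k) k h') \<Theta>" for k h'
  have \<theta>: "\<theta> k \<in> H \<rightarrow>\<^sub>M prob_algebra T" for k
    unfolding \<theta>_def[abs_def] by (rule measurable_bind_prob_space[OF run_kernel \<Theta>])
  note \<theta>_pr = kernel_pr[OF \<theta>]
  define A where "A h1 h2 = integral\<^sup>L (\<theta> (Suc k) h1) (ubar (Suc k) h2)" for h1 h2
  have Ab: "(\<lambda>(h1, h2). A h1 h2) \<in> bfun (H \<Otimes>\<^sub>M H)"
  proof -
    have "(\<lambda>p. \<integral>x. ubar (Suc k) (snd p) x \<partial>\<theta> (Suc k) (fst p)) \<in> bfun (H \<Otimes>\<^sub>M H)"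
    proof (rule bfun_kernel_integral[where Y=T])
      show "(\<lambda>p. \<theta> (Suc k) (fst p)) \<in> H \<Otimes>\<^sub>M H \<rightarrow>\<^sub>M prob_algebra T"
        by (rule measurable_compose[OF measurable_fst \<theta>])
      have "(\<lambda>q. (snd (fst q), snd q)) \<in> (H \<Otimes>\<^sub>M H) \<Otimes>\<^sub>M T \<rightarrow>\<^sub>M H \<Otimes>\<^sub>M T" by measurable
      from bfun_compose[OF ubar this]
      show "(\<lambda>(p, x). ubar (Suc k) (snd p) x) \<in> bfun ((H \<Otimes>\<^sub>M H) \<Otimes>\<^sub>M T)" by (simp add: split_def)
    qed
    then show ?thesis by (simp add: A_def split_def)
  qed
  let ?S = "\<lambda>k. \<Sum>j\<in>{k<..n}. (block_osc n j)\<^sup>2"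
  let ?\<mu> = "step k h"
  have diag: "(\<lambda>h'. A h' h') \<in> bfun H"
    using bfun_compose[OF Ab, of "\<lambda>x. (x, x)" H] by simp
  have "(\<integral>h'. L h' \<partial>run (n - k) k h) = (\<integral>h1. (\<integral>h'. L h' \<partial>run (n - Suc k) (Suc k) h1) \<partial>?\<mu>)"
    unfolding dk by (rule run_Suc_integral[OF h Lb])
  moreover have "\<bar>(\<integral>h1. (\<integral>h'. L h' \<partial>run (n - Suc k) (Suc k) h1) \<partial>?\<mu>) - (\<integral>h1. A h1 h1 \<partial>?\<mu>)\<bar> \<le> a1 * a2 * ?S (Suc k)"
  proof (rule pr_integral_near[OF step_pr[OF h] run_bfun[OF Lb] diag])
    fix h1 assume h1: "h1 \<in> space H"
    show "\<bar>(\<integral>h'. L h' \<partial>run (n - Suc k) (Suc k) h1) - A h1 h1\<bar> \<le> a1 * a2 * ?S (Suc k)"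
      unfolding A_def \<theta>_def ubar_def L_def using Suc(2) kn by (intro Suc(1) h1) auto
  qed
  moreover have "\<bar>(\<integral>h1. A h1 h1 \<partial>?\<mu>) - (\<integral>h1. (\<integral>h2. A h1 h2 \<partial>?\<mu>) \<partial>?\<mu>)\<bar> \<le> a1 * a2 * (block_osc n (Suc k))\<^sup>2"
  proof -
    let ?U = "upd m (Suc k) h"
    note U = upd_measurable1[OF h, of "Suc k"]
    have AU: "(\<lambda>(y1, y2). A (?U y1) (?U y2)) \<in> bfun (E \<Otimes>\<^sub>M E)"
    proof -
      have "(\<lambda>q. (?U (fst q), ?U (snd q))) \<in> E \<Otimes>\<^sub>M E \<rightarrow>\<^sub>M H \<Otimes>\<^sub>M H" using U by measurable
      from bfun_compose[OF Ab this] show ?thesis by (simp add: split_def)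
    qed
    have "\<bar>(\<integral>y. A (?U y) (?U y) \<partial>law k h) - (\<integral>y. (\<integral>y2. A (?U y) (?U y2) \<partial>law k h) \<partial>law k h)\<bar>
       \<le> (2 * (a1 * a2 * (block_osc n (Suc k))\<^sup>2)) / 2"
    proof (rule decouple_pr[OF law_pr[OF h] AU])
      fix y1 y2 assume y: "y1 \<in> space E" "y2 \<in> space E"
      let ?h1 = "?U y1" and ?h2 = "?U y2" and ?d = "block_osc n (Suc k)"
      have h12: "?h1 \<in> space H" "?h2 \<in> space H" using upd_space[OF h] y by auto
      define g where "g x = ubar (Suc k) ?h1 x - ubar (Suc k) ?h2 x" for x
      have ub12: "ubar (Suc k) ?h1 \<in> bfun T" "ubar (Suc k) ?h2 \<in> bfun T"
        using bfun_section(1)[OF ubar] h12 by auto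
      have g: "g \<in> bfun T" unfolding g_def[abs_def] by (intro bfun_diff ub12)
      have gb: "\<bar>g x\<bar> \<le> a2 * ?d" if x: "x \<in> space T" for x
        unfolding g_def ubar_def using kn
        by (intro value_at_block[OF ux[OF x] lipu[OF x] a(2) _ h y]) auto
      have "\<bar>value_at n (\<lambda>h'. integral\<^sup>L (\<Theta> h') g) (Suc k) ?h1 - value_at n (\<lambda>h'. integral\<^sup>L (\<Theta> h') g) (Suc k) ?h2\<bar>
          \<le> a1 * (a2 * ?d) * ?d"
        using kn a block_osc_nonneg
        by (intro value_at_block[OF bfun_kernel_integral1[OF \<Theta> g] lip\<Theta>[OF g gb] _ _ h y]) auto
      then have "\<bar>integral\<^sup>L (\<theta> (Suc k) ?h1) g - integral\<^sup>L (\<theta> (Suc k) ?h2) g\<bar> \<le> a1 * (a2 * ?d) * ?d"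
        unfolding value_at_bind[OF \<Theta> g h12(1)] value_at_bind[OF \<Theta> g h12(2)] \<theta>_def .
      also have "\<dots> = a1 * a2 * ?d\<^sup>2" by (simp add: power2_eq_square)
      also have "\<dots> \<le> 2 * (a1 * a2 * ?d\<^sup>2)" using a by simp
      finally show "\<bar>A ?h1 ?h1 - A ?h1 ?h2 - A ?h2 ?h1 + A ?h2 ?h2\<bar> \<le> 2 * (a1 * a2 * ?d\<^sup>2)"
        unfolding A_def g_def pr_integral_diff[OF \<theta>_pr[OF h12(1)] ub12] pr_integral_diff[OF \<theta>_pr[OF h12(2)] ub12]
        by (simp add: algebra_simps)
    qed
    moreover have "(\<integral>h1. A h1 h1 \<partial>?\<mu>) = (\<integral>y. A (?U y) (?U y) \<partial>law k h)"
      by (rule step_integral[OF h diag])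
    moreover have "(\<integral>h1. (\<integral>h2. A h1 h2 \<partial>?\<mu>) \<partial>?\<mu>) = (\<integral>y. (\<integral>y2. A (?U y) (?U y2) \<partial>law k h) \<partial>law k h)"
    proof -
      have "(\<lambda>h1. \<integral>h2. A h1 h2 \<partial>?\<mu>) \<in> bfun H"
        by (rule bfun_kernel_integral[OF _ Ab]) (use step_pr[OF h] in auto)
      from step_integral[OF h this, of k]
      have "(\<integral>h1. (\<integral>h2. A h1 h2 \<partial>?\<mu>) \<partial>?\<mu>) = (\<integral>y. (\<integral>h2. A (?U y) h2 \<partial>?\<mu>) \<partial>law k h)" .
      also have "\<dots> = (\<integral>y. (\<integral>y2. A (?U y) (?U y2) \<partial>law k h) \<partial>law k h)"
        by (rule pr_integral_cong[OF law_pr[OF h]])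
           (rule step_integral[OF h bfun_section(1)[OF Ab upd_space[OF h]]])
      finally show ?thesis .
    qed
    ultimately show ?thesis by simp
  qed
  moreover have "(\<integral>h1. (\<integral>h2. A h1 h2 \<partial>?\<mu>) \<partial>?\<mu>) = (\<integral>x. ubar k h x \<partial>\<theta> k h)"
  proof -
    have uk: "ubar k h \<in> bfun T" by (rule bfun_section(1)[OF ubar h])
    have "(\<integral>x. ubar k h x \<partial>\<theta> k h) = (\<integral>h'. integral\<^sup>L (\<Theta> h') (ubar k h) \<partial>run (n - k) k h)"
      unfolding \<theta>_def by (rule pr_integral_bind[OF run_pr[OF h] \<Theta> uk])
    also have "\<dots> = (\<integral>h1. (\<integral>h'. integral\<^sup>L (\<Theta> h') (ubar k h) \<partial>run (n - Suc k) (Suc k) h1) \<partial>?\<mu>)"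
      unfolding dk by (rule run_Suc_integral[OF h bfun_kernel_integral1[OF \<Theta> uk]])
    also have "\<dots> = (\<integral>h1. (\<integral>h2. A h1 h2 \<partial>?\<mu>) \<partial>?\<mu>)"
    proof (rule pr_integral_cong[OF step_pr[OF h]])
      fix h1 assume h1: "h1 \<in> space H"
      have "(\<integral>h'. integral\<^sup>L (\<Theta> h') (ubar k h) \<partial>run (n - Suc k) (Suc k) h1) = integral\<^sup>L (\<theta> (Suc k) h1) (ubar k h)"
        unfolding \<theta>_def by (rule pr_integral_bind[OF run_pr[OF h1] \<Theta> uk, symmetric])
      also have "\<dots> = (\<integral>x. (\<integral>h2. ubar (Suc k) h2 x \<partial>?\<mu>) \<partial>\<theta> (Suc k) h1)"
        unfolding ubar_def
        by (rule pr_integral_cong[OF \<theta>_pr[OF h1]]) (rule value_at_step[OF ux h kn])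
      also have "\<dots> = (\<integral>h2. (\<integral>x. ubar (Suc k) h2 x \<partial>\<theta> (Suc k) h1) \<partial>?\<mu>)"
        by (rule pr_fubini(1)[OF step_pr[OF h] \<theta>_pr[OF h1] ubar, symmetric])
      finally show "(\<integral>h'. integral\<^sup>L (\<Theta> h') (ubar k h) \<partial>run (n - Suc k) (Suc k) h1) = (\<integral>h2. A h1 h2 \<partial>?\<mu>)"
        unfolding A_def .
    qed
    finally show ?thesis by (rule sym)
  qed
  moreover have "?S k = (block_osc n (Suc k))\<^sup>2 + ?S (Suc k)"
  proof -
    have "{k<..n} = insert (Suc k) {Suc k<..n}" using kn by auto
    then show ?thesis by simp
  qed
  ultimately have "\<bar>(\<integral>h'. L h' \<partial>run (n - k) k h) - (\<integral>x. ubar k h x \<partial>\<theta> k h)\<bar> \<le> a1 * a2 * ?S k"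
    by (simp add: distrib_left)
  then show ?case unfolding L_def ubar_def \<theta>_def .
qed

lemma decoupled_small:
  fixes T :: "'t measure"
  assumes \<Theta>: "\<Theta> \<in> H \<rightarrow>\<^sub>M prob_algebra T" and u: "(\<lambda>(h, x). u h x) \<in> bfun (H \<Otimes>\<^sub>M T)"
    and lip\<Theta>: "\<And>g b. g \<in> bfun T \<Longrightarrow> (\<And>x. x \<in> space T \<Longrightarrow> \<bar>g x\<bar> \<le> b) \<Longrightarrow> lip (\<lambda>h. integral\<^sup>L (\<Theta> h) g) (a * b)"
    and lipu: "\<And>x. x \<in> space T \<Longrightarrow> lip (\<lambda>h. u h x) a"
    and a: "0 \<le> a" and h: "h \<in> space H"
    and small: "\<And>x. x \<in> space T \<Longrightarrow> \<bar>\<integral>h'. u h' x \<partial>run n 0 h\<bar> \<le> \<epsilon>"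
  shows "\<bar>\<integral>h'. integral\<^sup>L (\<Theta> h') (u h') \<partial>run n 0 h\<bar> \<le> \<epsilon> + a\<^sup>2 * (vconst * real (Suc n))"
proof -
  let ?b = "\<integral>x. value_at n (\<lambda>h'. u h' x) 0 h \<partial>bind (run n 0 h) \<Theta>"
  have "\<bar>(\<integral>h'. integral\<^sup>L (\<Theta> h') (u h') \<partial>run n 0 h) - ?b\<bar> \<le> a * a * (\<Sum>j\<in>{0<..n}. (block_osc n j)\<^sup>2)"
    using decouple[OF \<Theta> u lip\<Theta> lipu a a _ h, of 0 n] by simp
  also have "\<dots> \<le> a * a * (vconst * real (Suc n))"
  proof -
    have "(\<Sum>j\<in>{0<..n}. (block_osc n j)\<^sup>2) \<le> (\<Sum>j\<le>n. (block_osc n j)\<^sup>2)"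
      by (intro sum_mono2) auto
    then show ?thesis using sum_block_osc[of n] a by (intro mult_left_mono) auto
  qed
  finally have 1: "\<bar>(\<integral>h'. integral\<^sup>L (\<Theta> h') (u h') \<partial>run n 0 h) - ?b\<bar> \<le> a\<^sup>2 * (vconst * real (Suc n))"
    by (simp add: power2_eq_square)
  have "(\<lambda>x. \<integral>h'. u h' x \<partial>run n 0 h) \<in> bfun T"
  proof (rule bfun_kernel_integral[where Y=H])
    show "(\<lambda>x. run n 0 h) \<in> T \<rightarrow>\<^sub>M prob_algebra H" using run_pr[OF h] by simp
    show "(\<lambda>(x, h'). u h' x) \<in> bfun (T \<Otimes>\<^sub>M H)"
      using bfun_compose[OF u measurable_pair_swap'[of T H]] by (simp add: split_def)
  qed
  then have "\<bar>?b\<bar> \<le> \<epsilon>"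
    using small by (intro integral_bounds(3)[OF pr_bind[OF run_pr[OF h] \<Theta>]]) (auto simp: value_at_def)
  with 1 show ?thesis by linarith
qed

end

section \<open>Convergence of the means\<close>

lemma PiM_marginal:
  assumes fin: "finite I" and l: "l \<in> I" and \<mu>: "\<And>i. i \<in> I \<Longrightarrow> \<mu> i \<in> pr (S i)" and g: "g \<in> bfun (S l)"
  shows "(\<integral>y. g (y l) \<partial>PiM I \<mu>) = integral\<^sup>L (\<mu> l) g"
proof -
  have f: "(\<lambda>y. g (y l)) \<in> bfun (PiM I S)"
    by (rule bfun_compose[OF g measurable_component_singleton[OF l, of S]])
  have "(\<integral>y. g (y l) \<partial>PiM I (\<mu>(l := \<mu> l))) = (\<integral>y. (\<integral>z. g ((y(l := z)) l) \<partial>\<mu> l) \<partial>PiM I \<mu>)"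
    by (rule PiM_resample[OF fin l \<mu> \<mu>[OF l] f])
  also have "\<dots> = integral\<^sup>L (\<mu> l) g"
    using prob_space.prob_space[OF prD(1)[OF pr_PiM[of I \<mu> S, OF \<mu>]]] by simp
  finally show ?thesis by simp
qed

text \<open>
  Here \<open>\<Psi> l k h\<close> stands for \<open>\<Phi>\<^sub>l\<close> of the empirical measure of level \<open>l - 1\<close> at time \<open>k\<close>, and for the
  constant measure \<open>\<pi>\<^sub>0\<close> if \<open>l = 0\<close>. The last assumption is the form that the regularity of \<open>\<Phi>\<^sub>l\<close>
  takes for kernels with finite support: the weights and test functions on the level below depend on
  \<open>g\<close>, but not on the history.
\<close>

locale invariant_chains = interacting_chains S m K c n0
  for S :: "nat \<Rightarrow> 'a measure" and m :: nat
    and K :: "nat \<Rightarrow> nat \<Rightarrow> (nat \<times> nat \<Rightarrow> 'a) \<Rightarrow> 'a \<Rightarrow> 'a measure"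
    and c :: real and n0 :: nat +
  fixes \<Psi> :: "nat \<Rightarrow> nat \<Rightarrow> (nat \<times> nat \<Rightarrow> 'a) \<Rightarrow> 'a measure" and \<pi> :: "nat \<Rightarrow> 'a measure" and \<Lambda> :: real
  assumes \<Psi>_pr: "\<And>l k h. l \<le> m \<Longrightarrow> h \<in> space (hist S m) \<Longrightarrow> \<Psi> l k h \<in> pr (S l)"
    and \<Psi>_inv: "\<And>l k h. l \<le> m \<Longrightarrow> h \<in> space (hist S m) \<Longrightarrow> bind (\<Psi> l k h) (K l k h) = \<Psi> l k h"
    and \<Psi>_local: "\<And>l k h h'. l \<le> m \<Longrightarrow> h \<in> space (hist S m) \<Longrightarrow> h' \<in> space (hist S m) \<Longrightarrow>
        (\<And>p. l \<noteq> 0 \<Longrightarrow> p \<le> k \<Longrightarrow> h (l - 1, p) = h' (l - 1, p)) \<Longrightarrow> \<Psi> l k h = \<Psi> l k h'"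
    and \<Psi>_coord: "\<And>l k h y j g b. Suc l \<le> m \<Longrightarrow> h \<in> space (hist S m) \<Longrightarrow> y \<in> space (S l) \<Longrightarrow> j \<le> k \<Longrightarrow>
        g \<in> bfun (S (Suc l)) \<Longrightarrow> (\<And>x. x \<in> space (S (Suc l)) \<Longrightarrow> \<bar>g x\<bar> \<le> b) \<Longrightarrow>
        \<bar>integral\<^sup>L (\<Psi> (Suc l) k (h((l, j) := y))) g - integral\<^sup>L (\<Psi> (Suc l) k h) g\<bar> \<le> c / real (Suc k) * b"
    and \<pi>_pr: "\<And>l. l \<le> m \<Longrightarrow> \<pi> l \<in> pr (S l)"
    and \<Psi>_0: "\<And>k h. h \<in> space (hist S m) \<Longrightarrow> \<Psi> 0 k h = \<pi> 0"
    and \<Psi>_finite: "\<And>l g. Suc l \<le> m \<Longrightarrow> g \<in> bfun (S (Suc l)) \<Longrightarrow> (\<forall>x\<in>space (S (Suc l)). \<bar>g x\<bar> \<le> 1) \<Longrightarrow>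
        \<exists>(G :: ('a \<Rightarrow> real) set) w \<xi>. finite G \<and>
          (\<forall>i\<in>G. \<xi> i \<in> bfun (S l) \<and> (\<forall>x\<in>space (S l). \<bar>\<xi> i x\<bar> \<le> 1) \<and> 0 \<le> w i) \<and>
          sum w G \<le> \<Lambda> \<and> (\<forall>k. \<forall>h\<in>space (hist S m).
            \<bar>integral\<^sup>L (\<Psi> (Suc l) k h) g - integral\<^sup>L (\<pi> (Suc l)) g\<bar>
              \<le> (\<Sum>i\<in>G. w i * \<bar>(\<Sum>p\<le>k. \<xi> i (h (l, p))) / real (Suc k) - integral\<^sup>L (\<pi> l) (\<xi> i)\<bar>))"
begin

lemma kernel_pow_invariant:
  assumes l: "l \<le> m" and h: "h \<in> space H" and g: "g \<in> bfun (S l)"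
  shows "(\<integral>x. integral\<^sup>L (Kp l k h i x) g \<partial>\<Psi> l k h) = integral\<^sup>L (\<Psi> l k h) g"
proof (induction i)
  case 0
  show ?case by (rule pr_integral_cong[OF \<Psi>_pr[OF l h]]) (rule kernel_pow_0_integral[OF K_kernel[OF l h] g])
next
  case (Suc i)
  note Kk = K_kernel[OF l h, of k]
  have "(\<integral>x. integral\<^sup>L (Kp l k h (Suc i) x) g \<partial>\<Psi> l k h)
      = (\<integral>x. (\<integral>y. integral\<^sup>L (Kp l k h i y) g \<partial>K l k h x) \<partial>\<Psi> l k h)"
    by (rule pr_integral_cong[OF \<Psi>_pr[OF l h]]) (rule kernel_pow_Suc_integral[OF Kk g])
  also have "\<dots> = (\<integral>y. integral\<^sup>L (Kp l k h i y) g \<partial>bind (\<Psi> l k h) (K l k h))"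
    by (rule pr_integral_bind[OF \<Psi>_pr[OF l h] Kk kernel_pow_bfun[OF Kk g], symmetric])
  also have "\<dots> = integral\<^sup>L (\<Psi> l k h) g" unfolding \<Psi>_inv[OF l h] by (rule Suc)
  finally show ?case .
qed

lemma kernel_pow_near_invariant:
  assumes l: "l \<le> m" and h: "h \<in> space H" and g: "g \<in> bfun (S l)" "\<And>x. x \<in> space (S l) \<Longrightarrow> \<bar>g x\<bar> \<le> b"
    and x: "x \<in> space (S l)"
  shows "\<bar>integral\<^sup>L (Kp l k h (n0 * j) x) g - integral\<^sup>L (\<Psi> l k h) g\<bar> \<le> (1/2) ^ j * (2 * b)"
proof -
  note Kk = K_kernel[OF l h, of k]
  have "osc_le (space (S l)) (\<lambda>x. integral\<^sup>L (Kp l k h (n0 * j) x) g) ((1/2) ^ j * (2 * b))"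
    by (rule kernel_pow_contract_iterate[OF Kk _ g(1) osc_from_bound[OF g(2)]]) (rule K_contract[OF l h])
  from integral_osc(2)[OF \<Psi>_pr[OF l h, of k] \<Psi>_pr[OF l h, of k] kernel_pow_bfun[OF Kk g(1)] this x]
  show ?thesis unfolding kernel_pow_invariant[OF l h g(1)] .
qed

lemma Kp_kernel: 
  assumes l: "l \<le> m" and f: "f \<in> X \<rightarrow>\<^sub>M H" and g: "g \<in> X \<rightarrow>\<^sub>M S l"
  shows "(\<lambda>x. Kp l k (f x) i (g x)) \<in> X \<rightarrow>\<^sub>M prob_algebra (S l)"
  using measurable_compose[OF measurable_Pair[OF f g] measurable_kernel_pow[OF K_meas[OF l], of k i]]
  unfolding case_prod_conv .

text \<open>\<open>\<Psi>\<close> is the limit of the powers of a kernel that depends measurably on the history.\<close>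

lemma \<Psi>_kernel:
  assumes l: "l \<le> m" shows "\<Psi> l k \<in> H \<rightarrow>\<^sub>M prob_algebra (S l)"
proof (rule measurable_prob_algebraI)
  fix h assume h: "h \<in> space H"
  show "prob_space (\<Psi> l k h)" by (rule prD(1)[OF \<Psi>_pr[OF l h]])
next
  show "\<Psi> l k \<in> H \<rightarrow>\<^sub>M subprob_algebra (S l)"
  proof (rule measurable_subprob_algebra)
    fix h assume h: "h \<in> space H"
    show "subprob_space (\<Psi> l k h)" by (rule prob_space_imp_subprob_space[OF prD(1)[OF \<Psi>_pr[OF l h]]])
    show "sets (\<Psi> l k h) = sets (S l)" by (rule prD(2)[OF \<Psi>_pr[OF l h]])
  next
    fix A assume A: "A \<in> sets (S l)"
    let ?g = "indicator A :: 'a \<Rightarrow> real"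
    have g: "?g \<in> bfun (S l)" by (rule bfun_indicator[OF A])
    have lim: "(\<lambda>j. integral\<^sup>L (Kp l k h (n0 * j) (h (l, 0))) ?g) \<longlonglongrightarrow> measure (\<Psi> l k h) A"
      if h: "h \<in> space H" for h
    proof -
      have m: "integral\<^sup>L (\<Psi> l k h) ?g = measure (\<Psi> l k h) A"
        using A prD(2)[OF \<Psi>_pr[OF l h]] by simp
      have 0: "(\<lambda>j. (1/2) ^ j * (2 * 1)) \<longlonglongrightarrow> (0::real)"
        by (intro tendsto_mult_left_zero LIMSEQ_realpow_zero) auto
      show ?thesis
        unfolding m[symmetric]
        by (rule LIM_zero_cancel[OF Lim_null_comparison[OF always_eventually 0]])
           (use kernel_pow_near_invariant[OF l h g, of 1 "h (l, 0)" k] hist_spaceD[OF h l] in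
             \<open>auto simp: indicator_def simp del: kernel_pow.simps\<close>)
    qed
    have "(\<lambda>h. measure (\<Psi> l k h) A) \<in> borel_measurable H"
    proof (rule borel_measurable_LIMSEQ_real[OF lim])
      show "(\<lambda>h. integral\<^sup>L (Kp l k h (n0 * j) (h (l, 0))) ?g) \<in> borel_measurable H" for j
        by (rule bfun_meas[OF bfun_kernel_integral1[OF Kp_kernel[OF l measurable_ident_sets[OF refl] hist_component[OF l]] g]])
    qed
    moreover have "emeasure (\<Psi> l k h) A = ennreal (measure (\<Psi> l k h) A)" if "h \<in> space H" for h
    proof -
      interpret prob_space "\<Psi> l k h" by (rule prD(1)[OF \<Psi>_pr[OF l that]])
      show ?thesis by (rule emeasure_eq_measure)
    qed
    ultimately show "(\<lambda>h. emeasure (\<Psi> l k h) A) \<in> borel_measurable H"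
      by (subst measurable_cong) auto
  qed
qed

lemma \<Psi>_change:
  assumes l: "l \<le> m" and l': "l' \<le> m" and h: "h \<in> space H" and z: "z \<in> space (S l')"
    and g: "g \<in> bfun (S l)" "\<And>x. x \<in> space (S l) \<Longrightarrow> \<bar>g x\<bar> \<le> b" and b: "0 \<le> b"
  shows "\<bar>integral\<^sup>L (\<Psi> l k (h((l', j) := z))) g - integral\<^sup>L (\<Psi> l k h) g\<bar> \<le> c / real (Suc k) * b"
    and "l \<noteq> Suc l' \<Longrightarrow> \<Psi> l k (h((l', j) := z)) = \<Psi> l k h"
proof -
  have h': "h((l', j) := z) \<in> space H" by (rule hist_fun_upd[OF h l' z])
  show 1: "\<Psi> l k (h((l', j) := z)) = \<Psi> l k h" if "l \<noteq> Suc l'"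
    by (rule \<Psi>_local[OF l h' h]) (use that in auto)
  show "\<bar>integral\<^sup>L (\<Psi> l k (h((l', j) := z))) g - integral\<^sup>L (\<Psi> l k h) g\<bar> \<le> c / real (Suc k) * b"
  proof (cases "l = Suc l' \<and> j \<le> k")
    case True
    then show ?thesis using \<Psi>_coord[of l' h z j k g b] l h z g by auto
  next
    case False
    have "\<Psi> l k (h((l', j) := z)) = \<Psi> l k h"
    proof (cases "l = Suc l'")
      case True
      then show ?thesis using False by (intro \<Psi>_local[OF l h' h]) auto
    qed (rule 1)
    then show ?thesis using c_nonneg b by simp
  qed
qed

definition block :: "nat \<Rightarrow> (nat \<times> nat \<Rightarrow> 'a) \<Rightarrow> nat \<Rightarrow> 'a" where
  "block p h = (\<lambda>l\<in>{..m}. h (l, p))"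

definition emp :: "((nat \<Rightarrow> 'a) \<Rightarrow> real) \<Rightarrow> nat \<Rightarrow> (nat \<times> nat \<Rightarrow> 'a) \<Rightarrow> real" where
  "emp f n h = (\<Sum>p\<le>n. f (block p h)) / real (Suc n)"

definition test :: "((nat \<Rightarrow> 'a) \<Rightarrow> real) set" where
  "test = {f \<in> bfun E. \<forall>x\<in>space E. \<bar>f x\<bar> \<le> 1}"

lemma testD: "f \<in> test \<Longrightarrow> f \<in> bfun E" "f \<in> test \<Longrightarrow> x \<in> space E \<Longrightarrow> \<bar>f x\<bar> \<le> 1"
  by (auto simp: test_def)

lemma block_meas: "block p \<in> H \<rightarrow>\<^sub>M E"
  unfolding block_def[abs_def] by (rule measurable_restrict) (rule hist_component, simp)

lemma block_space: "h \<in> space H \<Longrightarrow> block p h \<in> space E"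
  by (rule measurable_space[OF block_meas])

lemma block_bfun: "f \<in> bfun E \<Longrightarrow> (\<lambda>h. f (block p h)) \<in> bfun H"
  by (rule bfun_compose[OF _ block_meas])

lemma emp_bfun: "f \<in> bfun E \<Longrightarrow> emp f n \<in> bfun H"
  unfolding emp_def[abs_def] divide_inverse by (intro bfun_mult bfun_const bfun_sum block_bfun)

lemma emp_lip: assumes f: "f \<in> test" shows "lip (emp f n) (2 / real (Suc n))"
  unfolding lip_def
proof (intro allI impI ballI)
  fix l j h z assume l: "l \<le> m" and h: "h \<in> space H" and z: "z \<in> space (S l)"
  let ?h = "h((l, j) := z)"
  have h': "?h \<in> space H" by (rule hist_fun_upd[OF h l z])
  have "(\<Sum>p\<le>n. f (block p ?h)) - (\<Sum>p\<le>n. f (block p h)) = (\<Sum>p\<le>n. f (block p ?h) - f (block p h))"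
    by (rule sum_subtractf[symmetric])
  also have "\<dots> = (\<Sum>p\<in>{..n} \<inter> {j}. f (block p ?h) - f (block p h))"
    by (rule sum.mono_neutral_right) (auto simp: block_def fun_eq_iff restrict_def intro!: arg_cong[where f=f])
  finally have e: "(\<Sum>p\<le>n. f (block p ?h)) - (\<Sum>p\<le>n. f (block p h)) = (\<Sum>p\<in>{..n} \<inter> {j}. f (block p ?h) - f (block p h))" .
  have "\<bar>f (block j ?h) - f (block j h)\<bar> \<le> 2"
    using testD(2)[OF f block_space[OF h'], of j] testD(2)[OF f block_space[OF h], of j] by linarith
  then have "\<bar>(\<Sum>p\<le>n. f (block p ?h)) - (\<Sum>p\<le>n. f (block p h))\<bar> \<le> 2"
    unfolding e by (cases "j \<le> n") auto
  then show "\<bar>emp f n ?h - emp f n h\<bar> \<le> 2 / real (Suc n)"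
    unfolding emp_def diff_divide_distrib[symmetric] abs_divide by (simp add: divide_right_mono)
qed

text \<open>
  In each of \<open>r\<close> steps the kernels move by \<open>O(1/q)\<close>, which displaces powers up to order
  \<open>r\<close> by \<open>O(r/q)\<close>; hence \<open>O(r\<^sup>2/q)\<close> in total.
\<close>

lemma frozen_run:
  assumes f: "f \<in> test"
  shows "h \<in> space H \<Longrightarrow> \<bar>(\<integral>h'. f (block (q + r) h') \<partial>run r q h) - integral\<^sup>L (PiM {..m} (\<lambda>l. Kp l q h r (h (l, q)))) f\<bar>
     \<le> 2 * real (Suc m) * c * (real r)\<^sup>2 / real (Suc q)"
proof (induction r arbitrary: q h)
  case 0
  have "block q h \<in> space E" by (rule block_space[OF 0])
  then have "PiM {..m} (\<lambda>l. Kp l q h 0 (h (l, q))) = return E (block q h)"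
    by (subst PiM_return) (auto simp: block_def intro!: PiM_cong)
  then have "integral\<^sup>L (PiM {..m} (\<lambda>l. Kp l q h 0 (h (l, q)))) f = f (block q h)"
    using block_space[OF 0] testD(1)[OF f] by (simp add: integral_return bfun_meas del: kernel_pow.simps)
  then show ?case
    using run_0_integral[OF 0 block_bfun[OF testD(1)[OF f]], of q q] by (simp del: kernel_pow.simps run.simps)
next
  case (Suc r)
  note h = Suc(2) and fb = testD(1)[OF f]
  let ?e = "2 * real (Suc m) * c * (real r)\<^sup>2 / real (Suc q)"
  let ?F = "\<lambda>h'. f (block (q + Suc r) h')"
  have Fb: "?F \<in> bfun H" by (rule block_bfun[OF fb])
  define W where "W h1 = integral\<^sup>L (PiM {..m} (\<lambda>l. Kp l (Suc q) h1 r (h1 (l, Suc q)))) f" for h1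
  have Wb: "W \<in> bfun H" unfolding W_def[abs_def]
    by (rule bfun_kernel_integral1[OF measurable_PiM_kernel[OF _ Kp_kernel[OF _ measurable_ident_sets[OF refl] hist_component]] fb]) auto
  have 1: "integral\<^sup>L (run (Suc r) q h) ?F = (\<integral>h1. integral\<^sup>L (run r (Suc q) h1) ?F \<partial>step q h)"
    by (rule run_Suc_integral[OF h Fb])
  have 2: "\<bar>(\<integral>h1. integral\<^sup>L (run r (Suc q) h1) ?F \<partial>step q h) - integral\<^sup>L (step q h) W\<bar> \<le> ?e"
  proof (rule pr_integral_near[OF step_pr[OF h] run_bfun[OF Fb] Wb])
    fix h1 assume "h1 \<in> space H"
    from Suc(1)[OF this, of "Suc q"]
    have "\<bar>integral\<^sup>L (run r (Suc q) h1) ?F - W h1\<bar> \<le> 2 * real (Suc m) * c * (real r)\<^sup>2 / real (Suc (Suc q))"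
      by (simp add: W_def)
    also have "\<dots> \<le> ?e" using c_nonneg by (intro divide_left_mono) auto
    finally show "\<bar>integral\<^sup>L (run r (Suc q) h1) ?F - W h1\<bar> \<le> ?e" .
  qed
  define W' where "W' y = integral\<^sup>L (PiM {..m} (\<lambda>l. Kp l q h r (y l))) f" for y
  have K': "(\<lambda>y. PiM {..m} (\<lambda>l. Kp l q h r (y l))) \<in> E \<rightarrow>\<^sub>M prob_algebra E"
  proof (rule measurable_PiM_kernel[OF finite_atMost])
    fix l assume l: "l \<in> {..m}"
    show "(\<lambda>y. Kp l q h r (y l)) \<in> E \<rightarrow>\<^sub>M prob_algebra (S l)"
      by (rule measurable_compose[OF measurable_component_singleton[OF l, of S] kernel_pow_kernel[OF K_kernel[OF _ h]]])
         (use l in simp)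
  qed
  have W'b: "W' \<in> bfun E" unfolding W'_def[abs_def] by (rule bfun_kernel_integral1[OF K' fb])
  have 3: "integral\<^sup>L (step q h) W = (\<integral>y. W (upd m (Suc q) h y) \<partial>law q h)"
    by (rule step_integral[OF h Wb])
  have 4: "\<bar>(\<integral>y. W (upd m (Suc q) h y) \<partial>law q h) - (\<integral>y. W' y \<partial>law q h)\<bar> \<le> (\<Sum>l\<le>m. real r * (c / real (Suc q) * 2))"
  proof (rule pr_integral_near[OF law_pr[OF h] bfun_compose[OF Wb upd_measurable1[OF h]] W'b])
    fix y assume y: "y \<in> space E"
    let ?h = "upd m (Suc q) h y"
    have h2: "?h \<in> space H" by (rule upd_space[OF h y])
    have yl: "y l \<in> space (S l)" if "l \<le> m" for l using y that by (auto simp: space_PiM)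
    have We: "W ?h = integral\<^sup>L (PiM {..m} (\<lambda>l. Kp l (Suc q) ?h r (y l))) f"
      unfolding W_def by (intro arg_cong[where f="\<lambda>M. integral\<^sup>L M f"] PiM_cong) (auto simp: upd_apply)
    show "\<bar>W ?h - W' y\<bar> \<le> (\<Sum>l\<le>m. real r * (c / real (Suc q) * 2))"
      unfolding We W'_def
    proof (rule PiM_diff[OF finite_atMost _ _ fb])
      fix l x assume l: "l \<in> {..m}" and x: "x \<in> space E"
      then have lm: "l \<le> m" by simp
      have Kh2: "K l q ?h = K l q h"
        by (rule K_local[OF lm h2 h]) (use lm in \<open>auto simp: upd_apply\<close>)
      have g: "(\<lambda>z. f (x(l := z))) \<in> bfun (S l)" by (rule bfun_section(1)[OF bfun_fun_upd[OF l fb] x])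
      have o: "osc_le (space (S l)) (\<lambda>z. f (x(l := z))) 2"
        using osc_from_bound[of "space (S l)" "\<lambda>z. f (x(l := z))" 1] testD(2)[OF f fun_upd_PiM_space[OF x l]] by simp
      show "\<bar>(\<integral>z. f (x(l := z)) \<partial>Kp l (Suc q) ?h r (y l)) - (\<integral>z. f (x(l := z)) \<partial>Kp l q h r (y l))\<bar>
          \<le> real r * (c / real (Suc q) * 2)"
        unfolding Kh2[symmetric]
        by (rule kernel_pow_perturb[OF K_kernel[OF lm h2] K_kernel[OF lm h2] K_time[OF lm h2] g o yl[OF lm]])
    qed (use kernel_pow_pr[OF K_kernel[OF _ h]] kernel_pow_pr[OF K_kernel[OF _ h2]] yl in auto)
  qed
  have 5: "(\<integral>y. W' y \<partial>law q h) = integral\<^sup>L (PiM {..m} (\<lambda>l. Kp l q h (Suc r) (h (l, q)))) f"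
  proof -
    have "(\<integral>y. W' y \<partial>law q h) = integral\<^sup>L (bind (law q h) (\<lambda>y. PiM {..m} (\<lambda>l. Kp l q h r (y l)))) f"
      unfolding W'_def by (rule pr_integral_bind[OF law_pr[OF h] K' fb, symmetric])
    also have "bind (law q h) (\<lambda>y. PiM {..m} (\<lambda>l. Kp l q h r (y l))) = PiM {..m} (\<lambda>l. bind (K l q h (h (l, q))) (Kp l q h r))"
      unfolding law_def
      by (rule PiM_bind[where S=S]) (use K_pr[OF _ h hist_spaceD[OF h]] kernel_pow_kernel[OF K_kernel[OF _ h]] in auto)
    finally show ?thesis by simp
  qed
  have "(\<Sum>l\<le>m. real r * (c / real (Suc q) * 2)) = 2 * real (Suc m) * c * real r / real (Suc q)"
    by simp
  moreover have "?e + 2 * real (Suc m) * c * real r / real (Suc q) \<le> 2 * real (Suc m) * c * (real (Suc r))\<^sup>2 / real (Suc q)"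
  proof -
    have "2 * real (Suc m) * c * ((real r)\<^sup>2 + real r) \<le> 2 * real (Suc m) * c * (real (Suc r))\<^sup>2"
      using c_nonneg by (intro mult_left_mono) (auto simp: power2_eq_square algebra_simps)
    then show ?thesis
      unfolding add_divide_distrib[symmetric] by (intro divide_right_mono) (auto simp: algebra_simps)
  qed
  ultimately show ?case using 1 2 3 4 5 by linarith
qed

definition \<Psi>m :: "nat \<Rightarrow> (nat \<times> nat \<Rightarrow> 'a) \<Rightarrow> (nat \<Rightarrow> 'a) measure" where
  "\<Psi>m k h = PiM {..m} (\<lambda>l. \<Psi> l k h)"

lemma \<Psi>m_kernel: "\<Psi>m k \<in> H \<rightarrow>\<^sub>M prob_algebra E"
  unfolding \<Psi>m_def[abs_def] by (rule measurable_PiM_kernel) (auto intro: \<Psi>_kernel)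

lemma run_near_\<Psi>m:
  assumes f: "f \<in> test" and h: "h \<in> space H"
  shows "\<bar>(\<integral>h'. f (block (q + n0 * j) h') \<partial>run (n0 * j) q h) - integral\<^sup>L (\<Psi>m q h) f\<bar>
     \<le> 2 * real (Suc m) * c * (real (n0 * j))\<^sup>2 / real (Suc q) + 2 * real (Suc m) * (1/2) ^ j"
proof -
  have "\<bar>integral\<^sup>L (PiM {..m} (\<lambda>l. Kp l q h (n0 * j) (h (l, q)))) f - integral\<^sup>L (\<Psi>m q h) f\<bar> \<le> (\<Sum>l\<le>m. (1/2) ^ j * (2 * 1))"
    unfolding \<Psi>m_def
  proof (rule PiM_diff[OF finite_atMost _ _ testD(1)[OF f]])
    fix l x assume l: "l \<in> {..m}" and x: "x \<in> space E"
    then have lm: "l \<le> m" by simp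
    have g: "(\<lambda>z. f (x(l := z))) \<in> bfun (S l)" by (rule bfun_section(1)[OF bfun_fun_upd[OF l testD(1)[OF f]] x])
    show "\<bar>(\<integral>z. f (x(l := z)) \<partial>Kp l q h (n0 * j) (h (l, q))) - (\<integral>z. f (x(l := z)) \<partial>\<Psi> l q h)\<bar> \<le> (1/2) ^ j * (2 * 1)"
      by (rule kernel_pow_near_invariant[OF lm h g testD(2)[OF f fun_upd_PiM_space[OF x l]] hist_spaceD[OF h lm]])
  qed (use kernel_pow_pr[OF K_kernel[OF _ h]] hist_spaceD[OF h] \<Psi>_pr[OF _ h] in auto)
  also have "(\<Sum>l\<le>m. (1/2) ^ j * (2 * 1)) = 2 * real (Suc m) * (1/2) ^ j" by simp
  finally show ?thesis using frozen_run[OF f h, where q = q and r = "n0 * j"] by linarith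
qed

end

lemma eventually_inverse_small:
  fixes C \<epsilon> :: real
  assumes "0 \<le> C" "0 < \<epsilon>"
  shows "\<exists>N. \<forall>n\<ge>N. C / real (Suc n) \<le> \<epsilon>"
proof -
  obtain N where N: "C / \<epsilon> \<le> real N" using real_arch_simple by blast
  have "C / real (Suc n) \<le> \<epsilon>" if "n \<ge> N" for n
  proof -
    have "C / \<epsilon> \<le> real (Suc n)" using N that by simp
    then show ?thesis using assms by (simp add: divide_le_eq pos_divide_le_eq mult.commute)
  qed
  then show ?thesis by blast
qed

lemma eventually_geometric_small:
  fixes C \<epsilon> :: real
  assumes "0 < \<epsilon>"
  shows "\<exists>j. C * (1/2) ^ j \<le> \<epsilon>"
proof -
  have "(\<lambda>j. C * (1/2) ^ j) \<longlonglongrightarrow> 0"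
    by (intro tendsto_mult_right_zero LIMSEQ_realpow_zero) auto
  from order_tendstoD(2)[OF this assms] show ?thesis
    by (auto simp: eventually_sequentially intro: less_imp_le)
qed

lemma cesaro_bound:
  fixes a :: "nat \<Rightarrow> real"
  assumes a: "\<And>p. \<bar>a p\<bar> \<le> b" and small: "\<And>p. p \<ge> N \<Longrightarrow> \<bar>a p\<bar> \<le> \<epsilon>" and \<epsilon>: "0 \<le> \<epsilon>"
  shows "\<bar>(\<Sum>p\<le>n. a p) / real (Suc n)\<bar> \<le> b * real N / real (Suc n) + \<epsilon>"
proof -
  have b: "0 \<le> b" using a[of 0] by linarith
  have "\<bar>\<Sum>p\<le>n. a p\<bar> \<le> (\<Sum>p\<le>n. (if p < N then b else 0) + \<epsilon>)"
    by (rule order_trans[OF sum_abs]) (rule sum_mono, use a small \<epsilon> b in \<open>fastforce simp: not_less intro: order_trans[OF a]\<close>)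
  also have "\<dots> = (\<Sum>p\<le>n. if p < N then b else 0) + real (Suc n) * \<epsilon>"
    by (simp add: sum.distrib)
  also have "(\<Sum>p\<le>n. if p < N then b else 0) = (\<Sum>p\<in>{..n} \<inter> {p. p < N}. b)"
    by (subst sum.inter_restrict) auto
  also have "\<dots> \<le> (\<Sum>p<N. b)"
    using b by (intro sum_mono2) auto
  finally have "\<bar>\<Sum>p\<le>n. a p\<bar> \<le> b * real N + real (Suc n) * \<epsilon>" by (simp add: mult.commute)
  then have "\<bar>\<Sum>p\<le>n. a p\<bar> / real (Suc n) \<le> (b * real N + real (Suc n) * \<epsilon>) / real (Suc n)"
    by (rule divide_right_mono) simp
  then show ?thesis by (simp add: abs_divide add_divide_distrib del: of_nat_Suc)
qed

text \<open>
  Uniformity in the function matters for the induction over the levels, where the test functions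
  on the level below are not known in advance.
\<close>

definition uniformly_small :: "'h set \<Rightarrow> 'f set \<Rightarrow> ('f \<Rightarrow> nat \<Rightarrow> 'h \<Rightarrow> real) \<Rightarrow> bool" where
  "uniformly_small A \<F> e \<longleftrightarrow> (\<forall>\<epsilon>>0. \<exists>N. \<forall>n\<ge>N. \<forall>f\<in>\<F>. \<forall>h\<in>A. \<bar>e f n h\<bar> \<le> \<epsilon>)"

lemma uniformly_smallI:
  "(\<And>\<epsilon>. 0 < \<epsilon> \<Longrightarrow> \<exists>N. \<forall>n\<ge>N. \<forall>f\<in>\<F>. \<forall>h\<in>A. \<bar>e f n h\<bar> \<le> \<epsilon>) \<Longrightarrow> uniformly_small A \<F> e"
  by (auto simp: uniformly_small_def)

lemma uniformly_smallE:
  assumes "uniformly_small A \<F> e" "0 < \<epsilon>"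
  obtains N where "\<And>n f h. n \<ge> N \<Longrightarrow> f \<in> \<F> \<Longrightarrow> h \<in> A \<Longrightarrow> \<bar>e f n h\<bar> \<le> \<epsilon>"
  using assms unfolding uniformly_small_def by metis

context invariant_chains begin

abbreviation \<pi>m where "\<pi>m \<equiv> PiM {..m} \<pi>"

lemma \<pi>m_pr: "\<pi>m \<in> pr E" by (rule pr_PiM) (simp add: \<pi>_pr)

text \<open>
  The last \<open>r\<close> of the \<open>p\<close> steps are compared with their frozen version. First \<open>r\<close> is chosen so
  large that the frozen chain is near its invariant measure, then \<open>p\<close> so large that freezing costs little.
\<close>

lemma mean_block:
  assumes \<F>: "\<F> \<subseteq> test"
    and hyp: "uniformly_small (space H) \<F> (\<lambda>f n h. (\<integral>h'. integral\<^sup>L (\<Psi>m n h') f \<partial>run n 0 h) - integral\<^sup>L \<pi>m f)"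
  shows "uniformly_small (space H) \<F> (\<lambda>f p h. (\<integral>h'. f (block p h') \<partial>run p 0 h) - integral\<^sup>L \<pi>m f)"
proof (rule uniformly_smallI)
  fix \<epsilon> :: real assume \<epsilon>: "0 < \<epsilon>"
  then have \<epsilon>3: "0 < \<epsilon> / 3" by simp
  obtain j where j: "2 * real (Suc m) * (1/2) ^ j \<le> \<epsilon> / 3" using eventually_geometric_small[OF \<epsilon>3] by blast
  define r where "r = n0 * j"
  obtain N1 where N1: "\<And>n f h. n \<ge> N1 \<Longrightarrow> f \<in> \<F> \<Longrightarrow> h \<in> space H \<Longrightarrow>
      \<bar>(\<integral>h'. integral\<^sup>L (\<Psi>m n h') f \<partial>run n 0 h) - integral\<^sup>L \<pi>m f\<bar> \<le> \<epsilon> / 3"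
    using uniformly_smallE[OF hyp \<epsilon>3] by blast
  have "0 \<le> 2 * real (Suc m) * c * (real r)\<^sup>2" using c_nonneg by simp
  from eventually_inverse_small[OF this \<epsilon>3]
  obtain N2 where N2: "\<And>n. n \<ge> N2 \<Longrightarrow> 2 * real (Suc m) * c * (real r)\<^sup>2 / real (Suc n) \<le> \<epsilon> / 3" by blast
  show "\<exists>N. \<forall>n\<ge>N. \<forall>f\<in>\<F>. \<forall>h\<in>space H. \<bar>(\<integral>h'. f (block n h') \<partial>run n 0 h) - integral\<^sup>L \<pi>m f\<bar> \<le> \<epsilon>"
  proof (intro exI[of _ "N1 + N2 + r"] allI impI ballI)
    fix n f h assume n: "N1 + N2 + r \<le> n" and f: "f \<in> \<F>" and h: "h \<in> space H"
    define q where "q = n - r"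
    have nq: "n = q + r" "q \<ge> N1" "q \<ge> N2" using n by (auto simp: q_def)
    have ft: "f \<in> test" using f \<F> by blast
    note fb = testD(1)[OF ft]
    have "(\<integral>h'. f (block n h') \<partial>run n 0 h) = (\<integral>h'. (\<integral>h''. f (block n h'') \<partial>run r q h') \<partial>run q 0 h)"
      using run_add[OF h block_bfun[OF fb, of n], of q r 0] nq(1) by simp
    moreover have "\<bar>(\<integral>h'. (\<integral>h''. f (block n h'') \<partial>run r q h') \<partial>run q 0 h) - (\<integral>h'. integral\<^sup>L (\<Psi>m q h') f \<partial>run q 0 h)\<bar> \<le> 2 * \<epsilon> / 3"
    proof (rule pr_integral_near[OF run_pr[OF h] run_bfun[OF block_bfun[OF fb]] bfun_kernel_integral1[OF \<Psi>m_kernel fb]])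
      fix h' assume h': "h' \<in> space H"
      show "\<bar>(\<integral>h''. f (block n h'') \<partial>run r q h') - integral\<^sup>L (\<Psi>m q h') f\<bar> \<le> 2 * \<epsilon> / 3"
        using run_near_\<Psi>m[OF ft h', where q = q and j = j] j N2[OF nq(3)] unfolding r_def[symmetric] nq(1) by linarith
    qed
    ultimately show "\<bar>(\<integral>h'. f (block n h') \<partial>run n 0 h) - integral\<^sup>L \<pi>m f\<bar> \<le> \<epsilon>"
      using N1[OF nq(2) f h] by linarith
  qed
qed

lemma mean_emp_formula:
  assumes f: "f \<in> test" and h: "h \<in> space H"
  shows "(\<integral>h'. emp f n h' \<partial>run n 0 h) - integral\<^sup>L \<pi>m f
     = (\<Sum>p\<le>n. (\<integral>h'. f (block p h') \<partial>run p 0 h) - integral\<^sup>L \<pi>m f) / real (Suc n)"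
proof -
  note fb = testD(1)[OF f]
  have "(\<integral>h'. f (block p h') \<partial>run n 0 h) = (\<integral>h'. f (block p h') \<partial>run p 0 h)" if "p \<le> n" for p
  proof -
    have "(\<integral>h'. f (block p h') \<partial>run n 0 h) = (\<integral>h'. (\<integral>h''. f (block p h'') \<partial>run (n - p) p h') \<partial>run p 0 h)"
      using run_add[OF h block_bfun[OF fb, of p], of p "n - p" 0] that by simp
    also have "\<dots> = (\<integral>h'. f (block p h') \<partial>run p 0 h)"
      by (rule pr_integral_cong[OF run_pr[OF h]], rule run_adapted[OF block_bfun[OF fb] _ _ order_refl])
         (auto simp: block_def intro!: arg_cong[where f=f])
    finally show ?thesis .
  qed
  then have "(\<integral>h'. emp f n h' \<partial>run n 0 h) = (\<Sum>p\<le>n. (\<integral>h'. f (block p h') \<partial>run p 0 h)) / real (Suc n)"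
    unfolding emp_def
    by (simp add: Bochner_Integration.integral_sum[OF bfun_integrable[OF run_pr[OF h] block_bfun[OF fb]]] del: of_nat_Suc)
  then show ?thesis
    by (simp add: sum_subtractf diff_divide_distrib)
qed

lemma mean_emp:
  assumes \<F>: "\<F> \<subseteq> test"
    and hyp: "uniformly_small (space H) \<F> (\<lambda>f n h. (\<integral>h'. integral\<^sup>L (\<Psi>m n h') f \<partial>run n 0 h) - integral\<^sup>L \<pi>m f)"
  shows "uniformly_small (space H) \<F> (\<lambda>f n h. (\<integral>h'. emp f n h' \<partial>run n 0 h) - integral\<^sup>L \<pi>m f)"
proof (rule uniformly_smallI)
  fix \<epsilon> :: real assume \<epsilon>: "0 < \<epsilon>"
  then have \<epsilon>2: "0 < \<epsilon> / 2" by simp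
  obtain N where N: "\<And>n f h. n \<ge> N \<Longrightarrow> f \<in> \<F> \<Longrightarrow> h \<in> space H \<Longrightarrow>
      \<bar>(\<integral>h'. f (block n h') \<partial>run n 0 h) - integral\<^sup>L \<pi>m f\<bar> \<le> \<epsilon> / 2"
    using uniformly_smallE[OF mean_block[OF assms] \<epsilon>2] by blast
  obtain N' where N': "\<And>n. n \<ge> N' \<Longrightarrow> 2 * real N / real (Suc n) \<le> \<epsilon> / 2"
    using eventually_inverse_small[OF _ \<epsilon>2, of "2 * real N"] by auto
  show "\<exists>N. \<forall>n\<ge>N. \<forall>f\<in>\<F>. \<forall>h\<in>space H. \<bar>(\<integral>h'. emp f n h' \<partial>run n 0 h) - integral\<^sup>L \<pi>m f\<bar> \<le> \<epsilon>"
  proof (intro exI[of _ N'] allI impI ballI)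
    fix n f h assume n: "N' \<le> n" and f: "f \<in> \<F>" and h: "h \<in> space H"
    have ft: "f \<in> test" using f \<F> by blast
    have b: "\<bar>(\<integral>h'. f (block p h') \<partial>run p 0 h) - integral\<^sup>L \<pi>m f\<bar> \<le> 2" for p
    proof -
      have "\<bar>\<integral>h'. f (block p h') \<partial>run p 0 h\<bar> \<le> 1"
        by (rule integral_bounds(3)[OF run_pr[OF h] block_bfun[OF testD(1)[OF ft]]])
           (rule testD(2)[OF ft block_space])
      moreover have "\<bar>integral\<^sup>L \<pi>m f\<bar> \<le> 1"
        by (rule integral_bounds(3)[OF \<pi>m_pr testD(1)[OF ft] testD(2)[OF ft]])
      ultimately show ?thesis by linarith
    qed
    show "\<bar>(\<integral>h'. emp f n h' \<partial>run n 0 h) - integral\<^sup>L \<pi>m f\<bar> \<le> \<epsilon>"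
      unfolding mean_emp_formula[OF ft h]
      using cesaro_bound[of "\<lambda>p. (\<integral>h'. f (block p h') \<partial>run p 0 h) - integral\<^sup>L \<pi>m f" 2 N "\<epsilon> / 2" n, OF b N[OF _ f h]]
        N'[OF n] \<epsilon> by linarith
  qed
qed

lemma abs_dev_emp:
  assumes \<F>: "\<F> \<subseteq> test"
    and hyp: "uniformly_small (space H) \<F> (\<lambda>f n h. (\<integral>h'. emp f n h' \<partial>run n 0 h) - integral\<^sup>L \<pi>m f)"
  shows "uniformly_small (space H) \<F> (\<lambda>f n h. \<integral>h'. \<bar>emp f n h' - integral\<^sup>L \<pi>m f\<bar> \<partial>run n 0 h)"
proof (rule uniformly_smallI)
  fix \<epsilon> :: real assume \<epsilon>: "0 < \<epsilon>"
  then have \<epsilon>2: "0 < \<epsilon> / 2" by simp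
  obtain N where N: "\<And>n f h. n \<ge> N \<Longrightarrow> f \<in> \<F> \<Longrightarrow> h \<in> space H \<Longrightarrow>
      \<bar>(\<integral>h'. emp f n h' \<partial>run n 0 h) - integral\<^sup>L \<pi>m f\<bar> \<le> \<epsilon> / 2"
    using uniformly_smallE[OF hyp \<epsilon>2] by blast
  have "0 \<le> 36 * vconst" "0 < (\<epsilon> / 2)\<^sup>2" using vconst_pos \<epsilon> by auto
  from eventually_inverse_small[OF this]
  obtain N' where N': "\<And>n. n \<ge> N' \<Longrightarrow> 36 * vconst / real (Suc n) \<le> (\<epsilon> / 2)\<^sup>2" by blast
  show "\<exists>N. \<forall>n\<ge>N. \<forall>f\<in>\<F>. \<forall>h\<in>space H. \<bar>\<integral>h'. \<bar>emp f n h' - integral\<^sup>L \<pi>m f\<bar> \<partial>run n 0 h\<bar> \<le> \<epsilon>"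
  proof (intro exI[of _ "max N N'"] allI impI ballI)
    fix n f h assume n: "max N N' \<le> n" and f: "f \<in> \<F>" and h: "h \<in> space H"
    have ft: "f \<in> test" using f \<F> by blast
    note eb = emp_bfun[OF testD(1)[OF ft], of n]
    let ?v = "value_at n (emp f n) 0 h"
    let ?x = "integral\<^sup>L \<pi>m f"
    have v: "?v = (\<integral>h'. emp f n h' \<partial>run n 0 h)" by (simp add: value_at_def)
    have "(\<integral>h'. \<bar>emp f n h' - ?x\<bar> \<partial>run n 0 h) \<le> (\<integral>h'. \<bar>emp f n h' - ?v\<bar> + \<bar>?v - ?x\<bar> \<partial>run n 0 h)"
    proof (rule pr_integral_mono[OF run_pr[OF h]])
      show "(\<lambda>h'. \<bar>emp f n h' - ?x\<bar>) \<in> bfun H" "(\<lambda>h'. \<bar>emp f n h' - ?v\<bar> + \<bar>?v - ?x\<bar>) \<in> bfun H"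
        by (intro bfun_abs bfun_add bfun_diff eb bfun_const)+
    qed linarith
    also have "\<dots> = (\<integral>h'. \<bar>emp f n h' - ?v\<bar> \<partial>run n 0 h) + \<bar>?v - ?x\<bar>"
      by (simp only: pr_integral_add[OF run_pr[OF h] bfun_abs[OF bfun_diff[OF eb bfun_const]] bfun_const]
          pr_integral_const[OF run_pr[OF h]])
    also have "(\<integral>h'. \<bar>emp f n h' - ?v\<bar> \<partial>run n 0 h) \<le> 3 * (2 / real (Suc n) * sqrt (vconst * real (Suc n)))"
      by (rule run_abs_dev[OF eb emp_lip[OF ft] _ h]) simp
    also have "3 * (2 / real (Suc n) * sqrt (vconst * real (Suc n))) = sqrt (36 * vconst / real (Suc n))"
    proof -
      let ?r = "real (Suc n)"
      have r: "sqrt ?r * sqrt ?r = ?r" "0 < sqrt ?r" by simp_all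
      have "3 * (2 / ?r * sqrt (vconst * ?r)) = 6 * sqrt vconst * (sqrt ?r / ?r)"
        by (simp add: real_sqrt_mult)
      also have "sqrt ?r / ?r = 1 / sqrt ?r" by (simp add: real_div_sqrt divide_simps)
      also have "6 * sqrt vconst * (1 / sqrt ?r) = sqrt (36 * vconst / ?r)"
        by (simp add: real_sqrt_mult real_sqrt_divide)
      finally show ?thesis .
    qed
    also have "\<dots> \<le> sqrt ((\<epsilon> / 2)\<^sup>2)" using N'[of n] n by (intro real_sqrt_le_mono) auto
    also have "\<dots> = \<epsilon> / 2" using \<epsilon> by simp
    finally have "(\<integral>h'. \<bar>emp f n h' - ?x\<bar> \<partial>run n 0 h) \<le> \<epsilon>"
      using N[of n f h] n f h unfolding v by simp
    moreover have "0 \<le> (\<integral>h'. \<bar>emp f n h' - ?x\<bar> \<partial>run n 0 h)"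
      by (rule Bochner_Integration.integral_nonneg) simp
    ultimately show "\<bar>\<integral>h'. \<bar>emp f n h' - ?x\<bar> \<partial>run n 0 h\<bar> \<le> \<epsilon>" by simp
  qed
qed

definition level_test :: "nat \<Rightarrow> ('a \<Rightarrow> real) set" where
  "level_test l = {g \<in> bfun (S l). \<forall>x\<in>space (S l). \<bar>g x\<bar> \<le> 1}"

definition \<Psi>_close :: "nat \<Rightarrow> bool" where
  "\<Psi>_close l \<longleftrightarrow> uniformly_small (space H) (level_test l)
     (\<lambda>g n h. \<integral>h'. \<bar>integral\<^sup>L (\<Psi> l n h') g - integral\<^sup>L (\<pi> l) g\<bar> \<partial>run n 0 h)"

lemma level_test_lift:
  assumes l: "l \<le> m" and g: "g \<in> level_test l"
  shows "(\<lambda>x. g (x l)) \<in> test"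
  using g l bfun_compose[of g "S l" "\<lambda>x. x l" E] measurable_component_singleton[of l "{..m}" S]
  by (auto simp: test_def level_test_def space_PiM)

lemma \<Psi>_bfun: "l \<le> m \<Longrightarrow> g \<in> bfun (S l) \<Longrightarrow> (\<lambda>h. integral\<^sup>L (\<Psi> l k h) g) \<in> bfun H"
  by (rule bfun_kernel_integral1[OF \<Psi>_kernel])

text \<open>
  Functions of one coordinate are test functions for the joint chain, and for them the product of
  the invariant measures reduces to its factor of level \<open>l\<close>.
\<close>

lemma \<Psi>_close_emp:
  assumes l: "l \<le> m" and close: "\<Psi>_close l"
  shows "uniformly_small (space H) (level_test l)
     (\<lambda>g n h. \<integral>h'. \<bar>(\<Sum>p\<le>n. g (h' (l, p))) / real (Suc n) - integral\<^sup>L (\<pi> l) g\<bar> \<partial>run n 0 h)"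
proof -
  let ?L = "\<lambda>g x. g (x l) :: real"
  let ?F = "?L ` level_test l"
  have F: "?F \<subseteq> test" using level_test_lift[OF l] by blast
  have \<pi>g: "integral\<^sup>L \<pi>m (?L g) = integral\<^sup>L (\<pi> l) g" if "g \<in> level_test l" for g
    by (rule PiM_marginal[where S=S]) (use l that \<pi>_pr in \<open>auto simp: level_test_def\<close>)
  have \<Psi>g: "integral\<^sup>L (\<Psi>m n h) (?L g) = integral\<^sup>L (\<Psi> l n h) g" if "g \<in> level_test l" "h \<in> space H" for g n h
    unfolding \<Psi>m_def by (rule PiM_marginal[where S=S]) (use l that \<Psi>_pr in \<open>auto simp: level_test_def\<close>)
  have "uniformly_small (space H) ?F (\<lambda>f n h. (\<integral>h'. integral\<^sup>L (\<Psi>m n h') f \<partial>run n 0 h) - integral\<^sup>L \<pi>m f)"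
    unfolding uniformly_small_def
  proof (intro allI impI)
    fix \<epsilon> :: real assume "0 < \<epsilon>"
    then obtain N where N: "\<And>n g h. n \<ge> N \<Longrightarrow> g \<in> level_test l \<Longrightarrow> h \<in> space H \<Longrightarrow>
      \<bar>\<integral>h'. \<bar>integral\<^sup>L (\<Psi> l n h') g - integral\<^sup>L (\<pi> l) g\<bar> \<partial>run n 0 h\<bar> \<le> \<epsilon>"
      using uniformly_smallE[OF close[unfolded \<Psi>_close_def]] by blast
    show "\<exists>N. \<forall>n\<ge>N. \<forall>f\<in>?F. \<forall>h\<in>space H. \<bar>(\<integral>h'. integral\<^sup>L (\<Psi>m n h') f \<partial>run n 0 h) - integral\<^sup>L \<pi>m f\<bar> \<le> \<epsilon>"
    proof (intro exI[of _ N] allI impI ballI)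
      fix n f h assume n: "N \<le> n" and f: "f \<in> ?F" and h: "h \<in> space H"
      obtain g where g: "g \<in> level_test l" "f = ?L g" using f by auto
      have gb: "g \<in> bfun (S l)" using g by (simp add: level_test_def)
      have "(\<integral>h'. integral\<^sup>L (\<Psi>m n h') f \<partial>run n 0 h) = (\<integral>h'. integral\<^sup>L (\<Psi> l n h') g \<partial>run n 0 h)"
        unfolding g(2) by (rule pr_integral_cong[OF run_pr[OF h]]) (rule \<Psi>g[OF g(1)])
      then have "(\<integral>h'. integral\<^sup>L (\<Psi>m n h') f \<partial>run n 0 h) - integral\<^sup>L \<pi>m f
          = (\<integral>h'. integral\<^sup>L (\<Psi> l n h') g - integral\<^sup>L (\<pi> l) g \<partial>run n 0 h)"
        unfolding g(2) \<pi>g[OF g(1)]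
        by (simp only: pr_integral_diff[OF run_pr[OF h] \<Psi>_bfun[OF l gb] bfun_const] pr_integral_const[OF run_pr[OF h]])
      also have "\<bar>\<dots>\<bar> \<le> (\<integral>h'. \<bar>integral\<^sup>L (\<Psi> l n h') g - integral\<^sup>L (\<pi> l) g\<bar> \<partial>run n 0 h)"
        by (rule integral_abs_bound)
      also have "\<dots> \<le> \<epsilon>" using N[OF n g(1) h] by simp
      finally show "\<bar>(\<integral>h'. integral\<^sup>L (\<Psi>m n h') f \<partial>run n 0 h) - integral\<^sup>L \<pi>m f\<bar> \<le> \<epsilon>" .
    qed
  qed
  from abs_dev_emp[OF F mean_emp[OF F this]]
  have "uniformly_small (space H) ?F (\<lambda>f n h. \<integral>h'. \<bar>emp f n h' - integral\<^sup>L \<pi>m f\<bar> \<partial>run n 0 h)" .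
  moreover have "emp (?L g) n h' = (\<Sum>p\<le>n. g (h' (l, p))) / real (Suc n)" for g n h'
    using l by (simp add: emp_def block_def)
  ultimately show ?thesis unfolding uniformly_small_def using \<pi>g by (simp cong: ball_cong)
qed

text \<open>
  The finite sum of test functions, which is the same for all histories, can be exchanged with
  the expectation.
\<close>

lemma \<Psi>_close_Suc:
  assumes l: "Suc l \<le> m" and close: "\<Psi>_close l"
  shows "\<Psi>_close (Suc l)"
  unfolding \<Psi>_close_def
proof (rule uniformly_smallI)
  fix \<epsilon> :: real assume \<epsilon>: "0 < \<epsilon>"
  define \<epsilon>' where "\<epsilon>' = \<epsilon> / (\<bar>\<Lambda>\<bar> + 1)"
  have \<epsilon>': "0 < \<epsilon>'" unfolding \<epsilon>'_def using \<epsilon> by simp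
  have lm: "l \<le> m" using l by simp
  let ?D = "\<lambda>g n h'. \<bar>(\<Sum>p\<le>n. g (h' (l, p))) / real (Suc n) - integral\<^sup>L (\<pi> l) g\<bar>"
  obtain N where N: "\<And>n g h. n \<ge> N \<Longrightarrow> g \<in> level_test l \<Longrightarrow> h \<in> space H \<Longrightarrow> \<bar>\<integral>h'. ?D g n h' \<partial>run n 0 h\<bar> \<le> \<epsilon>'"
    using uniformly_smallE[OF \<Psi>_close_emp[OF lm close] \<epsilon>'] by blast
  show "\<exists>N. \<forall>n\<ge>N. \<forall>f\<in>level_test (Suc l). \<forall>h\<in>space H.
     \<bar>\<integral>h'. \<bar>integral\<^sup>L (\<Psi> (Suc l) n h') f - integral\<^sup>L (\<pi> (Suc l)) f\<bar> \<partial>run n 0 h\<bar> \<le> \<epsilon>"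
  proof (intro exI[of _ N] allI impI ballI)
    fix n f h assume n: "N \<le> n" and f: "f \<in> level_test (Suc l)" and h: "h \<in> space H"
    have fb: "f \<in> bfun (S (Suc l))" "\<forall>x\<in>space (S (Suc l)). \<bar>f x\<bar> \<le> 1"
      using f by (auto simp: level_test_def)
    obtain G :: "('a \<Rightarrow> real) set" and w \<xi> where G1: "finite G"
      and G2: "\<forall>i\<in>G. \<xi> i \<in> bfun (S l) \<and> (\<forall>x\<in>space (S l). \<bar>\<xi> i x\<bar> \<le> 1) \<and> 0 \<le> w i"
      and G4: "sum w G \<le> \<Lambda>" and G5: "\<forall>k. \<forall>h\<in>space H. \<bar>integral\<^sup>L (\<Psi> (Suc l) k h) f - integral\<^sup>L (\<pi> (Suc l)) f\<bar>
        \<le> (\<Sum>i\<in>G. w i * \<bar>(\<Sum>p\<le>k. \<xi> i (h (l, p))) / real (Suc k) - integral\<^sup>L (\<pi> l) (\<xi> i)\<bar>)"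
      using \<Psi>_finite[OF l fb] by (elim exE conjE) (rule that; assumption)
    have G: "\<And>i. i \<in> G \<Longrightarrow> \<xi> i \<in> level_test l" "\<And>i. i \<in> G \<Longrightarrow> 0 \<le> w i"
      using G2 by (auto simp: level_test_def)
    have bd: "\<bar>integral\<^sup>L (\<Psi> (Suc l) n h') f - integral\<^sup>L (\<pi> (Suc l)) f\<bar> \<le> (\<Sum>i\<in>G. w i * ?D (\<xi> i) n h')"
      if "h' \<in> space H" for h' using G5 that by blast
    have gb: "\<xi> i \<in> bfun (S l)" if "i \<in> G" for i using G(1)[OF that] by (simp add: level_test_def)
    have Db: "?D (\<xi> i) n \<in> bfun H" if "i \<in> G" for i
      unfolding divide_inverse
      by (intro bfun_abs bfun_diff bfun_mult bfun_const bfun_sum bfun_compose[OF gb[OF that] hist_component[where S = S, OF lm]])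
    have "(\<integral>h'. \<bar>integral\<^sup>L (\<Psi> (Suc l) n h') f - integral\<^sup>L (\<pi> (Suc l)) f\<bar> \<partial>run n 0 h)
        \<le> (\<integral>h'. (\<Sum>i\<in>G. w i * ?D (\<xi> i) n h') \<partial>run n 0 h)"
    proof (rule pr_integral_mono[OF run_pr[OF h] _ _ bd])
      show "(\<lambda>h'. \<bar>integral\<^sup>L (\<Psi> (Suc l) n h') f - integral\<^sup>L (\<pi> (Suc l)) f\<bar>) \<in> bfun H"
        by (intro bfun_abs bfun_diff \<Psi>_bfun[OF l] fb(1) bfun_const)
      show "(\<lambda>h'. \<Sum>i\<in>G. w i * ?D (\<xi> i) n h') \<in> bfun H"
        by (intro bfun_sum bfun_mult bfun_const Db)
    qed
    also have "\<dots> = (\<Sum>i\<in>G. w i * (\<integral>h'. ?D (\<xi> i) n h' \<partial>run n 0 h))"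
      unfolding integral_mult_right_zero[symmetric]
      by (rule Bochner_Integration.integral_sum) (intro bfun_integrable[OF run_pr[OF h]] bfun_mult bfun_const Db)
    also have "\<dots> \<le> (\<Sum>i\<in>G. w i * \<epsilon>')"
      using N[OF n G(1) h] by (intro sum_mono mult_left_mono G(2)) auto
    also have "\<dots> = sum w G * \<epsilon>'" by (rule sum_distrib_right[symmetric])
    also have "\<dots> \<le> (\<bar>\<Lambda>\<bar> + 1) * \<epsilon>'" using G4 \<epsilon>' by (intro mult_right_mono) auto
    also have "\<dots> = \<epsilon>" unfolding \<epsilon>'_def by simp
    finally have "(\<integral>h'. \<bar>integral\<^sup>L (\<Psi> (Suc l) n h') f - integral\<^sup>L (\<pi> (Suc l)) f\<bar> \<partial>run n 0 h) \<le> \<epsilon>" .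
    moreover have "0 \<le> (\<integral>h'. \<bar>integral\<^sup>L (\<Psi> (Suc l) n h') f - integral\<^sup>L (\<pi> (Suc l)) f\<bar> \<partial>run n 0 h)"
      by (rule Bochner_Integration.integral_nonneg) simp
    ultimately show "\<bar>\<integral>h'. \<bar>integral\<^sup>L (\<Psi> (Suc l) n h') f - integral\<^sup>L (\<pi> (Suc l)) f\<bar> \<partial>run n 0 h\<bar> \<le> \<epsilon>" by simp
  qed
qed

lemma \<Psi>_close: "l \<le> m \<Longrightarrow> \<Psi>_close l"
proof (induction l)
  case 0
  have "(\<integral>h'. \<bar>integral\<^sup>L (\<Psi> 0 n h') g - integral\<^sup>L (\<pi> 0) g\<bar> \<partial>run n 0 h) = 0" if "h \<in> space H" for n h and g :: "'a \<Rightarrow> real"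
  proof -
    have "(\<integral>h'. \<bar>integral\<^sup>L (\<Psi> 0 n h') g - integral\<^sup>L (\<pi> 0) g\<bar> \<partial>run n 0 h) = (\<integral>h'. 0 \<partial>run n 0 h)"
      by (rule pr_integral_cong[OF run_pr[OF that]]) (simp add: \<Psi>_0)
    then show ?thesis by simp
  qed
  then show ?case unfolding \<Psi>_close_def by (auto simp: uniformly_small_def)
qed (auto intro: \<Psi>_close_Suc)

text \<open>
  The factors are replaced by their limits from the last to the first. When factor \<open>j\<close> is replaced,
  the product of the other ones is decoupled from the error in factor \<open>j\<close>, whose mean is small for
  every fixed value of the other coordinates.
\<close>

lemma \<Psi>m_close:
  "uniformly_small (space H) test (\<lambda>f n h. (\<integral>h'. integral\<^sup>L (\<Psi>m n h') f \<partial>run n 0 h) - integral\<^sup>L \<pi>m f)"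
proof (rule uniformly_smallI)
  fix \<epsilon> :: real assume \<epsilon>: "0 < \<epsilon>"
  define \<epsilon>' where "\<epsilon>' = \<epsilon> / (2 * real (Suc m))"
  have \<epsilon>': "0 < \<epsilon>'" unfolding \<epsilon>'_def using \<epsilon> by simp
  have "\<exists>N. \<forall>l\<le>m. \<forall>n\<ge>N. \<forall>g\<in>level_test l. \<forall>h\<in>space H.
     \<bar>\<integral>h'. \<bar>integral\<^sup>L (\<Psi> l n h') g - integral\<^sup>L (\<pi> l) g\<bar> \<partial>run n 0 h\<bar> \<le> \<epsilon>'"
  proof -
    have "\<forall>l\<in>{..m}. \<forall>\<^sub>F n in sequentially. \<forall>g\<in>level_test l. \<forall>h\<in>space H.
      \<bar>\<integral>h'. \<bar>integral\<^sup>L (\<Psi> l n h') g - integral\<^sup>L (\<pi> l) g\<bar> \<partial>run n 0 h\<bar> \<le> \<epsilon>'"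
      using \<Psi>_close \<epsilon>' unfolding \<Psi>_close_def uniformly_small_def eventually_sequentially by blast
    then have "\<forall>\<^sub>F n in sequentially. \<forall>l\<in>{..m}. \<forall>g\<in>level_test l. \<forall>h\<in>space H.
      \<bar>\<integral>h'. \<bar>integral\<^sup>L (\<Psi> l n h') g - integral\<^sup>L (\<pi> l) g\<bar> \<partial>run n 0 h\<bar> \<le> \<epsilon>'"
      by (rule eventually_ball_finite[OF finite_atMost])
    then show ?thesis unfolding eventually_sequentially by blast
  qed
  then obtain N where N: "\<And>l n g h. l \<le> m \<Longrightarrow> n \<ge> N \<Longrightarrow> g \<in> level_test l \<Longrightarrow> h \<in> space H \<Longrightarrow>
     \<bar>\<integral>h'. \<bar>integral\<^sup>L (\<Psi> l n h') g - integral\<^sup>L (\<pi> l) g\<bar> \<partial>run n 0 h\<bar> \<le> \<epsilon>'" by blast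
  have "0 \<le> c\<^sup>2 * vconst" using vconst_pos by simp
  from eventually_inverse_small[OF this \<epsilon>']
  obtain N' where N': "\<And>n. n \<ge> N' \<Longrightarrow> c\<^sup>2 * vconst / real (Suc n) \<le> \<epsilon>'" by blast
  show "\<exists>N. \<forall>n\<ge>N. \<forall>f\<in>test. \<forall>h\<in>space H. \<bar>(\<integral>h'. integral\<^sup>L (\<Psi>m n h') f \<partial>run n 0 h) - integral\<^sup>L \<pi>m f\<bar> \<le> \<epsilon>"
  proof (intro exI[of _ "max N N'"] allI impI ballI)
    fix n f h assume n: "max N N' \<le> n" and f: "f \<in> test" and h: "h \<in> space H"
    note fb = testD(1)[OF f]
    \<comment> \<open>the product with the first \<open>j\<close> factors random and the others already replaced by their limits\<close>
    define fam where "fam j h' = (\<lambda>i. if i < j then \<Psi> i n h' else \<pi> i)" for j h'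
    define T where "T j h' = PiM {..m} (fam j h')" for j h'
    have fam_pr: "fam j h' i \<in> pr (S i)" if "i \<in> {..m}" "h' \<in> space H" for i j h'
      using that \<Psi>_pr \<pi>_pr by (simp add: fam_def)
    have T: "T j \<in> H \<rightarrow>\<^sub>M prob_algebra E" for j
      unfolding T_def[abs_def]
    proof (rule measurable_PiM_kernel[OF finite_atMost])
      fix i assume i: "i \<in> {..m}"
      show "(\<lambda>h'. fam j h' i) \<in> H \<rightarrow>\<^sub>M prob_algebra (S i)"
        using i \<Psi>_kernel[of i n] \<pi>_pr[of i] by (cases "i < j") (simp_all add: fam_def)
    qed
    let ?a = "c / real (Suc n)"
    have step: "\<bar>(\<integral>h'. integral\<^sup>L (T (Suc j) h') f \<partial>run n 0 h) - (\<integral>h'. integral\<^sup>L (T j h') f \<partial>run n 0 h)\<bar> \<le> 2 * \<epsilon>'"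
      if j: "j \<le> m" for j
    proof -
      have jI: "j \<in> {..m}" using j by simp
      define g where "g y z = f (y(j := z))" for y z
      have g2: "(\<lambda>(y, z). g y z) \<in> bfun (E \<Otimes>\<^sub>M S j)" unfolding g_def by (rule bfun_fun_upd[OF jI fb])
      have g: "g y \<in> bfun (S j)" if "y \<in> space E" for y by (rule bfun_section(1)[OF g2 that])
      have g1: "\<bar>g y z\<bar> \<le> 1" if "y \<in> space E" "z \<in> space (S j)" for y z
        unfolding g_def by (rule testD(2)[OF f fun_upd_PiM_space[OF that(1) jI that(2)]])
      define u where "u h' y = integral\<^sup>L (\<Psi> j n h') (g y) - integral\<^sup>L (\<pi> j) (g y)" for h' y
      have i1: "(\<lambda>(h', y). integral\<^sup>L (\<Psi> j n h') (g y)) \<in> bfun (H \<Otimes>\<^sub>M E)"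
      proof -
        have "(\<lambda>p. \<integral>z. g (snd p) z \<partial>\<Psi> j n (fst p)) \<in> bfun (H \<Otimes>\<^sub>M E)"
        proof (rule bfun_kernel_integral[where Y="S j"])
          show "(\<lambda>p. \<Psi> j n (fst p)) \<in> H \<Otimes>\<^sub>M E \<rightarrow>\<^sub>M prob_algebra (S j)"
            by (rule measurable_compose[OF measurable_fst \<Psi>_kernel[OF j]])
          have "(\<lambda>q. (snd (fst q), snd q)) \<in> (H \<Otimes>\<^sub>M E) \<Otimes>\<^sub>M S j \<rightarrow>\<^sub>M E \<Otimes>\<^sub>M S j" by measurable
          from bfun_compose[OF g2 this]
          show "(\<lambda>(p, z). g (snd p) z) \<in> bfun ((H \<Otimes>\<^sub>M E) \<Otimes>\<^sub>M S j)" by (simp add: split_def)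
        qed
        then show ?thesis by (simp add: split_def)
      qed
      have i2: "(\<lambda>y. integral\<^sup>L (\<pi> j) (g y)) \<in> bfun E"
        by (rule bfun_kernel_integral[OF _ g2]) (use \<pi>_pr[OF j] in simp)
      have u: "(\<lambda>(h', y). u h' y) \<in> bfun (H \<Otimes>\<^sub>M E)"
        using bfun_diff[OF i1 bfun_compose[OF i2 measurable_snd[of H E]]] by (simp add: u_def split_def)
      have diff: "integral\<^sup>L (T (Suc j) h') f - integral\<^sup>L (T j h') f = integral\<^sup>L (T j h') (u h')"
        if h': "h' \<in> space H" for h'
      proof -
        note Tp = kernel_pr[OF T h', of j]
        have upd1: "fam (Suc j) h' = (fam j h')(j := \<Psi> j n h')" by (auto simp: fam_def)
        have upd2: "fam j h' = (fam j h')(j := \<pi> j)" by (auto simp: fam_def)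
        have "integral\<^sup>L (T (Suc j) h') f = (\<integral>y. integral\<^sup>L (\<Psi> j n h') (g y) \<partial>T j h')"
          unfolding T_def upd1 g_def
          by (rule PiM_resample[OF finite_atMost jI fam_pr[OF _ h'] \<Psi>_pr[OF j h'] fb])
        moreover have "integral\<^sup>L (T j h') f = (\<integral>y. integral\<^sup>L (\<pi> j) (g y) \<partial>T j h')"
          unfolding T_def g_def
          using PiM_resample[OF finite_atMost jI fam_pr[where j = j, OF _ h'] \<pi>_pr[OF j] fb] upd2 by simp
        moreover have "integral\<^sup>L (T j h') (u h') = (\<integral>y. integral\<^sup>L (\<Psi> j n h') (g y) \<partial>T j h') - (\<integral>y. integral\<^sup>L (\<pi> j) (g y) \<partial>T j h')"
          unfolding u_def by (rule pr_integral_diff[OF Tp bfun_section(1)[OF i1 h'] i2])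
        ultimately show ?thesis by simp
      qed
      have Tb: "(\<lambda>h'. integral\<^sup>L (T j h') f) \<in> bfun H" for j by (rule bfun_kernel_integral1[OF T fb])
      have "(\<integral>h'. integral\<^sup>L (T (Suc j) h') f \<partial>run n 0 h) - (\<integral>h'. integral\<^sup>L (T j h') f \<partial>run n 0 h)
          = (\<integral>h'. integral\<^sup>L (T j h') (u h') \<partial>run n 0 h)"
        unfolding pr_integral_diff[OF run_pr[OF h] Tb Tb, symmetric]
        by (rule pr_integral_cong[OF run_pr[OF h] diff])
      \<comment> \<open>a change of level \<open>l\<close> is felt by the factor \<open>l + 1\<close> of the product only\<close>
      also have "\<bar>\<dots>\<bar> \<le> \<epsilon>' + ?a\<^sup>2 * (vconst * real (Suc n))"
      proof (rule decoupled_small[OF T u _ _ _ h])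
        show "0 \<le> ?a" using c_nonneg by simp
        show "lip (\<lambda>h'. integral\<^sup>L (T j h') g') (?a * b)"
          if g': "g' \<in> bfun E" "\<And>x. x \<in> space E \<Longrightarrow> \<bar>g' x\<bar> \<le> b" for g' b
          unfolding lip_def
        proof (intro allI impI ballI)
          fix l i h' z assume l: "l \<le> m" and h': "h' \<in> space H" and z: "z \<in> space (S l)"
          let ?h = "h'((l, i) := z)"
          have h2: "?h \<in> space H" by (rule hist_fun_upd[OF h' l z])
          have b: "0 \<le> b" using g'(2)[OF block_space[OF h', of 0]] by linarith
          show "\<bar>integral\<^sup>L (T j ?h) g' - integral\<^sup>L (T j h') g'\<bar> \<le> ?a * b"
          proof (cases "Suc l \<le> m")
            case False
            have "fam j ?h i' = fam j h' i'" if "i' \<in> {..m}" for i'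
            proof -
              have im: "i' \<le> m" "i' \<noteq> Suc l" using that False by auto
              show ?thesis using \<Psi>_change(2)[OF im(1) l h' z bfun_const _ order_refl im(2), of 0] by (simp add: fam_def)
            qed
            then have "T j ?h = T j h'" unfolding T_def by (intro PiM_cong) auto
            then show ?thesis using b c_nonneg by simp
          next
            case True
            have "PiM {..m} (fam j ?h) = PiM {..m} ((fam j h')(Suc l := fam j ?h (Suc l)))"
            proof (rule PiM_cong[OF refl])
              fix i' assume "i' \<in> {..m}"
              then have im: "i' \<le> m" by simp
              show "fam j ?h i' = ((fam j h')(Suc l := fam j ?h (Suc l))) i'"
                using \<Psi>_change(2)[OF im l h' z bfun_const _ order_refl, of 0] by (auto simp: fam_def)
            qed
            then show ?thesis unfolding T_def
            proof (simp only:, intro PiM_diff_one[OF finite_atMost _ fam_pr[OF _ h'] _ g'(1)])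
              show "Suc l \<in> {..m}" using True by simp
              then show "fam j ?h (Suc l) \<in> pr (S (Suc l))" by (rule fam_pr[OF _ h2])
              fix y assume y: "y \<in> space E"
              have sec: "(\<lambda>w. g' (y(Suc l := w))) \<in> bfun (S (Suc l))"
                by (rule bfun_section(1)[OF bfun_fun_upd[OF _ g'(1)] y]) (use True in simp)
              have secb: "\<bar>g' (y(Suc l := w))\<bar> \<le> b" if "w \<in> space (S (Suc l))" for w
                by (rule g'(2)[OF fun_upd_PiM_space[OF y _ that]]) (use True in simp)
              show "\<bar>(\<integral>w. g' (y(Suc l := w)) \<partial>fam j ?h (Suc l)) - (\<integral>w. g' (y(Suc l := w)) \<partial>fam j h' (Suc l))\<bar> \<le> ?a * b"
              proof (cases "Suc l < j")
                case True2: True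
                then show ?thesis unfolding fam_def using \<Psi>_change(1)[OF True l h' z sec secb b] by simp
              next
                case False then show ?thesis unfolding fam_def using b c_nonneg by simp
              qed
            qed auto
          qed
        qed
      next
        fix y assume y: "y \<in> space E"
        show "lip (\<lambda>h'. u h' y) ?a" unfolding lip_def u_def
        proof (intro allI impI ballI)
          fix l i h' z assume l: "l \<le> m" and h': "h' \<in> space H" and z: "z \<in> space (S l)"
          show "\<bar>integral\<^sup>L (\<Psi> j n (h'((l, i) := z))) (g y) - integral\<^sup>L (\<pi> j) (g y)
              - (integral\<^sup>L (\<Psi> j n h') (g y) - integral\<^sup>L (\<pi> j) (g y))\<bar> \<le> ?a"
            using \<Psi>_change(1)[OF j l h' z g[OF y] g1[OF y], where j = i and k = n] by simp
        qed
        have gl: "g y \<in> level_test j" using g[OF y] g1[OF y] by (simp add: level_test_def)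
        have "\<bar>\<integral>h'. u h' y \<partial>run n 0 h\<bar> \<le> (\<integral>h'. \<bar>u h' y\<bar> \<partial>run n 0 h)" by (rule integral_abs_bound)
        also have "\<dots> \<le> \<epsilon>'" using N[OF j _ gl h, of n] n unfolding u_def by simp
        finally show "\<bar>\<integral>h'. u h' y \<partial>run n 0 h\<bar> \<le> \<epsilon>'" .
      qed
      also have "?a\<^sup>2 * (vconst * real (Suc n)) = c\<^sup>2 * vconst / real (Suc n)"
        by (simp add: power_divide power2_eq_square del: of_nat_Suc)
      also have "\<epsilon>' + \<dots> \<le> 2 * \<epsilon>'" using N'[of n] n by simp
      finally show ?thesis .
    qed
    have tel: "\<bar>(\<integral>h'. integral\<^sup>L (T j h') f \<partial>run n 0 h) - (\<integral>h'. integral\<^sup>L (T 0 h') f \<partial>run n 0 h)\<bar> \<le> real j * (2 * \<epsilon>')"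
      if "j \<le> Suc m" for j
      using that
    proof (induction j)
      case (Suc j)
      then show ?case using step[of j] by (simp add: algebra_simps)
    qed simp
    have "T (Suc m) h' = \<Psi>m n h'" for h' unfolding T_def \<Psi>m_def by (rule PiM_cong) (auto simp: fam_def)
    moreover have "T 0 h' = \<pi>m" for h' unfolding T_def by (rule PiM_cong) (auto simp: fam_def)
    moreover have "real (Suc m) * (2 * \<epsilon>') = \<epsilon>" unfolding \<epsilon>'_def by (simp del: of_nat_Suc)
    ultimately show "\<bar>(\<integral>h'. integral\<^sup>L (\<Psi>m n h') f \<partial>run n 0 h) - integral\<^sup>L \<pi>m f\<bar> \<le> \<epsilon>"
      using tel[of "Suc m"] prob_space.prob_space[OF prD(1)[OF run_pr[OF h]]] by simp
  qed
qed

text \<open>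
  Concentration around the mean given the starting point, and a bias below \<open>\<epsilon>\<close> whatever the
  starting point is.
\<close>

theorem emp_tail:
  assumes \<epsilon>: "0 < \<epsilon>"
  shows "\<exists>N. \<forall>n\<ge>N. \<forall>f\<in>test. \<forall>h\<in>space H. \<forall>t\<ge>\<epsilon>.
    measure (run n 0 h) {h' \<in> space H. t < \<bar>emp f n h' - integral\<^sup>L \<pi>m f\<bar>}
      \<le> 2 * exp (- ((t - \<epsilon>)\<^sup>2 * real (Suc n) / (8 * vconst)))"
proof -
  obtain N where N: "\<And>n f h. n \<ge> N \<Longrightarrow> f \<in> test \<Longrightarrow> h \<in> space H \<Longrightarrow>
      \<bar>(\<integral>h'. emp f n h' \<partial>run n 0 h) - integral\<^sup>L \<pi>m f\<bar> \<le> \<epsilon>"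
    using uniformly_smallE[OF mean_emp[OF order_refl \<Psi>m_close] \<epsilon>] by blast
  show ?thesis
  proof (intro exI[of _ N] allI impI ballI)
    fix n f h t assume n: "N \<le> n" and f: "f \<in> test" and h: "h \<in> space H" and t: "\<epsilon> \<le> t"
    let ?v = "value_at n (emp f n) 0 h"
    let ?x = "integral\<^sup>L \<pi>m f"
    note eb = emp_bfun[OF testD(1)[OF f], of n]
    have v: "\<bar>?v - ?x\<bar> \<le> \<epsilon>" using N[OF n f h] by (simp add: value_at_def)
    interpret prob_space "run n 0 h" by (rule prD(1)[OF run_pr[OF h]])
    have "{h' \<in> space H. t - \<epsilon> < \<bar>emp f n h' - ?v\<bar>} \<in> sets H"
      using bfun_meas[OF eb] by measurable
    then have "measure (run n 0 h) {h' \<in> space H. t < \<bar>emp f n h' - ?x\<bar>}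
        \<le> measure (run n 0 h) {h' \<in> space H. t - \<epsilon> < \<bar>emp f n h' - ?v\<bar>}"
      using v prD(2)[OF run_pr[OF h]] by (intro finite_measure_mono) auto
    also have "\<dots> \<le> 2 * exp (- ((t - \<epsilon>)\<^sup>2 / (2 * ((2 / real (Suc n))\<^sup>2 * (vconst * real (Suc n))))))"
      using t by (intro run_tail[OF eb emp_lip[OF f] _ h]) auto
    also have "(t - \<epsilon>)\<^sup>2 / (2 * ((2 / real (Suc n))\<^sup>2 * (vconst * real (Suc n)))) = (t - \<epsilon>)\<^sup>2 * real (Suc n) / (8 * vconst)"
      using vconst_pos by (simp add: power2_eq_square divide_simps del: of_nat_Suc)
    finally show "measure (run n 0 h) {h' \<in> space H. t < \<bar>emp f n h' - ?x\<bar>}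
        \<le> 2 * exp (- ((t - \<epsilon>)\<^sup>2 * real (Suc n) / (8 * vconst)))" .
  qed
qed

end

section \<open>The law of the process\<close>

lemma generated_by_subalgebra:
  assumes "\<And>k p. (k, p) \<in> I \<Longrightarrow> X k p \<in> P \<rightarrow>\<^sub>M S k"
  shows "subalgebra P (generated_by P S X I)"
proof -
  let ?G = "\<Union>(k, p)\<in>I. {X k p -` A \<inter> space P | A. A \<in> sets (S k)}"
  have sub: "?G \<subseteq> sets P"
  proof clarify
    fix k p A assume "(k, p) \<in> I" "A \<in> sets (S k)"
    then show "X k p -` A \<inter> space P \<in> sets P" by (intro measurable_sets[OF assms])
  qed
  have pow: "?G \<subseteq> Pow (space P)" by auto
  show ?thesis
    unfolding subalgebra_def generated_by_def space_measure_of[OF pow] sets_measure_of[OF pow]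
    using sets.sigma_sets_subset[OF sub] by simp
qed

lemma measurable_generated_by:
  assumes "(k, p) \<in> I" "\<And>k p. (k, p) \<in> I \<Longrightarrow> X k p \<in> P \<rightarrow>\<^sub>M S k"
  shows "X k p \<in> generated_by P S X I \<rightarrow>\<^sub>M S k"
proof (rule measurableI)
  let ?G = "\<Union>(k, p)\<in>I. {X k p -` A \<inter> space P | A. A \<in> sets (S k)}"
  have pow: "?G \<subseteq> Pow (space P)" by auto
  have sp: "space (generated_by P S X I) = space P" unfolding generated_by_def by (rule space_measure_of[OF pow])
  show "X k p x \<in> space (S k)" if "x \<in> space (generated_by P S X I)" for x
    using measurable_space[OF assms(2)[OF assms(1)]] that unfolding sp by blast
  fix A assume "A \<in> sets (S k)"
  then have "X k p -` A \<inter> space P \<in> ?G" using assms(1) by blast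
  then show "X k p -` A \<inter> space (generated_by P S X I) \<in> sets (generated_by P S X I)"
    unfolding sp unfolding generated_by_def sets_measure_of[OF pow] by (rule sigma_sets.Basic)
qed

lemma cond_law_integral:
  assumes P: "prob_space P" and F: "subalgebra P F" and law: "cond_law P F T J \<kappa>"
    and J: "J \<in> P \<rightarrow>\<^sub>M T" and B: "B \<in> sets F" and A: "A \<in> sets T"
    and \<kappa>: "(\<lambda>\<omega>. measure (\<kappa> \<omega>) A) \<in> borel_measurable P"
  shows "(\<integral>\<omega>. indicator B \<omega> * indicator (J -` A \<inter> space P) \<omega> \<partial>P) = (\<integral>\<omega>. indicator B \<omega> * measure (\<kappa> \<omega>) A \<partial>P)"
proof -
  interpret prob_space P by (rule P)
  interpret finite_measure_subalgebra P F
    by unfold_locales (rule F)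
  have JA: "J -` A \<inter> space P \<in> sets P" by (rule measurable_sets[OF J A])
  have BP: "B \<in> sets P" using F B unfolding subalgebra_def by auto
  have "(\<integral>\<omega>. indicator B \<omega> * (indicator (J -` A \<inter> space P) \<omega> :: real) \<partial>P)
      = (\<integral>\<omega>. indicator B \<omega> * real_cond_exp P F (indicator (J -` A \<inter> space P)) \<omega> \<partial>P)"
  proof (rule real_cond_exp_intg(2)[symmetric])
    have "(\<lambda>\<omega>. indicator B \<omega> * (indicator (J -` A \<inter> space P) \<omega> :: real)) = indicator (B \<inter> (J -` A \<inter> space P))"
      by (auto simp: indicator_def)
    then show "integrable P (\<lambda>\<omega>. indicator B \<omega> * (indicator (J -` A \<inter> space P) \<omega> :: real))"
      using BP JA by (simp add: integrable_indicator_iff emeasure_eq_measure)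
    show "indicator B \<in> borel_measurable F" using B by simp
    show "indicator (J -` A \<inter> space P) \<in> borel_measurable P" using JA by simp
  qed
  also have "\<dots> = (\<integral>\<omega>. indicator B \<omega> * measure (\<kappa> \<omega>) A \<partial>P)"
  proof (rule integral_cong_AE)
    show "(\<lambda>\<omega>. indicator B \<omega> * real_cond_exp P F (indicator (J -` A \<inter> space P)) \<omega>) \<in> borel_measurable P"
      using BP by measurable
    show "(\<lambda>\<omega>. indicator B \<omega> * measure (\<kappa> \<omega>) A) \<in> borel_measurable P" using BP \<kappa> by measurable
    show "AE \<omega> in P. indicator B \<omega> * real_cond_exp P F (indicator (J -` A \<inter> space P)) \<omega> = indicator B \<omega> * measure (\<kappa> \<omega>) A"
      using law A unfolding cond_law_def by auto
  qed
  finally show ?thesis .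
qed

context interacting_chains begin

text \<open>
  A random history that is determined by the past up to time \<open>k\<close>; the points \<open>z\<close> fill the later coordinates.
\<close>

definition stopped :: "(nat \<Rightarrow> 'a) \<Rightarrow> (nat \<Rightarrow> nat \<Rightarrow> 'w \<Rightarrow> 'a) \<Rightarrow> nat \<Rightarrow> 'w \<Rightarrow> nat \<times> nat \<Rightarrow> 'a" where
  "stopped z X k \<omega> = (\<lambda>i\<in>{..m} \<times> UNIV. if snd i \<le> k then X (fst i) (snd i) \<omega> else z (fst i))"

lemma stopped_measurable:
  assumes z: "\<And>l. l \<le> m \<Longrightarrow> z l \<in> space (S l)"
    and X: "\<And>l p. l \<le> m \<Longrightarrow> p \<le> k \<Longrightarrow> X l p \<in> Q \<rightarrow>\<^sub>M S l"
  shows "stopped z X k \<in> Q \<rightarrow>\<^sub>M H"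
  unfolding stopped_def[abs_def] hist_def
proof (rule measurable_restrict)
  fix i :: "nat \<times> nat" assume i: "i \<in> {..m} \<times> UNIV"
  then have l: "fst i \<le> m" by auto
  show "(\<lambda>\<omega>. if snd i \<le> k then X (fst i) (snd i) \<omega> else z (fst i)) \<in> Q \<rightarrow>\<^sub>M S (fst i)"
    using X[OF l] z[OF l] by (cases "snd i \<le> k") auto
qed

lemma stopped_Suc: "stopped z X (Suc k) \<omega> = upd m (Suc k) (stopped z X k \<omega>) (joint X m (Suc k) \<omega>)"
  by (auto simp: stopped_def upd_def joint_def fun_eq_iff le_Suc_eq)

text \<open>
  The conditional law fixes the joint law of past and next block on rectangles, and these generate
  the product \<open>\<sigma>\<close>-algebra.
\<close>

lemma process_step:
  fixes P :: "'w measure"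
  assumes P: "prob_space P" and X: "\<And>l p. l \<le> m \<Longrightarrow> X l p \<in> P \<rightarrow>\<^sub>M S l"
    and z: "\<And>l. l \<le> m \<Longrightarrow> z l \<in> space (S l)"
    and cond: "cond_law P (generated_by P S X ({..m} \<times> {..k})) E (joint X m (Suc k)) \<kappa>"
    and \<kappa>: "\<And>\<omega>. \<omega> \<in> space P \<Longrightarrow> \<kappa> \<omega> = law k (stopped z X k \<omega>)"
    and F: "F \<in> bfun H"
  shows "(\<integral>\<omega>. F (stopped z X (Suc k) \<omega>) \<partial>P) = (\<integral>\<omega>. integral\<^sup>L (step k (stopped z X k \<omega>)) F \<partial>P)"
proof -
  let ?Y = "stopped z X k" and ?J = "joint X m (Suc k)"
  let ?F = "generated_by P S X ({..m} \<times> {..k})"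
  have Ppr: "P \<in> pr P" using P by (simp add: prI)
  have sub: "subalgebra P ?F" by (rule generated_by_subalgebra) (use X in auto)
  have Y: "?Y \<in> P \<rightarrow>\<^sub>M H" by (rule stopped_measurable[OF z X])
  have YF: "?Y \<in> ?F \<rightarrow>\<^sub>M H"
    by (rule stopped_measurable[OF z]) (auto intro!: measurable_generated_by X)
  have J: "?J \<in> P \<rightarrow>\<^sub>M E" unfolding joint_def[abs_def] by (rule measurable_restrict) (use X in auto)
  have YJ: "(\<lambda>\<omega>. (?Y \<omega>, ?J \<omega>)) \<in> P \<rightarrow>\<^sub>M H \<Otimes>\<^sub>M E" by (rule measurable_Pair[OF Y J])
  let ?R = "\<lambda>h. distr (law k h) (H \<Otimes>\<^sub>M E) (\<lambda>y. (h, y))"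
  have R: "?R \<in> H \<rightarrow>\<^sub>M prob_algebra (H \<Otimes>\<^sub>M E)"
    by (rule measurable_distr_prob_space2[OF law_kernel]) simp
  have D: "distr P H ?Y \<in> pr H" by (rule pr_distr[OF Ppr Y])
  let ?\<nu>1 = "distr P (H \<Otimes>\<^sub>M E) (\<lambda>\<omega>. (?Y \<omega>, ?J \<omega>))"
  let ?\<nu>2 = "bind (distr P H ?Y) ?R"
  have n1: "?\<nu>1 \<in> pr (H \<Otimes>\<^sub>M E)" by (rule pr_distr[OF Ppr YJ])
  have n2: "?\<nu>2 \<in> pr (H \<Otimes>\<^sub>M E)" by (rule pr_bind[OF D R])
  have int2: "integral\<^sup>L ?\<nu>2 g = (\<integral>\<omega>. (\<integral>y. g (?Y \<omega>, y) \<partial>law k (?Y \<omega>)) \<partial>P)" if g: "g \<in> bfun (H \<Otimes>\<^sub>M E)" for g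
  proof -
    have "integral\<^sup>L ?\<nu>2 g = (\<integral>h. integral\<^sup>L (?R h) g \<partial>distr P H ?Y)" by (rule pr_integral_bind[OF D R g])
    also have "\<dots> = (\<integral>\<omega>. integral\<^sup>L (?R (?Y \<omega>)) g \<partial>P)"
      by (rule pr_integral_distr[OF Ppr Y bfun_meas[OF bfun_kernel_integral1[OF R g]]])
    also have "\<dots> = (\<integral>\<omega>. (\<integral>y. g (?Y \<omega>, y) \<partial>law k (?Y \<omega>)) \<partial>P)"
      by (intro pr_integral_cong[OF Ppr] pr_integral_distr[OF law_pr] bfun_meas[OF g] measurable_Pair1')
         (auto intro: measurable_space[OF Y])
    finally show ?thesis .
  qed
  have "?\<nu>1 = ?\<nu>2"
  proof (rule measure_eqI_generator_eq[OF Int_stable_pair_measure_generator[of H E]])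
    show "{a \<times> b |a b. a \<in> sets H \<and> b \<in> sets E} \<subseteq> Pow (space H \<times> space E)"
      using sets.space_closed[of H] sets.space_closed[of E] by blast
    show "sets ?\<nu>1 = sigma_sets (space H \<times> space E) {a \<times> b |a b. a \<in> sets H \<and> b \<in> sets E}"
      "sets ?\<nu>2 = sigma_sets (space H \<times> space E) {a \<times> b |a b. a \<in> sets H \<and> b \<in> sets E}"
      using prD(2)[OF n1] prD(2)[OF n2] by (simp_all only: sets_pair_measure)
    show "range (\<lambda>i::nat. space H \<times> space E) \<subseteq> {a \<times> b |a b. a \<in> sets H \<and> b \<in> sets E}" by auto
    show "(\<Union>i::nat. space H \<times> space E) = space H \<times> space E" by simp
    interpret N1: prob_space ?\<nu>1 by (rule prD(1)[OF n1])
    interpret N2: prob_space ?\<nu>2 by (rule prD(1)[OF n2])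
    show "emeasure ?\<nu>1 (space H \<times> space E) \<noteq> \<infinity>" for i :: nat by (simp add: N1.emeasure_eq_measure)
    fix R' assume "R' \<in> {a \<times> b |a b. a \<in> sets H \<and> b \<in> sets E}"
    then obtain B A where R': "R' = B \<times> A" and B: "B \<in> sets H" and A: "A \<in> sets E" by auto
    have RS: "B \<times> A \<in> sets (H \<Otimes>\<^sub>M E)" using A B by simp
    have ib: "(indicator (B \<times> A) :: _ \<Rightarrow> real) \<in> bfun (H \<Otimes>\<^sub>M E)" by (rule bfun_indicator[OF RS])
    have "measure ?\<nu>1 (B \<times> A) = integral\<^sup>L ?\<nu>1 (indicator (B \<times> A))"
      using RS prD(2)[OF n1] by simp
    also have "\<dots> = (\<integral>\<omega>. indicator (B \<times> A) (?Y \<omega>, ?J \<omega>) \<partial>P)"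
      by (rule pr_integral_distr[OF Ppr YJ bfun_meas[OF ib]])
    also have "\<dots> = (\<integral>\<omega>. indicator (?Y -` B \<inter> space P) \<omega> * indicator (?J -` A \<inter> space P) \<omega> \<partial>P)"
      by (rule pr_integral_cong[OF Ppr]) (auto simp: indicator_def)
    also have "\<dots> = (\<integral>\<omega>. indicator (?Y -` B \<inter> space P) \<omega> * measure (\<kappa> \<omega>) A \<partial>P)"
    proof (rule cond_law_integral[OF P sub cond J _ A])
      show "?Y -` B \<inter> space P \<in> sets ?F"
        using measurable_sets[OF YF B] sub by (simp add: subalgebra_def)
      have "(\<lambda>\<omega>. measure (law k (?Y \<omega>)) A) \<in> borel_measurable P"
        by (rule measurable_compose[OF measurable_compose[OF Y law_kernel] measurable_measure_prob_algebra[OF A]])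
      then show "(\<lambda>\<omega>. measure (\<kappa> \<omega>) A) \<in> borel_measurable P"
        using \<kappa> by (simp cong: measurable_cong)
    qed
    also have "\<dots> = (\<integral>\<omega>. (\<integral>y. indicator (B \<times> A) (?Y \<omega>, y) \<partial>law k (?Y \<omega>)) \<partial>P)"
    proof (rule pr_integral_cong[OF Ppr])
      fix \<omega> assume w: "\<omega> \<in> space P"
      have Yw: "?Y \<omega> \<in> space H" by (rule measurable_space[OF Y w])
      have As: "A \<in> sets (law k (?Y \<omega>))" using A prD(2)[OF law_pr[OF Yw]] by simp
      have "(\<integral>y. (indicator (B \<times> A) (?Y \<omega>, y) :: real) \<partial>law k (?Y \<omega>))
          = (\<integral>y. indicator B (?Y \<omega>) * indicator A y \<partial>law k (?Y \<omega>))"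
        by (intro Bochner_Integration.integral_cong refl) (auto simp: indicator_def)
      also have "\<dots> = indicator B (?Y \<omega>) * measure (law k (?Y \<omega>)) A" using As by simp
      finally show "indicator (?Y -` B \<inter> space P) \<omega> * measure (\<kappa> \<omega>) A
          = (\<integral>y. indicator (B \<times> A) (?Y \<omega>, y) \<partial>law k (?Y \<omega>))"
        using w \<kappa>[OF w] by (simp add: indicator_def)
    qed
    also have "\<dots> = integral\<^sup>L ?\<nu>2 (indicator (B \<times> A))" by (rule int2[OF ib, symmetric])
    also have "\<dots> = measure ?\<nu>2 (B \<times> A)" using RS prD(2)[OF n2] by simp
    finally show "emeasure ?\<nu>1 R' = emeasure ?\<nu>2 R'"
      unfolding R' by (simp add: N1.emeasure_eq_measure N2.emeasure_eq_measure)
  qed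
  moreover have G: "(\<lambda>q. F (upd m (Suc k) (fst q) (snd q))) \<in> bfun (H \<Otimes>\<^sub>M E)"
    using bfun_compose[OF F upd_measurable[of m "Suc k" S]] by (simp add: split_def)
  ultimately have "integral\<^sup>L ?\<nu>1 (\<lambda>q. F (upd m (Suc k) (fst q) (snd q)))
      = (\<integral>\<omega>. (\<integral>y. F (upd m (Suc k) (?Y \<omega>) y) \<partial>law k (?Y \<omega>)) \<partial>P)"
    using int2[OF G] by simp
  moreover have "integral\<^sup>L ?\<nu>1 (\<lambda>q. F (upd m (Suc k) (fst q) (snd q))) = (\<integral>\<omega>. F (stopped z X (Suc k) \<omega>) \<partial>P)"
    using pr_integral_distr[OF Ppr YJ bfun_meas[OF G]] by (simp add: stopped_Suc)
  moreover have "(\<integral>\<omega>. (\<integral>y. F (upd m (Suc k) (?Y \<omega>) y) \<partial>law k (?Y \<omega>)) \<partial>P) = (\<integral>\<omega>. integral\<^sup>L (step k (?Y \<omega>)) F \<partial>P)"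
    by (rule pr_integral_cong[OF Ppr]) (rule step_integral[OF measurable_space[OF Y] F, symmetric])
  ultimately show ?thesis by simp
qed

lemma process_run:
  fixes P :: "'w measure"
  assumes P: "prob_space P" and X: "\<And>l p. l \<le> m \<Longrightarrow> X l p \<in> P \<rightarrow>\<^sub>M S l"
    and z: "\<And>l. l \<le> m \<Longrightarrow> z l \<in> space (S l)"
    and cond: "\<And>k. cond_law P (generated_by P S X ({..m} \<times> {..k})) E (joint X m (Suc k)) (\<kappa> k)"
    and \<kappa>: "\<And>k \<omega>. \<omega> \<in> space P \<Longrightarrow> \<kappa> k \<omega> = law k (stopped z X k \<omega>)"
    and F: "F \<in> bfun H"
  shows "(\<integral>\<omega>. F (stopped z X n \<omega>) \<partial>P) = (\<integral>\<omega>. integral\<^sup>L (run n 0 (stopped z X 0 \<omega>)) F \<partial>P)"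
  using F
proof (induction n arbitrary: F)
  case 0
  have Ppr: "P \<in> pr P" using P by (simp add: prI)
  show ?case
    by (rule pr_integral_cong[OF Ppr])
       (rule run_0_integral[OF measurable_space[OF stopped_measurable[OF z X]] 0, symmetric])
next
  case (Suc n)
  have Ppr: "P \<in> pr P" using P by (simp add: prI)
  note step_b = bfun_kernel_integral1[OF step_kernel[of n] Suc(2)]
  have "(\<integral>\<omega>. F (stopped z X (Suc n) \<omega>) \<partial>P) = (\<integral>\<omega>. integral\<^sup>L (step n (stopped z X n \<omega>)) F \<partial>P)"
    by (rule process_step[OF P X z cond \<kappa> Suc(2)])
  also have "\<dots> = (\<integral>\<omega>. (\<integral>h. integral\<^sup>L (step n h) F \<partial>run n 0 (stopped z X 0 \<omega>)) \<partial>P)"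
    by (rule Suc(1)[OF step_b])
  also have "\<dots> = (\<integral>\<omega>. integral\<^sup>L (run (Suc n) 0 (stopped z X 0 \<omega>)) F \<partial>P)"
  proof (rule pr_integral_cong[OF Ppr])
    fix \<omega> assume w: "\<omega> \<in> space P"
    have h: "stopped z X 0 \<omega> \<in> space H" by (rule measurable_space[OF stopped_measurable[OF z X] w])
    have "integral\<^sup>L (run (Suc n) 0 (stopped z X 0 \<omega>)) F
        = (\<integral>h'. integral\<^sup>L (run 1 n h') F \<partial>run n 0 (stopped z X 0 \<omega>))"
      using run_add[OF h Suc(2), of n 1 0] by simp
    also have "\<dots> = (\<integral>h'. integral\<^sup>L (step n h') F \<partial>run n 0 (stopped z X 0 \<omega>))"
    proof (rule pr_integral_cong[OF run_pr[OF h]])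
      fix h' assume h': "h' \<in> space H"
      have "integral\<^sup>L (run (Suc 0) n h') F = (\<integral>h''. integral\<^sup>L (run 0 (Suc n) h'') F \<partial>step n h')"
        by (rule run_Suc_integral[OF h' Suc(2)])
      also have "\<dots> = integral\<^sup>L (step n h') F"
        by (rule pr_integral_cong[OF step_pr[OF h']]) (rule run_0_integral[OF _ Suc(2)])
      finally show "integral\<^sup>L (run 1 n h') F = integral\<^sup>L (step n h') F" by simp
    qed
    finally show "(\<integral>h. integral\<^sup>L (step n h) F \<partial>run n 0 (stopped z X 0 \<omega>))
        = integral\<^sup>L (run (Suc n) 0 (stopped z X 0 \<omega>)) F" by (rule sym)
  qed
  finally show ?case .
qed

end

context invariant_chains begin

text \<open>
  The tail bound holds for every starting point, and it is integrated over the initial values.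
\<close>

lemma process_tail:
  fixes P :: "'w measure"
  assumes P: "prob_space P" and X: "\<And>l p. l \<le> m \<Longrightarrow> X l p \<in> P \<rightarrow>\<^sub>M S l"
    and z: "\<And>l. l \<le> m \<Longrightarrow> z l \<in> space (S l)"
    and cond: "\<And>k. cond_law P (generated_by P S X ({..m} \<times> {..k})) E (joint X m (Suc k)) (\<kappa> k)"
    and \<kappa>: "\<And>k \<omega>. \<omega> \<in> space P \<Longrightarrow> \<kappa> k \<omega> = law k (stopped z X k \<omega>)"
    and \<epsilon>: "0 < \<epsilon>"
  shows "\<exists>N. \<forall>n\<ge>N. \<forall>f\<in>test. \<forall>t\<ge>\<epsilon>.
    measure P {\<omega> \<in> space P. t < \<bar>(\<Sum>p\<le>n. f (joint X m p \<omega>)) / real (Suc n) - integral\<^sup>L \<pi>m f\<bar>}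
      \<le> 2 * exp (- ((t - \<epsilon>)\<^sup>2 * real (Suc n) / (8 * vconst)))"
proof -
  have Ppr: "P \<in> pr P" using P by (simp add: prI)
  obtain N where N: "\<And>n f h t. n \<ge> N \<Longrightarrow> f \<in> test \<Longrightarrow> h \<in> space H \<Longrightarrow> \<epsilon> \<le> t \<Longrightarrow>
    measure (run n 0 h) {h' \<in> space H. t < \<bar>emp f n h' - integral\<^sup>L \<pi>m f\<bar>}
      \<le> 2 * exp (- ((t - \<epsilon>)\<^sup>2 * real (Suc n) / (8 * vconst)))"
    using emp_tail[OF \<epsilon>] by blast
  show ?thesis
  proof (intro exI[of _ N] allI impI ballI)
    fix n f t assume n: "N \<le> n" and f: "f \<in> test" and t: "\<epsilon> \<le> t"
    let ?x = "integral\<^sup>L \<pi>m f"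
    let ?D = "{h' \<in> space H. t < \<bar>emp f n h' - ?x\<bar>}"
    let ?A = "{\<omega> \<in> space P. t < \<bar>(\<Sum>p\<le>n. f (joint X m p \<omega>)) / real (Suc n) - ?x\<bar>}"
    have Y: "stopped z X k \<in> P \<rightarrow>\<^sub>M H" for k by (rule stopped_measurable[OF z X])
    have D: "?D \<in> sets H" using bfun_meas[OF emp_bfun[OF testD(1)[OF f]]] by measurable
    have "block p (stopped z X n \<omega>) = joint X m p \<omega>" if "p \<le> n" for p \<omega>
      using that by (auto simp: block_def stopped_def joint_def fun_eq_iff)
    then have e: "emp f n (stopped z X n \<omega>) = (\<Sum>p\<le>n. f (joint X m p \<omega>)) / real (Suc n)" for \<omega>
      by (simp add: emp_def)
    have A: "?A = stopped z X n -` ?D \<inter> space P"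
      using measurable_space[OF Y] by (auto simp: e)
    have AP: "?A \<in> sets P" unfolding A by (rule measurable_sets[OF Y D])
    have "measure P ?A = (\<integral>\<omega>. indicator ?A \<omega> \<partial>P)" using AP by simp
    also have "\<dots> = (\<integral>\<omega>. indicator ?D (stopped z X n \<omega>) \<partial>P)"
      unfolding A by (rule pr_integral_cong[OF Ppr]) (auto simp: indicator_def)
    also have "\<dots> = (\<integral>\<omega>. integral\<^sup>L (run n 0 (stopped z X 0 \<omega>)) (indicator ?D) \<partial>P)"
      by (rule process_run[OF P X z cond \<kappa> bfun_indicator[OF D]])
    also have "\<dots> \<le> 2 * exp (- ((t - \<epsilon>)\<^sup>2 * real (Suc n) / (8 * vconst)))"
    proof (rule integral_bounds(1)[OF Ppr])
      show "(\<lambda>\<omega>. integral\<^sup>L (run n 0 (stopped z X 0 \<omega>)) (indicator ?D)) \<in> bfun P"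
        by (rule bfun_compose[OF run_bfun[OF bfun_indicator[OF D]] Y])
      fix \<omega> assume w: "\<omega> \<in> space P"
      have h: "stopped z X 0 \<omega> \<in> space H" by (rule measurable_space[OF Y w])
      have "integral\<^sup>L (run n 0 (stopped z X 0 \<omega>)) (indicator ?D) = measure (run n 0 (stopped z X 0 \<omega>)) ?D"
        using D prD(2)[OF run_pr[OF h]] by simp
      also have "\<dots> \<le> 2 * exp (- ((t - \<epsilon>)\<^sup>2 * real (Suc n) / (8 * vconst)))" by (rule N[OF n f h t])
      finally show "integral\<^sup>L (run n 0 (stopped z X 0 \<omega>)) (indicator ?D) \<le> 2 * exp (- ((t - \<epsilon>)\<^sup>2 * real (Suc n) / (8 * vconst)))" .
    qed
    finally show "measure P ?A \<le> 2 * exp (- ((t - \<epsilon>)\<^sup>2 * real (Suc n) / (8 * vconst)))" .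
  qed
qed

end

section \<open>The norms and coefficients of the hypotheses\<close>

lemma bfun_restrict_bmeas:
  assumes "f \<in> bfun A" shows "restrict f (space A) \<in> bmeas A"
proof -
  obtain B where B: "\<And>x. x \<in> space A \<Longrightarrow> \<bar>f x\<bar> \<le> B" using bfunE[OF assms] by metis
  have "restrict f (space A) \<in> borel_measurable A"
    using bfun_meas[OF assms] by (simp cong: measurable_cong)
  moreover have "bounded (restrict f (space A) ` space A)"
    unfolding bounded_iff by (rule exI[of _ B]) (use B in auto)
  ultimately show ?thesis by (simp add: bmeas_def)
qed

lemma bmeas_bfun: assumes "f \<in> bmeas A" shows "f \<in> bfun A"
proof -
  obtain B where "\<forall>y\<in>f ` space A. norm y \<le> B" using assms unfolding bmeas_def bounded_iff by auto
  then show ?thesis using assms by (intro bfunI[where B=B]) (auto simp: bmeas_def)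
qed

lemma bdd_above_abs_image: assumes "f \<in> bfun A" shows "bdd_above ((\<lambda>x. \<bar>f x\<bar>) ` space A)"
proof -
  obtain B where "\<And>x. x \<in> space A \<Longrightarrow> \<bar>f x\<bar> \<le> B" using bfunE[OF assms] by metis
  then show ?thesis by (rule bdd_aboveI2)
qed

lemma abs_le_sup_norm: "f \<in> bfun A \<Longrightarrow> x \<in> space A \<Longrightarrow> \<bar>f x\<bar> \<le> sup_norm A f"
  unfolding sup_norm_def by (rule cSUP_upper[OF _ bdd_above_abs_image])

lemma sup_norm_le: "space A \<noteq> {} \<Longrightarrow> (\<And>x. x \<in> space A \<Longrightarrow> \<bar>f x\<bar> \<le> b) \<Longrightarrow> sup_norm A f \<le> b"
  unfolding sup_norm_def by (rule cSUP_least)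

lemma sup_norm_nonneg: "f \<in> bfun A \<Longrightarrow> space A \<noteq> {} \<Longrightarrow> 0 \<le> sup_norm A f"
  using abs_le_sup_norm abs_ge_zero order_trans by (metis all_not_in_conv)

lemma bmeas1_bfun:
  assumes "f \<in> bmeas1 A"
  shows "f \<in> bfun A" and "x \<in> space A \<Longrightarrow> \<bar>f x\<bar> \<le> 1"
  using assms bmeas_bfun[of f A] abs_le_sup_norm[of f A x] by (auto simp: bmeas1_def)

lemma restrict_bmeas1:
  assumes "space A \<noteq> {}" "f \<in> bfun A" "\<And>x. x \<in> space A \<Longrightarrow> \<bar>f x\<bar> \<le> 1"
  shows "restrict f (space A) \<in> bmeas1 A"
  using bfun_restrict_bmeas[OF assms(2)] sup_norm_le[OF assms(1), of "restrict f (space A)" 1] assms(3)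
  by (simp add: bmeas1_def)

lemma zero_bmeas1: "space A \<noteq> {} \<Longrightarrow> restrict (\<lambda>x. 0) (space A) \<in> bmeas1 A"
  by (rule restrict_bmeas1) (auto intro: bfun_const)

lemma integral_restrict: "\<mu> \<in> pr A \<Longrightarrow> integral\<^sup>L \<mu> (restrict f (space A)) = integral\<^sup>L \<mu> f"
  by (rule pr_integral_cong) auto

lemma meas_dist_bounds:
  assumes ne: "space A \<noteq> {}"
    and d: "\<And>f. f \<in> bfun A \<Longrightarrow> (\<And>x. x \<in> space A \<Longrightarrow> \<bar>f x\<bar> \<le> 1) \<Longrightarrow> \<bar>integral\<^sup>L \<mu> f - integral\<^sup>L \<nu> f\<bar> \<le> d"
  shows "meas_dist A \<mu> \<nu> \<le> d" and "0 \<le> meas_dist A \<mu> \<nu>"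
proof -
  have *: "\<bar>integral\<^sup>L \<mu> f - integral\<^sup>L \<nu> f\<bar> \<le> d" if "f \<in> bmeas1 A" for f
    by (rule d[OF bmeas1_bfun[OF that]])
  have ne1: "bmeas1 A \<noteq> {}" using zero_bmeas1[OF ne] by blast
  then show "meas_dist A \<mu> \<nu> \<le> d"
    unfolding meas_dist_def by (rule cSUP_least[OF _ *])
  have "bdd_above ((\<lambda>f. \<bar>integral\<^sup>L \<mu> f - integral\<^sup>L \<nu> f\<bar>) ` bmeas1 A)"
    by (rule bdd_aboveI2[OF *])
  from cSUP_upper[OF zero_bmeas1[OF ne] this]
  show "0 \<le> meas_dist A \<mu> \<nu>" unfolding meas_dist_def by (rule order_trans[OF abs_ge_zero])
qed

lemma kernel_op_eq: "x \<in> space A \<Longrightarrow> kernel_op A K f x = integral\<^sup>L (K x) f"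
  by (simp add: kernel_op_def)

lemma kernel_op_bfun: assumes "K \<in> A \<rightarrow>\<^sub>M prob_algebra A" "f \<in> bfun A" shows "kernel_op A K f \<in> bfun A"
  unfolding kernel_op_def by (rule bmeas_bfun[OF bfun_restrict_bmeas[OF bfun_kernel_integral1[OF assms]]])

lemma op_dist_upper:
  assumes K: "K \<in> A \<rightarrow>\<^sub>M prob_algebra A" and L: "L \<in> A \<rightarrow>\<^sub>M prob_algebra A"
    and f: "f \<in> bfun A" "\<And>x. x \<in> space A \<Longrightarrow> \<bar>f x\<bar> \<le> 1" and x: "x \<in> space A"
  shows "\<bar>integral\<^sup>L (K x) f - integral\<^sup>L (L x) f\<bar> \<le> op_dist A K L"
proof -
  have ne: "space A \<noteq> {}" using x by auto
  let ?s = "\<lambda>f. sup_norm A (\<lambda>x. kernel_op A K f x - kernel_op A L f x)"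
  have db: "(\<lambda>x. kernel_op A K f x - kernel_op A L f x) \<in> bfun A" if "f \<in> bfun A" for f
    by (intro bfun_diff kernel_op_bfun K L that)
  have "?s f \<le> 2" if "f \<in> bmeas1 A" for f
  proof (rule sup_norm_le[OF ne])
    fix x assume x: "x \<in> space A"
    have "osc_le (space A) f (2 * 1)" by (rule osc_from_bound) (rule bmeas1_bfun(2)[OF that])
    from integral_osc(1)[OF kernel_pr[OF K x] kernel_pr[OF L x] bmeas1_bfun(1)[OF that] this]
    show "\<bar>kernel_op A K f x - kernel_op A L f x\<bar> \<le> 2" using x by (simp add: kernel_op_eq)
  qed
  then have bdd: "bdd_above (?s ` bmeas1 A)" by (rule bdd_aboveI2)
  let ?f = "restrict f (space A)"
  have fr: "?f \<in> bmeas1 A" by (rule restrict_bmeas1[OF ne f])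
  have "\<bar>integral\<^sup>L (K x) f - integral\<^sup>L (L x) f\<bar> = \<bar>kernel_op A K ?f x - kernel_op A L ?f x\<bar>"
    unfolding kernel_op_eq[OF x] integral_restrict[OF kernel_pr[OF K x]] integral_restrict[OF kernel_pr[OF L x]] ..
  also have "\<dots> \<le> ?s ?f" by (rule abs_le_sup_norm[OF db[OF bmeas1_bfun(1)[OF fr]] x])
  also have "\<dots> \<le> op_dist A K L" unfolding op_dist_def by (rule cSUP_upper[OF fr bdd])
  finally show ?thesis .
qed

text \<open>
  A difference of two Markov kernels does not see constants, so the oscillation can take the place of the norm.
\<close>

lemma op_dist_osc:
  assumes K: "K \<in> A \<rightarrow>\<^sub>M prob_algebra A" and L: "L \<in> A \<rightarrow>\<^sub>M prob_algebra A"
    and f: "f \<in> bfun A" "osc_le (space A) f a" and x: "x \<in> space A"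
  shows "\<bar>integral\<^sup>L (K x) f - integral\<^sup>L (L x) f\<bar> \<le> op_dist A K L * a"
proof -
  have a: "0 \<le> a" using osc_leD[OF f(2) x x] by simp
  show ?thesis
  proof (cases "a = 0")
    case True
    then show ?thesis
      using integral_osc(1)[OF kernel_pr[OF K x] kernel_pr[OF L x] f] by simp
  next
    case False
    then have a: "0 < a" using a by simp
    define g where "g y = (f y - f x) * (1 / a)" for y
    have gb: "g \<in> bfun A" unfolding g_def[abs_def] by (intro bfun_mult bfun_diff bfun_const f)
    have g1: "\<bar>g y\<bar> \<le> 1" if "y \<in> space A" for y
      using osc_leD[OF f(2) that x] a by (simp add: g_def abs_mult)
    have e: "integral\<^sup>L \<mu> g = (integral\<^sup>L \<mu> f - f x) / a" if "\<mu> \<in> pr A" for \<mu>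
      unfolding g_def integral_mult_left_zero pr_integral_diff[OF that f(1) bfun_const] pr_integral_const[OF that] by simp
    have "\<bar>integral\<^sup>L (K x) g - integral\<^sup>L (L x) g\<bar> \<le> op_dist A K L"
      by (rule op_dist_upper[OF K L gb g1 x])
    then have "\<bar>integral\<^sup>L (K x) f - integral\<^sup>L (L x) f\<bar> / a \<le> op_dist A K L"
      unfolding e[OF kernel_pr[OF K x]] e[OF kernel_pr[OF L x]] using a
      by (simp add: abs_divide flip: diff_divide_distrib)
    then show ?thesis using a by (simp add: pos_divide_le_eq)
  qed
qed

lemma osc_le_iff:
  assumes ne: "space A \<noteq> {}" and f: "f \<in> bfun A"
  shows "osc A f \<le> a \<longleftrightarrow> osc_le (space A) f a"
proof -
  obtain B where B: "\<And>x. x \<in> space A \<Longrightarrow> \<bar>f x\<bar> \<le> B" using bfunE[OF f] by metis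
  have o: "osc_le (space A) f (2 * B)" by (rule osc_from_bound[OF B])
  have bdd: "bdd_above ((\<lambda>(x, y). \<bar>f x - f y\<bar>) ` (space A \<times> space A))"
    by (rule bdd_aboveI2[where M="2 * B"]) (use o in \<open>auto simp: osc_le_def\<close>)
  show ?thesis
  proof
    assume l: "osc A f \<le> a"
    show "osc_le (space A) f a"
    proof (rule osc_leI)
      fix x y assume "x \<in> space A" "y \<in> space A"
      then have "\<bar>f x - f y\<bar> \<le> osc A f"
        unfolding osc_def using cSUP_upper[OF _ bdd, of "(x, y)"] by simp
      with l show "\<bar>f x - f y\<bar> \<le> a" by simp
    qed
  next
    assume "osc_le (space A) f a"
    then show "osc A f \<le> a"
      unfolding osc_def using ne by (intro cSUP_least) (auto simp: osc_le_def)
  qed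
qed

lemma dobrushin_contract:
  assumes K: "K \<in> A \<rightarrow>\<^sub>M prob_algebra A" and f: "f \<in> bfun A" "osc_le (space A) f a"
  shows "osc_le (space A) (\<lambda>x. integral\<^sup>L (K x) f) (dobrushin A K * a)"
    and "space A \<noteq> {} \<Longrightarrow> dobrushin A K \<le> 1"
proof -
  have Osc: "f \<in> bfun A" "osc_le (space A) f 1" if "space A \<noteq> {}" "f \<in> Osc1 A" for f
    using that bmeas_bfun osc_le_iff[OF that(1) bmeas_bfun] by (auto simp: Osc1_def)
  have le1: "osc A (kernel_op A K f) \<le> 1" if "space A \<noteq> {}" "f \<in> Osc1 A" for f
    unfolding osc_le_iff[OF that(1) kernel_op_bfun[OF K Osc(1)[OF that]]]
    using kernel_osc_le[OF K Osc[OF that]] by (simp add: osc_le_def kernel_op_eq)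
  have bdd: "bdd_above ((\<lambda>f. osc A (kernel_op A K f)) ` Osc1 A)" if "space A \<noteq> {}"
    by (rule bdd_aboveI2[OF le1[OF that]])
  have zero: "restrict (\<lambda>x. 0) (space A) \<in> Osc1 A" if "space A \<noteq> {}"
    using bfun_restrict_bmeas[OF bfun_const[of 0 A]] osc_le_iff[OF that bmeas_bfun[OF bfun_restrict_bmeas[OF bfun_const[of 0 A]]]]
    by (simp add: Osc1_def osc_le_def)
  show "dobrushin A K \<le> 1" if ne: "space A \<noteq> {}"
    unfolding dobrushin_def by (rule cSUP_least[OF _ le1[OF ne]]) (use zero[OF ne] in auto)
  show "osc_le (space A) (\<lambda>x. integral\<^sup>L (K x) f) (dobrushin A K * a)"
  proof (cases "space A = {}")
    case True then show ?thesis by (simp add: osc_le_def)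
  next
    case ne: False
    then obtain x where x: "x \<in> space A" by auto
    have a: "0 \<le> a" using osc_leD[OF f(2) x x] by simp
    show ?thesis
    proof (cases "a = 0")
      case True
      then show ?thesis using kernel_osc_le[OF K f] by simp
    next
      case False
      then have a: "0 < a" using a by simp
      define g where "g y = f y * (1 / a)" for y
      have gb: "g \<in> bfun A" unfolding g_def[abs_def] by (intro bfun_mult bfun_const f)
      let ?g = "restrict g (space A)"
      have "osc_le (space A) ?g 1"
      proof (rule osc_leI)
        fix x y assume "x \<in> space A" "y \<in> space A"
        then show "\<bar>?g x - ?g y\<bar> \<le> 1"
          using osc_leD[OF f(2), of x y] a by (simp add: g_def abs_divide flip: diff_divide_distrib)
      qed
      then have gO: "?g \<in> Osc1 A"
        using bfun_restrict_bmeas[OF gb] osc_le_iff[OF ne bmeas_bfun[OF bfun_restrict_bmeas[OF gb]]] by (simp add: Osc1_def)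
      have "osc A (kernel_op A K ?g) \<le> dobrushin A K"
        unfolding dobrushin_def by (rule cSUP_upper[OF gO bdd[OF ne]])
      then have o: "osc_le (space A) (kernel_op A K ?g) (dobrushin A K)"
        unfolding osc_le_iff[OF ne kernel_op_bfun[OF K Osc(1)[OF ne gO]]] .
      have e: "kernel_op A K ?g x = integral\<^sup>L (K x) f / a" if "x \<in> space A" for x
        unfolding kernel_op_eq[OF that] integral_restrict[OF kernel_pr[OF K that]] g_def by simp
      show ?thesis
      proof (rule osc_leI)
        fix x y assume xy: "x \<in> space A" "y \<in> space A"
        have "\<bar>integral\<^sup>L (K x) f - integral\<^sup>L (K y) f\<bar> / a \<le> dobrushin A K"
          using osc_leD[OF o xy] a unfolding e[OF xy(1)] e[OF xy(2)] by (simp add: abs_divide flip: diff_divide_distrib)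
        then show "\<bar>integral\<^sup>L (K x) f - integral\<^sup>L (K y) f\<bar> \<le> dobrushin A K * a"
          using a by (simp add: pos_divide_le_eq)
      qed
    qed
  qed
qed

subsection \<open>Empirical measures\<close>

lemma empirical_pr:
  assumes "\<And>p. p \<le> n \<Longrightarrow> u p \<in> space A" shows "empirical A n u \<in> pr A"
proof -
  have m: "u \<in> uniform_count_measure {..n} \<rightarrow>\<^sub>M A"
    using assms by (auto simp: measurable_def space_uniform_count_measure sets_uniform_count_measure)
  interpret prob_space "uniform_count_measure {..n}" by (rule prob_space_uniform_count_measure) auto
  show ?thesis unfolding empirical_def by (rule prI[OF prob_space_distr[OF m]]) simp
qed

lemma empirical_integral:
  fixes f :: "'a \<Rightarrow> real"
  assumes "\<And>p. p \<le> n \<Longrightarrow> u p \<in> space A" and f: "f \<in> borel_measurable A"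
  shows "integral\<^sup>L (empirical A n u) f = (\<Sum>p\<le>n. f (u p)) / real (Suc n)"
proof -
  have m: "u \<in> uniform_count_measure {..n} \<rightarrow>\<^sub>M A"
    using assms by (auto simp: measurable_def space_uniform_count_measure sets_uniform_count_measure)
  show ?thesis unfolding empirical_def integral_distr[OF m f] by (simp add: integral_uniform_count_measure)
qed

lemma empirical_cong: "(\<And>p. p \<le> n \<Longrightarrow> u p = v p) \<Longrightarrow> empirical A n u = empirical A n v"
  unfolding empirical_def by (rule distr_cong) (auto simp: space_uniform_count_measure)

lemma empirical_coord:
  assumes u: "\<And>p. p \<le> n \<Longrightarrow> u p \<in> space A" and v: "\<And>p. p \<le> n \<Longrightarrow> v p \<in> space A"
    and eq: "\<And>p. p \<noteq> j \<Longrightarrow> u p = v p"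
    and f: "f \<in> bfun A" "\<And>x. x \<in> space A \<Longrightarrow> \<bar>f x\<bar> \<le> b" and b: "0 \<le> b"
  shows "\<bar>integral\<^sup>L (empirical A n u) f - integral\<^sup>L (empirical A n v) f\<bar> \<le> 2 * b / real (Suc n)"
proof -
  have "(\<Sum>p\<le>n. f (u p)) - (\<Sum>p\<le>n. f (v p)) = (\<Sum>p\<le>n. f (u p) - f (v p))"
    by (rule sum_subtractf[symmetric])
  also have "\<dots> = (\<Sum>p\<in>{..n} \<inter> {j}. f (u p) - f (v p))"
    by (rule sum.mono_neutral_right) (use eq in auto)
  finally have e: "(\<Sum>p\<le>n. f (u p)) - (\<Sum>p\<le>n. f (v p)) = (\<Sum>p\<in>{..n} \<inter> {j}. f (u p) - f (v p))" .
  have "\<bar>(\<Sum>p\<le>n. f (u p)) - (\<Sum>p\<le>n. f (v p))\<bar> \<le> 2 * b"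
  proof (cases "j \<le> n")
    case True
    have "\<bar>f (u j) - f (v j)\<bar> \<le> 2 * b" using f(2)[OF u[OF True]] f(2)[OF v[OF True]] by linarith
    then show ?thesis unfolding e using True by simp
  next
    case False then show ?thesis unfolding e using b by simp
  qed
  moreover have "integral\<^sup>L (empirical A n u) f = (\<Sum>p\<le>n. f (u p)) / real (Suc n)"
    "integral\<^sup>L (empirical A n v) f = (\<Sum>p\<le>n. f (v p)) / real (Suc n)"
    by (rule empirical_integral[OF _ bfun_meas[OF f(1)]], erule u v)+
  ultimately show ?thesis
    by (simp add: divide_right_mono flip: diff_divide_distrib)
qed

lemma empirical_Suc:
  assumes u: "\<And>p. p \<le> Suc n \<Longrightarrow> u p \<in> space A"
    and f: "f \<in> bfun A" "\<And>x. x \<in> space A \<Longrightarrow> \<bar>f x\<bar> \<le> b" and b: "0 \<le> b"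
  shows "\<bar>integral\<^sup>L (empirical A (Suc n) u) f - integral\<^sup>L (empirical A n u) f\<bar> \<le> 2 * b / real (Suc n)"
proof -
  have u': "u p \<in> space A" if "p \<le> n" for p using u that by simp
  let ?e = "integral\<^sup>L (empirical A n u) f"
  have e: "(\<Sum>p\<le>n. f (u p)) = real (Suc n) * ?e"
    using empirical_integral[OF u' bfun_meas[OF f(1)], of n] by simp
  have "integral\<^sup>L (empirical A (Suc n) u) f = (real (Suc n) * ?e + f (u (Suc n))) / real (Suc (Suc n))"
    using empirical_integral[OF u bfun_meas[OF f(1)], of "Suc n"] e by simp
  moreover have "(real (Suc n) * x + y) / real (Suc (Suc n)) - x = (y - x) / real (Suc (Suc n))" for x y :: real
    by (simp add: field_simps)
  ultimately have "integral\<^sup>L (empirical A (Suc n) u) f - ?e = (f (u (Suc n)) - ?e) / real (Suc (Suc n))" by simp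
  moreover have "\<bar>f (u (Suc n)) - ?e\<bar> \<le> 2 * b"
    using f(2)[OF u[OF order_refl]] integral_bounds(3)[OF empirical_pr[OF u'] f(1) f(2)] by fastforce
  ultimately have "\<bar>integral\<^sup>L (empirical A (Suc n) u) f - ?e\<bar> \<le> 2 * b / real (Suc (Suc n))"
    by (simp add: abs_divide divide_right_mono)
  also have "\<dots> \<le> 2 * b / real (Suc n)" using b by (intro divide_left_mono) auto
  finally show ?thesis .
qed

subsection \<open>Kernels with finite support\<close>

lemma Metric_space_bmeas:
  assumes ne: "space A \<noteq> {}" shows "Metric_space (bmeas A) (bmeas_dist A)"
proof
  have d: "(\<lambda>x. f x - g x) \<in> bfun A" if "f \<in> bmeas A" "g \<in> bmeas A" for f g
    using that by (intro bfun_diff bmeas_bfun)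
  show "0 \<le> bmeas_dist A f g" for f g
    using sup_norm_nonneg[OF d ne] by (simp add: bmeas_dist_def)
  show "bmeas_dist A f g = bmeas_dist A g f" for f g
    by (simp add: bmeas_dist_def sup_norm_def abs_minus_commute)
  show "bmeas_dist A f g = 0 \<longleftrightarrow> f = g" if fg: "f \<in> bmeas A" "g \<in> bmeas A" for f g
  proof
    assume "bmeas_dist A f g = 0"
    then have "f x = g x" if "x \<in> space A" for x
      using abs_le_sup_norm[OF d[OF fg] that] fg by (simp add: bmeas_dist_def)
    then show "f = g" using fg by (intro extensionalityI[of f "space A" g]) (auto simp: bmeas_def)
  next
    assume "f = g"
    then show "bmeas_dist A f g = 0" using fg ne by (simp add: bmeas_dist_def sup_norm_def)
  qed
  show "bmeas_dist A f k \<le> bmeas_dist A f g + bmeas_dist A g k"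
    if "f \<in> bmeas A" "g \<in> bmeas A" "k \<in> bmeas A" for f g k
  proof -
    have "sup_norm A (\<lambda>x. f x - k x) \<le> sup_norm A (\<lambda>x. f x - g x) + sup_norm A (\<lambda>x. g x - k x)"
    proof (rule sup_norm_le[OF ne])
      fix x assume x: "x \<in> space A"
      show "\<bar>f x - k x\<bar> \<le> sup_norm A (\<lambda>x. f x - g x) + sup_norm A (\<lambda>x. g x - k x)"
        using abs_le_sup_norm[OF d[OF that(1,2)] x] abs_le_sup_norm[OF d[OF that(2,3)] x] by linarith
    qed
    then show ?thesis using that by (simp add: bmeas_dist_def)
  qed
qed

text \<open>
  Points are closed in the metrizable space of bounded functions, so a measure that is carried by
  a finite set integrates every function, measurable or not.
\<close>

lemma finite_support_integral:
  assumes ne: "space T \<noteq> {}" and sets: "sets \<gamma> = sets (bmeas_borel T)"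
    and full: "full_closed T \<gamma> C" and fin: "finite C"
  shows "C \<subseteq> bmeas T" and "(\<integral>\<^sup>+g. \<phi> g \<partial>\<gamma>) = (\<Sum>g\<in>C. \<phi> g * emeasure \<gamma> {g})"
proof -
  interpret Metric_space "bmeas T" "bmeas_dist T" by (rule Metric_space_bmeas[OF ne])
  let ?O = "{U. openin (bmeas_topology T) U}"
  have O: "?O \<subseteq> Pow (bmeas T)" using openin_subset by fastforce
  have s: "sets \<gamma> = sigma_sets (bmeas T) ?O" unfolding sets bmeas_borel_def sets_measure_of[OF O] ..
  have sp: "space \<gamma> = bmeas T" using sets_eq_imp_space_eq[OF sets] unfolding bmeas_borel_def space_measure_of[OF O] .
  have closed: "D \<in> sets \<gamma>" if "closedin (bmeas_topology T) D" for D
  proof -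
    have "bmeas T - D \<in> sets \<gamma>" unfolding s using that by (intro sigma_sets.Basic) (simp add: closedin_def)
    then have "space \<gamma> - (bmeas T - D) \<in> sets \<gamma>" by (rule sets.compl_sets)
    moreover have "space \<gamma> - (bmeas T - D) = D" using closedin_subset[OF that] sp by auto
    ultimately show ?thesis by simp
  qed
  show sub: "C \<subseteq> bmeas T" using full closedin_subset unfolding full_closed_def by fastforce
  have single: "{g} \<in> sets \<gamma>" if "g \<in> C" for g
    using that sub closedin_Hausdorff_singleton[OF Hausdorff_space_mtopology, of g] by (intro closed) auto
  have AE: "AE g in \<gamma>. g \<in> C"
  proof (rule AE_I[where N="bmeas T - C"])
    show "{g \<in> space \<gamma>. g \<notin> C} \<subseteq> bmeas T - C" using sp by auto
    show "emeasure \<gamma> (bmeas T - C) = 0" using full by (simp add: full_closed_def)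
    show "bmeas T - C \<in> sets \<gamma>" unfolding s using full by (intro sigma_sets.Basic) (simp add: full_closed_def closedin_def)
  qed
  have "(\<integral>\<^sup>+g. \<phi> g \<partial>\<gamma>) = (\<integral>\<^sup>+g. (\<Sum>g'\<in>C. \<phi> g' * indicator {g'} g) \<partial>\<gamma>)"
  proof (rule nn_integral_cong_AE, use AE in eventually_elim)
    fix g assume "g \<in> C"
    then have "(\<Sum>g'\<in>C. \<phi> g' * indicator {g'} g) = (\<Sum>g'\<in>{g}. \<phi> g' * indicator {g'} g)"
      using fin by (intro sum.mono_neutral_right) (auto simp: indicator_def)
    then show "\<phi> g = (\<Sum>g'\<in>C. \<phi> g' * indicator {g'} g)" by simp
  qed
  also have "\<dots> = (\<Sum>g'\<in>C. \<integral>\<^sup>+g. \<phi> g' * indicator {g'} g \<partial>\<gamma>)"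
    using single by (intro nn_integral_sum) auto
  also have "\<dots> = (\<Sum>g\<in>C. \<phi> g * emeasure \<gamma> {g})"
    using single by (intro sum.cong refl nn_integral_cmult_indicator) auto
  finally show "(\<integral>\<^sup>+g. \<phi> g \<partial>\<gamma>) = (\<Sum>g\<in>C. \<phi> g * emeasure \<gamma> {g})" .
qed

text \<open>
  Every function in the support is divided by its norm, and its mass multiplied by it. Only
  the zero function can have infinite mass, and it contributes to neither side.
\<close>

lemma finite_support_bound:
  assumes ne: "space T \<noteq> {}" and sets: "sets \<gamma> = sets (bmeas_borel T)"
    and full: "full_closed T \<gamma> C" and fin: "finite C"
    and bound: "(\<integral>\<^sup>+ g. ennreal (sup_norm T g) \<partial>\<gamma>) \<le> ennreal b" and b: "0 \<le> b"
  shows "\<exists>w \<xi>. (\<forall>g\<in>C. \<xi> g \<in> bfun T \<and> (\<forall>x\<in>space T. \<bar>\<xi> g x\<bar> \<le> 1) \<and> 0 \<le> w g) \<and> sum w C \<le> b \<and>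
    (\<forall>\<mu>\<in>pr T. \<forall>\<mu>'\<in>pr T. (\<integral>\<^sup>+ g. ennreal \<bar>integral\<^sup>L \<mu> g - integral\<^sup>L \<mu>' g\<bar> \<partial>\<gamma>)
       = ennreal (\<Sum>g\<in>C. w g * \<bar>integral\<^sup>L \<mu> (\<xi> g) - integral\<^sup>L \<mu>' (\<xi> g)\<bar>))"
proof -
  note I = finite_support_integral(2)[OF ne sets full fin]
  have gb: "g \<in> bfun T" if "g \<in> C" for g using finite_support_integral(1)[OF ne sets full fin] that bmeas_bfun by blast
  let ?s = "sup_norm T"
  have s0: "0 \<le> ?s g" if "g \<in> C" for g by (rule sup_norm_nonneg[OF gb[OF that] ne])
  define w where "w g = ?s g * enn2real (emeasure \<gamma> {g})" for g
  define \<xi> where "\<xi> g x = g x * (1 / ?s g)" for g x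
  have sum_le: "(\<Sum>g\<in>C. ennreal (?s g) * emeasure \<gamma> {g}) \<le> ennreal b" using bound unfolding I .
  have w_eq: "ennreal (?s g) * emeasure \<gamma> {g} = ennreal (w g)" if g: "g \<in> C" for g
  proof (cases "?s g = 0")
    case True then show ?thesis by (simp add: w_def)
  next
    case False
    have "ennreal (?s g) * emeasure \<gamma> {g} \<le> ennreal b"
      using member_le_sum[OF g _ fin, of "\<lambda>g. ennreal (?s g) * emeasure \<gamma> {g}"] sum_le by (auto intro: order_trans)
    then have "ennreal (?s g) * emeasure \<gamma> {g} < \<infinity>" by (rule le_less_trans) simp
    then have "emeasure \<gamma> {g} < \<infinity>" using False s0[OF g] by (auto simp: ennreal_mult_less_top)
    then have "emeasure \<gamma> {g} = ennreal (enn2real (emeasure \<gamma> {g}))" by simp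
    then show ?thesis unfolding w_def using s0[OF g] by (metis ennreal_mult enn2real_nonneg)
  qed
  have w0: "0 \<le> w g" if "g \<in> C" for g using s0[OF that] by (simp add: w_def)
  have "ennreal (sum w C) \<le> ennreal b"
    using sum_le w_eq w0 by (simp add: sum_ennreal cong: sum.cong)
  then have wb: "sum w C \<le> b" using b by (simp add: ennreal_le_iff)
  have \<xi>b: "\<xi> g \<in> bfun T" if "g \<in> C" for g
    unfolding \<xi>_def[abs_def] by (intro bfun_mult gb that bfun_const)
  have \<xi>1: "\<bar>\<xi> g x\<bar> \<le> 1" if "g \<in> C" "x \<in> space T" for g x
    using abs_le_sup_norm[OF gb[OF that(1)] that(2)] s0[OF that(1)] by (auto simp: \<xi>_def abs_divide divide_le_eq_1)
  have eq: "(\<integral>\<^sup>+ g. ennreal \<bar>integral\<^sup>L \<mu> g - integral\<^sup>L \<mu>' g\<bar> \<partial>\<gamma>)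
       = ennreal (\<Sum>g\<in>C. w g * \<bar>integral\<^sup>L \<mu> (\<xi> g) - integral\<^sup>L \<mu>' (\<xi> g)\<bar>)" if \<mu>: "\<mu> \<in> pr T" "\<mu>' \<in> pr T" for \<mu> \<mu>'
  proof -
    have "ennreal \<bar>integral\<^sup>L \<mu> g - integral\<^sup>L \<mu>' g\<bar> * emeasure \<gamma> {g}
        = ennreal (w g * \<bar>integral\<^sup>L \<mu> (\<xi> g) - integral\<^sup>L \<mu>' (\<xi> g)\<bar>)" if g: "g \<in> C" for g
    proof -
      let ?d = "\<bar>integral\<^sup>L \<mu> (\<xi> g) - integral\<^sup>L \<mu>' (\<xi> g)\<bar>"
      have "\<bar>integral\<^sup>L \<mu> g - integral\<^sup>L \<mu>' g\<bar> = ?s g * ?d"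
      proof (cases "?s g = 0")
        case True
        have "integral\<^sup>L \<eta> g = 0" if "\<eta> \<in> pr T" for \<eta>
          using integral_bounds(3)[OF that gb[OF g], of 0] abs_le_sup_norm[OF gb[OF g]] True by simp
        then show ?thesis using \<mu> True by simp
      next
        case False
        have "integral\<^sup>L \<eta> (\<xi> g) = integral\<^sup>L \<eta> g / ?s g" for \<eta>
          unfolding \<xi>_def integral_mult_left_zero by simp
        then show ?thesis using False s0[OF g] by (simp add: abs_divide flip: diff_divide_distrib)
      qed
      then have "ennreal \<bar>integral\<^sup>L \<mu> g - integral\<^sup>L \<mu>' g\<bar> * emeasure \<gamma> {g} = ennreal ?d * (ennreal (?s g) * emeasure \<gamma> {g})"
        using s0[OF g] by (simp add: ennreal_mult mult_ac)
      also have "\<dots> = ennreal (w g * ?d)"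
        unfolding w_eq[OF g] using w0[OF g] by (simp add: ennreal_mult mult.commute)
      finally show ?thesis .
    qed
    then show ?thesis unfolding I using w0 by (simp add: sum_ennreal cong: sum.cong)
  qed
  show ?thesis
    by (intro exI[of _ w] exI[of _ \<xi>] conjI ballI) (use \<xi>b \<xi>1 w0 wb eq in auto)
qed

section \<open>The exponential estimate\<close>

text \<open>
  Multiples of \<open>n\<close> steps reach the factor \<open>1/2\<close>, and further steps do no harm. This allows one
  number of steps for all levels.
\<close>

lemma uniform_contraction:
  assumes ne: "space A \<noteq> {}" and M: "\<And>\<mu>. \<mu> \<in> D \<Longrightarrow> M \<mu> \<in> A \<rightarrow>\<^sub>M prob_algebra A"
    and b: "(SUP \<mu>\<in>D. dobrushin A (kernel_pow A (M \<mu>) n)) < 1"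
  shows "\<exists>N. \<forall>N'\<ge>N. \<forall>\<mu>\<in>D. \<forall>g\<in>bfun A. \<forall>a. osc_le (space A) g a \<longrightarrow>
     osc_le (space A) (\<lambda>x. integral\<^sup>L (kernel_pow A (M \<mu>) N' x) g) (1/2 * a)"
proof -
  let ?d = "\<lambda>\<mu>. dobrushin A (kernel_pow A (M \<mu>) n)"
  define \<beta> where "\<beta> = max (SUP \<mu>\<in>D. ?d \<mu>) 0"
  have \<beta>: "0 \<le> \<beta>" "\<beta> < 1" using b by (auto simp: \<beta>_def)
  have kn: "kernel_pow A (M \<mu>) i \<in> A \<rightarrow>\<^sub>M prob_algebra A" if "\<mu> \<in> D" for \<mu> i
    by (rule kernel_pow_kernel[OF M[OF that]])
  have bdd: "bdd_above (?d ` D)"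
    by (rule bdd_aboveI2[where M=1]) (rule dobrushin_contract(2)[OF kn bfun_const _ ne, of _ 0 0], auto simp: osc_le_def)
  have d\<beta>: "?d \<mu> \<le> \<beta>" if "\<mu> \<in> D" for \<mu>
    using cSUP_upper[OF that bdd] by (simp add: \<beta>_def)
  obtain j where j: "\<beta> ^ j < 1/2" using real_arch_pow_inv[of "1/2" \<beta>] \<beta> by auto
  have a0: "0 \<le> a" if "osc_le (space A) g a" for g a
    using ne osc_leD[OF that] by fastforce
  have N: "osc_le (space A) (\<lambda>x. integral\<^sup>L (kernel_pow A (M \<mu>) (n * j) x) g) (1/2 * a)"
    if \<mu>: "\<mu> \<in> D" and g: "g \<in> bfun A" "osc_le (space A) g a" for \<mu> g a
  proof -
    have "osc_le (space A) (\<lambda>x. integral\<^sup>L (kernel_pow A (M \<mu>) (n * j) x) g) (\<beta> ^ j * a)"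
    proof (rule kernel_pow_contract_iterate[OF M[OF \<mu>] _ g])
      fix g a assume g: "g \<in> bfun A" "osc_le (space A) g a"
      show "osc_le (space A) (\<lambda>x. integral\<^sup>L (kernel_pow A (M \<mu>) n x) g) (\<beta> * a)"
        by (rule osc_le_mono[OF dobrushin_contract(1)[OF kn[OF \<mu>] g]])
           (intro mult_right_mono d\<beta>[OF \<mu>] a0[OF g(2)])
    qed
    then show ?thesis
      by (rule osc_le_mono) (use j a0[OF g(2)] in \<open>intro mult_right_mono, auto\<close>)
  qed
  show ?thesis
  proof (intro exI[of _ "n * j"] allI impI ballI)
    fix N' \<mu> g a assume N': "n * j \<le> N'" and \<mu>: "\<mu> \<in> D" and g: "g \<in> bfun A" "osc_le (space A) g a"
    have "integral\<^sup>L (kernel_pow A (M \<mu>) N' x) g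
        = (\<integral>y. integral\<^sup>L (kernel_pow A (M \<mu>) (n * j) y) g \<partial>kernel_pow A (M \<mu>) (N' - n * j) x)"
      if "x \<in> space A" for x
      using kernel_pow_add_integral[OF M[OF \<mu>] g(1) that, of "N' - n * j" "n * j"] N' by simp
    then show "osc_le (space A) (\<lambda>x. integral\<^sup>L (kernel_pow A (M \<mu>) N' x) g) (1/2 * a)"
      using kernel_pow_osc_le[OF M[OF \<mu>] kernel_pow_bfun[OF M[OF \<mu>] g(1)] N[OF \<mu> g], of "N' - n * j"]
      by (simp add: osc_le_def)
  qed
qed

lemma limsup_eln_less:
  fixes p :: "nat \<Rightarrow> real"
  assumes p: "\<And>n. 0 \<le> p n" and bound: "\<And>n. n \<ge> N \<Longrightarrow> p n \<le> C * exp (- (\<alpha> * real (Suc n)))"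
    and \<alpha>: "0 < \<alpha>" and C: "1 \<le> C" and \<gamma>: "\<gamma> < \<alpha>"
  shows "limsup (\<lambda>n. ereal (1 / real n) * eln (p n)) < ereal (- \<gamma>)"
proof -
  define \<delta> where "\<delta> = (\<alpha> - \<gamma>) / 2"
  have \<delta>: "0 < \<delta>" using \<gamma> by (simp add: \<delta>_def)
  obtain K where K: "ln C / \<delta> \<le> real K" using real_arch_simple by blast
  have "\<forall>\<^sub>F n in sequentially. ereal (1 / real n) * eln (p n) \<le> ereal (- \<alpha> + \<delta>)"
    unfolding eventually_sequentially
  proof (intro exI[of _ "max N (Suc K)"] allI impI)
    fix n assume n: "max N (Suc K) \<le> n"
    then have n0: "0 < real n" by simp
    show "ereal (1 / real n) * eln (p n) \<le> ereal (- \<alpha> + \<delta>)"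
    proof (cases "p n = 0")
      case True then show ?thesis using n0 by (simp add: eln_def)
    next
      case False
      then have pn: "0 < p n" using p[of n] by simp
      have "ln (p n) \<le> ln (C * exp (- (\<alpha> * real (Suc n))))"
        using bound[of n] n pn C by (subst ln_le_cancel_iff) auto
      also have "\<dots> = ln C - \<alpha> * real (Suc n)" using C by (simp add: ln_mult)
      also have "\<dots> \<le> \<delta> * real n - \<alpha> * real n"
      proof -
        have "ln C / \<delta> \<le> real n" using K n by linarith
        then have "ln C \<le> \<delta> * real n" using \<delta> by (simp add: pos_divide_le_eq mult.commute)
        moreover have "\<alpha> * real n \<le> \<alpha> * real (Suc n)" using \<alpha> by (intro mult_left_mono) auto
        ultimately show ?thesis by linarith
      qed
      finally have "ln (p n) \<le> (- \<alpha> + \<delta>) * real n" by (simp add: algebra_simps)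
      then have "1 / real n * ln (p n) \<le> - \<alpha> + \<delta>" using n0 by (simp add: pos_divide_le_eq)
      then show ?thesis using False by (simp add: eln_def)
    qed
  qed
  then have "limsup (\<lambda>n. ereal (1 / real n) * eln (p n)) \<le> ereal (- \<alpha> + \<delta>)"
    by (rule Limsup_bounded)
  also have "\<dots> < ereal (- \<gamma>)" using \<gamma> by (simp add: \<delta>_def field_simps)
  finally show ?thesis .
qed

theorem theorem6p2:
  fixes P :: "'w measure"
    and S :: "nat \<Rightarrow> 'a measure"
    and \<pi> \<nu> :: "nat \<Rightarrow> 'a measure"
    and \<Phi> :: "nat \<Rightarrow> 'a measure \<Rightarrow> 'a measure"
    and M0 :: "'a \<Rightarrow> 'a measure"
    and M :: "nat \<Rightarrow> 'a measure \<Rightarrow> 'a \<Rightarrow> 'a measure"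
    and X :: "nat \<Rightarrow> nat \<Rightarrow> 'w \<Rightarrow> 'a"
    and \<Gamma> :: "nat \<Rightarrow> ('a \<Rightarrow> real) \<Rightarrow> ('a \<Rightarrow> real) measure"
    and \<Lambda> :: "nat \<Rightarrow> real"
    and m :: nat
  assumes pi0: "\<pi> 0 \<in> space (prob_algebra (S 0))"
    and Phi: "\<And>l. l \<ge> 1 \<Longrightarrow> \<Phi> l \<in> space (prob_algebra (S (l - 1))) \<rightarrow> space (prob_algebra (S l))"
    and pi: "\<And>l. l \<ge> 1 \<Longrightarrow> \<pi> l = \<Phi> l (\<pi> (l - 1))"
    and M0: "M0 \<in> S 0 \<rightarrow>\<^sub>M prob_algebra (S 0)" "bind (\<pi> 0) M0 = \<pi> 0"
    and M_0: "\<And>\<mu>. M 0 \<mu> = M0"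
    and M: "\<And>l \<mu>. l \<ge> 1 \<Longrightarrow> \<mu> \<in> space (prob_algebra (S (l - 1))) \<Longrightarrow>
              M l \<mu> \<in> S l \<rightarrow>\<^sub>M prob_algebra (S l)"
    and M_inv: "\<And>l \<mu>. l \<ge> 1 \<Longrightarrow> \<mu> \<in> space (prob_algebra (S (l - 1))) \<Longrightarrow>
              bind (\<Phi> l \<mu>) (M l \<mu>) = \<Phi> l \<mu>"
    and nu: "\<And>k. \<nu> k \<in> space (prob_algebra (S k))"
    and X: "interacting_mcmc P S M \<nu> X"
    and R1_kernel: "\<And>l. l \<ge> 1 \<Longrightarrow> bmeas_kernel (S l) (S (l - 1)) (\<Gamma> l)"
    and R1_Lipschitz: "\<And>l f \<mu> \<mu>'. l \<ge> 1 \<Longrightarrow> f \<in> bmeas (S l) \<Longrightarrow>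
              \<mu> \<in> space (prob_algebra (S (l - 1))) \<Longrightarrow> \<mu>' \<in> space (prob_algebra (S (l - 1))) \<Longrightarrow>
              ennreal \<bar>integral\<^sup>L (\<Phi> l \<mu>) f - integral\<^sup>L (\<Phi> l \<mu>') f\<bar>
                \<le> (\<integral>\<^sup>+ g. ennreal \<bar>integral\<^sup>L \<mu> g - integral\<^sup>L \<mu>' g\<bar> \<partial>\<Gamma> l f)"
    and R1_bound: "\<And>l f. l \<ge> 1 \<Longrightarrow> f \<in> bmeas (S l) \<Longrightarrow>
              (\<integral>\<^sup>+ g. ennreal (sup_norm (S (l - 1)) g) \<partial>\<Gamma> l f) \<le> ennreal (\<Lambda> l * sup_norm (S l) f)"
    and R2: "\<And>l. \<exists>(n::nat) (c::real).
              (\<forall>\<mu> \<in> space (prob_algebra (S (l - 1))). \<forall>\<mu>' \<in> space (prob_algebra (S (l - 1))).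
                 op_dist (S l) (M l \<mu>) (M l \<mu>') \<le> c * meas_dist (S (l - 1)) \<mu> \<mu>') \<and>
              (SUP \<mu> \<in> space (prob_algebra (S (l - 1))). dobrushin (S l) (kernel_pow (S l) (M l \<mu>) n)) < 1"
    and finite_support: "\<And>k. k \<ge> 1 \<Longrightarrow> uniformly_finite_support (S k) (S (k - 1)) (\<Gamma> k)"
    and m: "m \<ge> 1"
  shows "\<exists>\<sigma>::real. \<sigma> > 0 \<and>
           (\<forall>f \<in> bmeas1 (\<Pi>\<^sub>M l\<in>{..m}. S l). \<forall>t>0.
              limsup (\<lambda>n. ereal (1 / real n) *
                eln (measure P {\<omega> \<in> space P.
                  \<bar>integral\<^sup>L (empirical (\<Pi>\<^sub>M l\<in>{..m}. S l) n (\<lambda>p. joint X m p \<omega>)) f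
                    - integral\<^sup>L (\<Pi>\<^sub>M l\<in>{..m}. \<pi> l) f\<bar> > t}))
              < ereal (- (t\<^sup>2 / (2 * \<sigma>\<^sup>2))))"
proof -
  have proc: "prob_space P" "\<And>k n. X k n \<in> P \<rightarrow>\<^sub>M S k"
    and M_joint: "\<And>k n. (\<lambda>(u, x). M k (empirical (S (k - 1)) n u) x)
        \<in> (\<Pi>\<^sub>M p\<in>{..n}. S (k - 1)) \<Otimes>\<^sub>M S k \<rightarrow>\<^sub>M prob_algebra (S k)"
    and joint_law: "\<And>n. cond_law P (generated_by P S X ({..m} \<times> {..n}))
        (\<Pi>\<^sub>M l\<in>{..m}. S l) (joint X m (Suc n))
        (\<lambda>\<omega>. \<Pi>\<^sub>M l\<in>{..m}. M l (level_empirical S X (l - 1) n \<omega>) (X l n \<omega>))"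
    using X m unfolding interacting_mcmc_def by blast+
  have ne: "space (S l) \<noteq> {}" for l by (rule pr_nonempty[OF nu])
  have M_kernel: "M l \<mu> \<in> S l \<rightarrow>\<^sub>M prob_algebra (S l)" if "\<mu> \<in> pr (S (l - 1))" for l \<mu>
    using M[of l \<mu>] M0(1) that M_0 by (cases "l = 0") auto
  have pi_pr: "\<pi> l \<in> pr (S l)" for l
  proof (induction l)
    case (Suc l)
    then show ?case using Phi[of "Suc l"] pi[of "Suc l"] by auto
  qed (rule pi0)
  have "\<forall>l. \<exists>N c. (\<forall>\<mu> \<in> pr (S (l - 1)). \<forall>\<mu>' \<in> pr (S (l - 1)).
      op_dist (S l) (M l \<mu>) (M l \<mu>') \<le> c * meas_dist (S (l - 1)) \<mu> \<mu>') \<and>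
      (\<forall>N'\<ge>N. \<forall>\<mu>\<in>pr (S (l - 1)). \<forall>g\<in>bfun (S l). \<forall>a. osc_le (space (S l)) g a \<longrightarrow>
        osc_le (space (S l)) (\<lambda>x. integral\<^sup>L (kernel_pow (S l) (M l \<mu>) N' x) g) (1/2 * a))"
  proof
    fix l
    obtain n c where 1: "\<forall>\<mu> \<in> pr (S (l - 1)). \<forall>\<mu>' \<in> pr (S (l - 1)).
        op_dist (S l) (M l \<mu>) (M l \<mu>') \<le> c * meas_dist (S (l - 1)) \<mu> \<mu>'"
      and 2: "(SUP \<mu> \<in> pr (S (l - 1)). dobrushin (S l) (kernel_pow (S l) (M l \<mu>) n)) < 1"
      using R2[of l] by blast
    show "\<exists>N c. (\<forall>\<mu> \<in> pr (S (l - 1)). \<forall>\<mu>' \<in> pr (S (l - 1)).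
      op_dist (S l) (M l \<mu>) (M l \<mu>') \<le> c * meas_dist (S (l - 1)) \<mu> \<mu>') \<and>
      (\<forall>N'\<ge>N. \<forall>\<mu>\<in>pr (S (l - 1)). \<forall>g\<in>bfun (S l). \<forall>a. osc_le (space (S l)) g a \<longrightarrow>
        osc_le (space (S l)) (\<lambda>x. integral\<^sup>L (kernel_pow (S l) (M l \<mu>) N' x) g) (1/2 * a))"
      using 1 uniform_contraction[OF ne M_kernel 2] by blast
  qed
  then obtain NN cc where
    op: "\<And>l \<mu> \<mu>'. \<mu> \<in> pr (S (l - 1)) \<Longrightarrow> \<mu>' \<in> pr (S (l - 1)) \<Longrightarrow>
      op_dist (S l) (M l \<mu>) (M l \<mu>') \<le> cc l * meas_dist (S (l - 1)) \<mu> \<mu>'"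
    and contr: "\<And>l N' \<mu> g a. N' \<ge> NN l \<Longrightarrow> \<mu> \<in> pr (S (l - 1)) \<Longrightarrow> g \<in> bfun (S l) \<Longrightarrow> osc_le (space (S l)) g a \<Longrightarrow>
        osc_le (space (S l)) (\<lambda>x. integral\<^sup>L (kernel_pow (S l) (M l \<mu>) N' x) g) (1/2 * a)"
    by metis
  \<comment> \<open>constants that serve all levels up to \<open>m\<close> at once; the 2 is the norm of a difference of two point masses\<close>
  define n0 where "n0 = Suc (\<Sum>l\<le>m. NN l)"
  define c where "c = (\<Sum>l\<le>m. 2 * (\<bar>cc l\<bar> + \<bar>\<Lambda> l\<bar>))"
  define \<Lambda>' where "\<Lambda>' = (\<Sum>l\<le>m. \<bar>\<Lambda> l\<bar>)"
  have c0: "0 \<le> c" unfolding c_def by (intro sum_nonneg) auto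
  have cl: "2 * (\<bar>cc l\<bar> + \<bar>\<Lambda> l\<bar>) \<le> c" if "l \<le> m" for l
    unfolding c_def using that by (intro member_le_sum) auto
  have \<Lambda>l: "\<bar>\<Lambda> l\<bar> \<le> \<Lambda>'" if "l \<le> m" for l
    unfolding \<Lambda>'_def using that by (intro member_le_sum) auto
  have NNl: "NN l \<le> n0" if "l \<le> m" for l
  proof -
    have "NN l \<le> (\<Sum>l\<le>m. NN l)" using that by (intro member_le_sum) auto
    then show ?thesis by (simp add: n0_def)
  qed
  define \<eta> where "\<eta> l k h = empirical (S l) k (\<lambda>p. h (l, p))" for l k and h :: "nat \<times> nat \<Rightarrow> 'a"
  define K where "K l k h = M l (\<eta> (l - 1) k h)" for l k and h :: "nat \<times> nat \<Rightarrow> 'a"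
  define \<Psi> where "\<Psi> l k h = (if l = 0 then \<pi> 0 else \<Phi> l (\<eta> (l - 1) k h))" for l k and h :: "nat \<times> nat \<Rightarrow> 'a"
  have \<eta>_pr: "\<eta> l k h \<in> pr (S l)" if "l \<le> m" "h \<in> space (hist S m)" for l k h
    unfolding \<eta>_def by (rule empirical_pr) (rule hist_spaceD[OF that(2,1)])
  have \<eta>_pr': "\<eta> (l - 1) k h \<in> pr (S (l - 1))" if "l \<le> m" "h \<in> space (hist S m)" for l k h
    by (rule \<eta>_pr) (use that in auto)
  have \<eta>_int: "integral\<^sup>L (\<eta> l k h) g = (\<Sum>p\<le>k. g (h (l, p))) / real (Suc k)"
    if "l \<le> m" "h \<in> space (hist S m)" "g \<in> bfun (S l)" for l k h g
    unfolding \<eta>_def by (rule empirical_integral[OF _ bfun_meas[OF that(3)]]) (rule hist_spaceD[OF that(2,1)])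
  have \<eta>_coord: "\<bar>integral\<^sup>L (\<eta> l k (h((l, j) := y))) g - integral\<^sup>L (\<eta> l k h) g\<bar> \<le> 2 / real (Suc k)"
    if "l \<le> m" "h \<in> space (hist S m)" "y \<in> space (S l)" "g \<in> bfun (S l)" "\<And>x. x \<in> space (S l) \<Longrightarrow> \<bar>g x\<bar> \<le> 1" for l k h j y g
  proof -
    have h': "h((l, j) := y) \<in> space (hist S m)" by (rule hist_fun_upd[OF that(2,1,3)])
    have "\<bar>integral\<^sup>L (\<eta> l k (h((l, j) := y))) g - integral\<^sup>L (\<eta> l k h) g\<bar> \<le> 2 * 1 / real (Suc k)"
      unfolding \<eta>_def
      by (rule empirical_coord[OF hist_spaceD[OF h' that(1)] hist_spaceD[OF that(2,1)] _ that(4,5), where j=j]) auto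
    then show ?thesis by simp
  qed
  have R1: "\<exists>(G :: ('a \<Rightarrow> real) set) w \<xi>. finite G \<and>
      (\<forall>i\<in>G. \<xi> i \<in> bfun (S l) \<and> (\<forall>x\<in>space (S l). \<bar>\<xi> i x\<bar> \<le> 1) \<and> 0 \<le> w i) \<and>
      sum w G \<le> \<bar>\<Lambda> (Suc l)\<bar> * b \<and> (\<forall>\<mu>\<in>pr (S l). \<forall>\<mu>'\<in>pr (S l).
        \<bar>integral\<^sup>L (\<Phi> (Suc l) \<mu>) g - integral\<^sup>L (\<Phi> (Suc l) \<mu>') g\<bar>
          \<le> (\<Sum>i\<in>G. w i * \<bar>integral\<^sup>L \<mu> (\<xi> i) - integral\<^sup>L \<mu>' (\<xi> i)\<bar>))"
    if g: "g \<in> bfun (S (Suc l))" "\<forall>x\<in>space (S (Suc l)). \<bar>g x\<bar> \<le> b" and b: "0 \<le> b" for l g b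
  proof -
    let ?g = "restrict g (space (S (Suc l)))"
    let ?\<gamma> = "\<Gamma> (Suc l) ?g"
    let ?C = "supp (S l) ?\<gamma>"
    have gb: "?g \<in> bmeas (S (Suc l))" by (rule bfun_restrict_bmeas[OF g(1)])
    have sets: "sets ?\<gamma> = sets (bmeas_borel (S l))"
      using R1_kernel[of "Suc l"] gb unfolding bmeas_kernel_def by simp
    have full: "full_closed (S l) ?\<gamma> ?C" and fin: "finite ?C"
      using finite_support[of "Suc l"] gb unfolding uniformly_finite_support_def by auto
    have "sup_norm (S (Suc l)) ?g \<le> b" by (rule sup_norm_le[OF ne]) (use g in simp)
    then have "\<Lambda> (Suc l) * sup_norm (S (Suc l)) ?g \<le> \<bar>\<Lambda> (Suc l)\<bar> * b"
      using sup_norm_nonneg[OF bmeas_bfun[OF gb] ne]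
      by (intro mult_mono) auto
    then have bound: "(\<integral>\<^sup>+ g. ennreal (sup_norm (S l) g) \<partial>?\<gamma>) \<le> ennreal (\<bar>\<Lambda> (Suc l)\<bar> * b)"
      using R1_bound[of "Suc l" ?g] gb by (auto intro: order_trans ennreal_leI)
    from finite_support_bound[OF ne sets full fin bound] b
    obtain w \<xi> where w: "\<forall>i\<in>?C. \<xi> i \<in> bfun (S l) \<and> (\<forall>x\<in>space (S l). \<bar>\<xi> i x\<bar> \<le> 1) \<and> 0 \<le> w i"
      "sum w ?C \<le> \<bar>\<Lambda> (Suc l)\<bar> * b"
      and eq: "\<forall>\<mu>\<in>pr (S l). \<forall>\<mu>'\<in>pr (S l). (\<integral>\<^sup>+ g. ennreal \<bar>integral\<^sup>L \<mu> g - integral\<^sup>L \<mu>' g\<bar> \<partial>?\<gamma>)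
       = ennreal (\<Sum>i\<in>?C. w i * \<bar>integral\<^sup>L \<mu> (\<xi> i) - integral\<^sup>L \<mu>' (\<xi> i)\<bar>)"
      by auto
    have "\<bar>integral\<^sup>L (\<Phi> (Suc l) \<mu>) g - integral\<^sup>L (\<Phi> (Suc l) \<mu>') g\<bar>
        \<le> (\<Sum>i\<in>?C. w i * \<bar>integral\<^sup>L \<mu> (\<xi> i) - integral\<^sup>L \<mu>' (\<xi> i)\<bar>)" if \<mu>: "\<mu> \<in> pr (S l)" "\<mu>' \<in> pr (S l)" for \<mu> \<mu>'
    proof -
      have P: "\<Phi> (Suc l) \<nu> \<in> pr (S (Suc l))" if "\<nu> \<in> pr (S l)" for \<nu> using Phi[of "Suc l"] that by auto
      have "ennreal \<bar>integral\<^sup>L (\<Phi> (Suc l) \<mu>) ?g - integral\<^sup>L (\<Phi> (Suc l) \<mu>') ?g\<bar>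
          \<le> ennreal (\<Sum>i\<in>?C. w i * \<bar>integral\<^sup>L \<mu> (\<xi> i) - integral\<^sup>L \<mu>' (\<xi> i)\<bar>)"
        using R1_Lipschitz[of "Suc l" ?g \<mu> \<mu>'] gb \<mu> eq by simp
      moreover have "0 \<le> (\<Sum>i\<in>?C. w i * \<bar>integral\<^sup>L \<mu> (\<xi> i) - integral\<^sup>L \<mu>' (\<xi> i)\<bar>)"
        using w by (intro sum_nonneg mult_nonneg_nonneg) auto
      ultimately show ?thesis
        unfolding integral_restrict[OF P[OF \<mu>(1)]] integral_restrict[OF P[OF \<mu>(2)]] by (simp add: ennreal_le_iff)
    qed
    then show ?thesis using fin w by (intro exI[of _ ?C] exI[of _ w] exI[of _ \<xi>]) auto
  qed
  interpret IC: invariant_chains S m K c n0 \<Psi> \<pi> \<Lambda>'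
  proof
    show "0 \<le> c" by (rule c0)
    show "0 < n0" by (simp add: n0_def)
  next
    fix l k assume l: "l \<le> m"
    have "(\<lambda>q. (\<lambda>p\<in>{..k}. fst q (l - 1, p), snd q)) \<in> hist S m \<Otimes>\<^sub>M S l \<rightarrow>\<^sub>M (\<Pi>\<^sub>M p\<in>{..k}. S (l - 1)) \<Otimes>\<^sub>M S l"
      by (intro measurable_Pair measurable_restrict measurable_compose[OF measurable_fst hist_component] measurable_snd)
         (use l in auto)
    from measurable_compose[OF this M_joint]
    have "(\<lambda>q. M l (empirical (S (l - 1)) k (\<lambda>p\<in>{..k}. fst q (l - 1, p))) (snd q)) \<in> hist S m \<Otimes>\<^sub>M S l \<rightarrow>\<^sub>M prob_algebra (S l)"
      unfolding case_prod_conv .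
    moreover have "empirical (S (l - 1)) k (\<lambda>p\<in>{..k}. h (l - 1, p)) = \<eta> (l - 1) k h" for h
      unfolding \<eta>_def by (rule empirical_cong) simp
    ultimately show "(\<lambda>(h, x). K l k h x) \<in> hist S m \<Otimes>\<^sub>M S l \<rightarrow>\<^sub>M prob_algebra (S l)"
      unfolding K_def split_def by simp
  next
    fix l k and h h' :: "nat \<times> nat \<Rightarrow> 'a"
    assume eq: "\<And>p. l \<noteq> 0 \<Longrightarrow> p \<le> k \<Longrightarrow> h (l - 1, p) = h' (l - 1, p)"
    show "K l k h = K l k h'"
    proof (cases "l = 0")
      case True then show ?thesis by (simp add: K_def M_0)
    next
      case False
      have "\<eta> (l - 1) k h = \<eta> (l - 1) k h'" unfolding \<eta>_def by (rule empirical_cong) (rule eq[OF False])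
      then show ?thesis by (simp add: K_def)
    qed
  next
    fix l k h y j x g a
    assume l: "Suc l \<le> m" and h: "h \<in> space (hist S m)" and y: "y \<in> space (S l)" and x: "x \<in> space (S (Suc l))"
      and g: "g \<in> bfun (S (Suc l))" "osc_le (space (S (Suc l))) g a"
    have lm: "l \<le> m" using l by simp
    let ?h = "h((l, j) := y)"
    have h': "?h \<in> space (hist S m)" by (rule hist_fun_upd[OF h lm y])
    note p = \<eta>_pr[OF lm h', of k] \<eta>_pr[OF lm h, of k]
    have a: "0 \<le> a" using osc_leD[OF g(2) x x] by simp
    have "op_dist (S (Suc l)) (M (Suc l) (\<eta> l k ?h)) (M (Suc l) (\<eta> l k h)) \<le> cc (Suc l) * meas_dist (S l) (\<eta> l k ?h) (\<eta> l k h)"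
      using op[of "\<eta> l k ?h" "Suc l" "\<eta> l k h"] p by simp
    also have "\<dots> \<le> \<bar>cc (Suc l)\<bar> * (2 / real (Suc k))"
    proof (intro mult_mono)
      have near: "\<bar>integral\<^sup>L (\<eta> l k ?h) f - integral\<^sup>L (\<eta> l k h) f\<bar> \<le> 2 / real (Suc k)"
        if "f \<in> bfun (S l)" "\<And>x. x \<in> space (S l) \<Longrightarrow> \<bar>f x\<bar> \<le> 1" for f
        by (rule \<eta>_coord[OF lm h y that])
      show "meas_dist (S l) (\<eta> l k ?h) (\<eta> l k h) \<le> 2 / real (Suc k)" by (rule meas_dist_bounds(1)[OF ne near])
      show "0 \<le> meas_dist (S l) (\<eta> l k ?h) (\<eta> l k h)" by (rule meas_dist_bounds(2)[OF ne near])
    qed auto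
    also have "\<dots> \<le> c / real (Suc k)" using cl[OF l] by (simp add: divide_right_mono)
    finally have o: "op_dist (S (Suc l)) (M (Suc l) (\<eta> l k ?h)) (M (Suc l) (\<eta> l k h)) \<le> c / real (Suc k)" .
    have "\<bar>integral\<^sup>L (M (Suc l) (\<eta> l k ?h) x) g - integral\<^sup>L (M (Suc l) (\<eta> l k h) x) g\<bar>
        \<le> op_dist (S (Suc l)) (M (Suc l) (\<eta> l k ?h)) (M (Suc l) (\<eta> l k h)) * a"
      by (rule op_dist_osc[OF M_kernel M_kernel g x]) (use p in simp_all)
    also have "\<dots> \<le> c / real (Suc k) * a" by (rule mult_right_mono[OF o a])
    finally show "\<bar>integral\<^sup>L (K (Suc l) k ?h x) g - integral\<^sup>L (K (Suc l) k h x) g\<bar> \<le> c / real (Suc k) * a"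
      by (simp add: K_def)
  next
    fix l k h x g a
    assume l: "l \<le> m" and h: "h \<in> space (hist S m)" and x: "x \<in> space (S l)"
      and g: "g \<in> bfun (S l)" "osc_le (space (S l)) g a"
    have a: "0 \<le> a" using osc_leD[OF g(2) x x] by simp
    have l1: "l - 1 \<le> m" using l by simp
    note p = \<eta>_pr[OF l1 h, of "Suc k"] \<eta>_pr[OF l1 h, of k]
    have near: "\<bar>integral\<^sup>L (\<eta> (l - 1) (Suc k) h) f - integral\<^sup>L (\<eta> (l - 1) k h) f\<bar> \<le> 2 / real (Suc k)"
      if "f \<in> bfun (S (l - 1))" "\<And>x. x \<in> space (S (l - 1)) \<Longrightarrow> \<bar>f x\<bar> \<le> 1" for f
      using empirical_Suc[where b=1, OF hist_spaceD[OF h l1] that, of k] unfolding \<eta>_def by simp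
    have "op_dist (S l) (M l (\<eta> (l - 1) (Suc k) h)) (M l (\<eta> (l - 1) k h)) \<le> cc l * meas_dist (S (l - 1)) (\<eta> (l - 1) (Suc k) h) (\<eta> (l - 1) k h)"
      by (rule op[OF p])
    also have "\<dots> \<le> \<bar>cc l\<bar> * (2 / real (Suc k))"
      using meas_dist_bounds[OF ne near] by (intro mult_mono) auto
    also have "\<dots> \<le> c / real (Suc k)" using cl[OF l] by (simp add: divide_right_mono)
    finally have o: "op_dist (S l) (M l (\<eta> (l - 1) (Suc k) h)) (M l (\<eta> (l - 1) k h)) \<le> c / real (Suc k)" .
    have "\<bar>integral\<^sup>L (M l (\<eta> (l - 1) (Suc k) h) x) g - integral\<^sup>L (M l (\<eta> (l - 1) k h) x) g\<bar>
        \<le> op_dist (S l) (M l (\<eta> (l - 1) (Suc k) h)) (M l (\<eta> (l - 1) k h)) * a"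
      by (rule op_dist_osc[OF M_kernel[OF p(1)] M_kernel[OF p(2)] g x])
    also have "\<dots> \<le> c / real (Suc k) * a" by (rule mult_right_mono[OF o a])
    finally show "\<bar>integral\<^sup>L (K l (Suc k) h x) g - integral\<^sup>L (K l k h x) g\<bar> \<le> c / real (Suc k) * a"
      by (simp add: K_def)
  next
    fix l k h g a
    assume l: "l \<le> m" and h: "h \<in> space (hist S m)" and g: "g \<in> bfun (S l)" "osc_le (space (S l)) g a"
    show "osc_le (space (S l)) (\<lambda>x. integral\<^sup>L (kernel_pow (S l) (K l k h) n0 x) g) (1/2 * a)"
      unfolding K_def by (rule contr[OF NNl[OF l] \<eta>_pr'[OF l h] g])
  next
    fix l k h assume l: "l \<le> m" and h: "h \<in> space (hist S m)"
    show "\<Psi> l k h \<in> pr (S l)"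
      using Phi[of l] \<eta>_pr'[OF l h, of k] pi_pr[of 0] unfolding \<Psi>_def by (cases "l = 0") auto
    show "bind (\<Psi> l k h) (K l k h) = \<Psi> l k h"
      using M_inv[of l "\<eta> (l - 1) k h"] \<eta>_pr'[OF l h, of k] M0(2) unfolding \<Psi>_def K_def
      by (cases "l = 0") (auto simp: M_0)
  next
    fix l k and h h' :: "nat \<times> nat \<Rightarrow> 'a"
    assume eq: "\<And>p. l \<noteq> 0 \<Longrightarrow> p \<le> k \<Longrightarrow> h (l - 1, p) = h' (l - 1, p)"
    show "\<Psi> l k h = \<Psi> l k h'"
    proof (cases "l = 0")
      case False
      have "\<eta> (l - 1) k h = \<eta> (l - 1) k h'" unfolding \<eta>_def by (rule empirical_cong) (rule eq[OF False])
      then show ?thesis by (simp add: \<Psi>_def)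
    qed (simp add: \<Psi>_def)
  next
    fix l k h y j g b
    assume l: "Suc l \<le> m" and h: "h \<in> space (hist S m)" and y: "y \<in> space (S l)"
      and g: "g \<in> bfun (S (Suc l))" "\<And>x. x \<in> space (S (Suc l)) \<Longrightarrow> \<bar>g x\<bar> \<le> b"
    have lm: "l \<le> m" using l by simp
    let ?h = "h((l, j) := y)"
    have h': "?h \<in> space (hist S m)" by (rule hist_fun_upd[OF h lm y])
    obtain x0 where "x0 \<in> space (S (Suc l))" using ne[of "Suc l"] by auto
    then have b: "0 \<le> b" using g(2)[of x0] by simp
    have gb: "\<forall>x\<in>space (S (Suc l)). \<bar>g x\<bar> \<le> b" using g(2) by blast
    obtain G :: "('a \<Rightarrow> real) set" and w \<xi> where w: "\<forall>i\<in>G. \<xi> i \<in> bfun (S l) \<and> (\<forall>x\<in>space (S l). \<bar>\<xi> i x\<bar> \<le> 1) \<and> 0 \<le> w i"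
      and wb: "sum w G \<le> \<bar>\<Lambda> (Suc l)\<bar> * b"
      and bd: "\<forall>\<mu>\<in>pr (S l). \<forall>\<mu>'\<in>pr (S l). \<bar>integral\<^sup>L (\<Phi> (Suc l) \<mu>) g - integral\<^sup>L (\<Phi> (Suc l) \<mu>') g\<bar>
          \<le> (\<Sum>i\<in>G. w i * \<bar>integral\<^sup>L \<mu> (\<xi> i) - integral\<^sup>L \<mu>' (\<xi> i)\<bar>)"
      using R1[OF g(1) gb b] by (elim exE conjE) (rule that; assumption)
    have "\<bar>integral\<^sup>L (\<Phi> (Suc l) (\<eta> l k ?h)) g - integral\<^sup>L (\<Phi> (Suc l) (\<eta> l k h)) g\<bar>
        \<le> (\<Sum>i\<in>G. w i * \<bar>integral\<^sup>L (\<eta> l k ?h) (\<xi> i) - integral\<^sup>L (\<eta> l k h) (\<xi> i)\<bar>)"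
      using bd \<eta>_pr[OF lm h', of k] \<eta>_pr[OF lm h, of k] by blast
    also have "\<dots> \<le> (\<Sum>i\<in>G. w i * (2 / real (Suc k)))"
      using w by (intro sum_mono mult_left_mono \<eta>_coord[OF lm h y]) auto
    also have "\<dots> = sum w G * (2 / real (Suc k))" by (rule sum_distrib_right[symmetric])
    also have "\<dots> \<le> \<bar>\<Lambda> (Suc l)\<bar> * b * (2 / real (Suc k))" by (rule mult_right_mono[OF wb]) simp
    also have "\<dots> = 2 * \<bar>\<Lambda> (Suc l)\<bar> / real (Suc k) * b" by simp
    also have "\<dots> \<le> c / real (Suc k) * b" using cl[OF l] b by (intro mult_right_mono divide_right_mono) auto
    finally show "\<bar>integral\<^sup>L (\<Psi> (Suc l) k ?h) g - integral\<^sup>L (\<Psi> (Suc l) k h) g\<bar> \<le> c / real (Suc k) * b"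
      by (simp add: \<Psi>_def)
  next
    show "\<pi> l \<in> pr (S l)" for l by (rule pi_pr)
    show "\<Psi> 0 k h = \<pi> 0" for k h by (simp add: \<Psi>_def)
  next
    fix l g
    assume l: "Suc l \<le> m" and g: "g \<in> bfun (S (Suc l))" "\<forall>x\<in>space (S (Suc l)). \<bar>g x\<bar> \<le> 1"
    have lm: "l \<le> m" using l by simp
    obtain G :: "('a \<Rightarrow> real) set" and w \<xi> where fin: "finite G"
      and w: "\<forall>i\<in>G. \<xi> i \<in> bfun (S l) \<and> (\<forall>x\<in>space (S l). \<bar>\<xi> i x\<bar> \<le> 1) \<and> 0 \<le> w i"
      and wb: "sum w G \<le> \<bar>\<Lambda> (Suc l)\<bar> * 1"
      and bd: "\<forall>\<mu>\<in>pr (S l). \<forall>\<mu>'\<in>pr (S l). \<bar>integral\<^sup>L (\<Phi> (Suc l) \<mu>) g - integral\<^sup>L (\<Phi> (Suc l) \<mu>') g\<bar>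
          \<le> (\<Sum>i\<in>G. w i * \<bar>integral\<^sup>L \<mu> (\<xi> i) - integral\<^sup>L \<mu>' (\<xi> i)\<bar>)"
      using R1[OF g zero_le_one] by (elim exE conjE) (rule that; assumption)
    have "\<bar>integral\<^sup>L (\<Psi> (Suc l) k h) g - integral\<^sup>L (\<pi> (Suc l)) g\<bar>
        \<le> (\<Sum>i\<in>G. w i * \<bar>(\<Sum>p\<le>k. \<xi> i (h (l, p))) / real (Suc k) - integral\<^sup>L (\<pi> l) (\<xi> i)\<bar>)"
      if h: "h \<in> space (hist S m)" for k h
    proof -
      have "\<bar>integral\<^sup>L (\<Phi> (Suc l) (\<eta> l k h)) g - integral\<^sup>L (\<Phi> (Suc l) (\<pi> l)) g\<bar>
          \<le> (\<Sum>i\<in>G. w i * \<bar>integral\<^sup>L (\<eta> l k h) (\<xi> i) - integral\<^sup>L (\<pi> l) (\<xi> i)\<bar>)"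
        using bd \<eta>_pr[OF lm h, of k] pi_pr[of l] by blast
      also have "\<dots> = (\<Sum>i\<in>G. w i * \<bar>(\<Sum>p\<le>k. \<xi> i (h (l, p))) / real (Suc k) - integral\<^sup>L (\<pi> l) (\<xi> i)\<bar>)"
        using w \<eta>_int[OF lm h] by (intro sum.cong refl) simp
      finally show ?thesis using pi[of "Suc l"] by (simp add: \<Psi>_def)
    qed
    then show "\<exists>(G :: ('a \<Rightarrow> real) set) w \<xi>. finite G \<and>
          (\<forall>i\<in>G. \<xi> i \<in> bfun (S l) \<and> (\<forall>x\<in>space (S l). \<bar>\<xi> i x\<bar> \<le> 1) \<and> 0 \<le> w i) \<and>
          sum w G \<le> \<Lambda>' \<and> (\<forall>k. \<forall>h\<in>space (hist S m).
            \<bar>integral\<^sup>L (\<Psi> (Suc l) k h) g - integral\<^sup>L (\<pi> (Suc l)) g\<bar>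
              \<le> (\<Sum>i\<in>G. w i * \<bar>(\<Sum>p\<le>k. \<xi> i (h (l, p))) / real (Suc k) - integral\<^sup>L (\<pi> l) (\<xi> i)\<bar>))"
      using fin w wb \<Lambda>l[OF l] by (intro exI[of _ G] exI[of _ w] exI[of _ \<xi>]) auto
  qed
  define V where "V = IC.vconst"
  have V: "0 < V" unfolding V_def by (rule IC.vconst_pos)
  \<comment> \<open>any points: they fill the coordinates of a history that are not yet visited\<close>
  define z where "z l = (SOME x. x \<in> space (S l))" for l
  have z: "z l \<in> space (S l)" for l unfolding z_def using ne[of l] some_in_eq by blast
  have \<kappa>: "(\<Pi>\<^sub>M l\<in>{..m}. M l (level_empirical S X (l - 1) k \<omega>) (X l k \<omega>)) = IC.law k (IC.stopped z X k \<omega>)" for k \<omega>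
    unfolding IC.law_def
  proof (rule PiM_cong[OF refl])
    fix l assume l: "l \<in> {..m}"
    have "level_empirical S X (l - 1) k \<omega> = \<eta> (l - 1) k (IC.stopped z X k \<omega>)"
      unfolding level_empirical_def \<eta>_def by (rule empirical_cong) (use l in \<open>auto simp: IC.stopped_def\<close>)
    then show "M l (level_empirical S X (l - 1) k \<omega>) (X l k \<omega>) = K l k (IC.stopped z X k \<omega>) (IC.stopped z X k \<omega> (l, k))"
      using l by (simp add: K_def IC.stopped_def)
  qed
  let ?E = "\<Pi>\<^sub>M l\<in>{..m}. S l"
  have J: "joint X m p \<omega> \<in> space ?E" if "\<omega> \<in> space P" for p \<omega>
    using measurable_space[OF proc(2) that] by (auto simp: joint_def space_PiM)
  show ?thesis
  proof (intro exI[of _ "sqrt (8 * V)"] conjI ballI allI impI)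
    show "0 < sqrt (8 * V)" using V by simp
    fix f t assume f: "f \<in> bmeas1 ?E" and t: "0 < (t::real)"
    have ft: "f \<in> IC.test" unfolding IC.test_def using bmeas1_bfun[OF f] by simp
    let ?p = "\<lambda>n. measure P {\<omega> \<in> space P.
        \<bar>integral\<^sup>L (empirical ?E n (\<lambda>p. joint X m p \<omega>)) f - integral\<^sup>L (\<Pi>\<^sub>M l\<in>{..m}. \<pi> l) f\<bar> > t}"
    \<comment> \<open>the bias is at most \<open>t / 8\<close> eventually, and \<open>(7/8)\<^sup>2 > 1/2\<close> leaves room for strictness\<close>
    have t8: "0 < t / 8" using t by simp
    have tt: "t / 8 \<le> t" using t by simp
    obtain N where N0: "\<forall>n\<ge>N. \<forall>f\<in>IC.test. \<forall>s\<ge>t / 8.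
      measure P {\<omega> \<in> space P. s < \<bar>(\<Sum>p\<le>n. f (joint X m p \<omega>)) / real (Suc n) - integral\<^sup>L (\<Pi>\<^sub>M l\<in>{..m}. \<pi> l) f\<bar>}
        \<le> 2 * exp (- ((s - t / 8)\<^sup>2 * real (Suc n) / (8 * IC.vconst)))"
      using IC.process_tail[OF proc(1,2) z joint_law \<kappa> t8] by (elim exE) (rule that)
    have N: "measure P {\<omega> \<in> space P. t < \<bar>(\<Sum>p\<le>n. f (joint X m p \<omega>)) / real (Suc n) - integral\<^sup>L (\<Pi>\<^sub>M l\<in>{..m}. \<pi> l) f\<bar>}
        \<le> 2 * exp (- ((t - t / 8)\<^sup>2 * real (Suc n) / (8 * V)))" if "n \<ge> N" for n
      using N0[folded V_def, rule_format, OF that ft tt] .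
    have "?p n \<le> 2 * exp (- ((t - t / 8)\<^sup>2 / (8 * V) * real (Suc n)))" if "n \<ge> N" for n
    proof -
      have "integral\<^sup>L (empirical ?E n (\<lambda>p. joint X m p \<omega>)) f = (\<Sum>p\<le>n. f (joint X m p \<omega>)) / real (Suc n)"
        if "\<omega> \<in> space P" for \<omega>
        by (rule empirical_integral[OF J[OF that] bfun_meas[OF bmeas1_bfun(1)[OF f]]])
      then have "?p n = measure P {\<omega> \<in> space P. t < \<bar>(\<Sum>p\<le>n. f (joint X m p \<omega>)) / real (Suc n) - integral\<^sup>L (\<Pi>\<^sub>M l\<in>{..m}. \<pi> l) f\<bar>}"
        by (intro arg_cong[where f="measure P"]) auto
      then show ?thesis using N[OF that] by simp
    qed
    then have "limsup (\<lambda>n. ereal (1 / real n) * eln (?p n)) < ereal (- (t\<^sup>2 / (2 * (8 * V))))"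
    proof (rule limsup_eln_less[rotated])
      show "0 < (t - t / 8)\<^sup>2 / (8 * V)" using t V by (intro divide_pos_pos) auto
      show "t\<^sup>2 / (2 * (8 * V)) < (t - t / 8)\<^sup>2 / (8 * V)"
        using t V by (simp add: field_simps power2_eq_square)
    qed auto
    then show "limsup (\<lambda>n. ereal (1 / real n) * eln (?p n)) < ereal (- (t\<^sup>2 / (2 * (sqrt (8 * V))\<^sup>2)))"
      using V by simp
  qed
qed

end
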